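(* Let $T\in\mathcal{K}(V)$ be bisectorial of angle $\omega\in(0,\frac{\pi}{2})$, let $\theta\in(\omega,\frac{\pi}{2})$, $g\in\mathcal{N}^0(D_\theta)$, and let $p$ be an intrinsic polynomial with constant coefficient $p_0=0$. Then $p\circ g\in\mathcal{SH}_L^0(D_\theta)$ and $$(p\circ g)(T)=p[g(T)],$$ where $(p\circ g)(T)$ and $g(T)$ are given by the $\omega$-functional calculus.
   Context: Clifford setting. Fix an integer $n\geq 1$. $\mathbb{R}_n$ is the real Clifford algebra generated by $e_1,\dots,e_n$ with $e_i^2=-1$, $e_ie_j=-e_je_i$ ($i\neq j$), with basis $e_A=e_{i_1}\cdots e_{i_r}$ for $A=(i_1<\dots<i_r)$, $e_\emptyset=1$, and $|s|^2=\sum_As_A^2$ for $s=\sum_As_Ae_A$. Paravectors: $\mathbb{R}^{n+1}=\{s_0+s_1e_1+\dots+s_ne_n\}\subseteq\mathbb{R}_n$ with $\overline{s}=s_0-s_1e_1-\dots-s_ne_n$. $\mathbb{S}=\{s\in\mathbb{R}^{n+1}: s_0=0,|s|=1\}$ and $\mathbb{C}_J=\{x+Jy: x,y\in\mathbb{R}\}$ for $J\in\mathbb{S}$. $U\subseteq\mathbb{R}^{n+1}$ is axially symmetric if $x+Jy\in U$ ($x,y\in\mathbb{R}$, $J\in\mathbb{S}$) implies $x+Iy\in U$ for all $I\in\mathbb{S}$. Slice hyperholomorphic functions. For $U$ open and axially symmetric, $f:U\to\mathbb{R}_n$ is left slice hyperholomorphic ($f\in\mathcal{SH}_L(U)$)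 if there are continuously differentiable $f_0,f_1:\{(x,y)\in\mathbb{R}^2: x+\mathbb{S}y\subseteq U\}\to\mathbb{R}_n$ with $f(x+Jy)=f_0(x,y)+Jf_1(x,y)$ for all $J\in\mathbb{S}$, $f_0(x,-y)=f_0(x,y)$, $f_1(x,-y)=-f_1(x,y)$, $\partial_xf_0=\partial_yf_1$, $\partial_yf_0=-\partial_xf_1$. If $f_0,f_1$ are real valued, $f$ is called intrinsic ($f\in\mathcal{N}(U)$). Operators. $V_\mathbb{R}$ is a real Banach space, $V=\{\sum_Av_A\otimes e_A: v_A\in V_\mathbb{R}\}$ the corresponding Clifford module with norm $\|v\|^2=\sum_A\|v_A\|^2$ and the natural left and right multiplications by $\mathbb{R}_n$. $\mathcal{B}(V)$: bounded everywhere defined right-linear operators; $\mathcal{K}(V)$: closed right-linear operators $T:\operatorname{dom}(T)\to V$ with right-linear domain $\operatorname{dom}(T)\subseteq V$. A Clifford number $a$ is identified with the operator $v\mapsto av$, so $(aT)v=a(Tv)$, $(Ta)v=T(av)$. For $s\in\mathbb{R}^{n+1}$, $Q_s[T]=T^2-2s_0T+|s|^2$ on $\operatorname{dom}(T^2)$; $\rho_S(T)=\{s\in\mathbb{R}^{n+1}: Q_s[T]^{-1}\in\mathcal{B}(V)\}$, $\sigma_S(T)=\mathbb{R}^{n+1}\setminus\rho_S(T)$, and $S_L^{-1}(s,T)=Q_s[T]^{-1}\overline{s}-TQ_s[T]^{-1}$ for $s\in\rho_S(T)$. Bisectorial operators. For $\omega\in(0,\frac{\pi}{2})$, $I_\omega=(-\omega,\omega)\cup(\pi-\omega,\pi+\omega)$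 and $D_\omega=\{re^{J\phi}: r>0,\,J\in\mathbb{S},\,\phi\in I_\omega\}\subseteq\mathbb{R}^{n+1}$. $T\in\mathcal{K}(V)$ is bisectorial of angle $\omega$ if $\sigma_S(T)\subseteq\overline{D_\omega}$ and for every $\varphi\in(\omega,\frac{\pi}{2})$ there is $C_\varphi\geq 0$ with $\|S_L^{-1}(s,T)\|\leq\frac{C_\varphi}{|s|}$ for all $s\in\mathbb{R}^{n+1}\setminus(D_\varphi\cup\{0\})$. $\omega$-functional calculus. $\mathcal{SH}_L^0(D_\theta)$ is the set of bounded $f\in\mathcal{SH}_L(D_\theta)$ with $\int_0^\infty|f(te^{J\phi})|\frac{dt}{t}<\infty$ for all $J\in\mathbb{S}$, $\phi\in I_\theta$; $\mathcal{N}^0(D_\theta)$ is the set of intrinsic such functions. For $T$ bisectorial of angle $\omega$, $\theta\in(\omega,\frac{\pi}{2})$ and $f\in\mathcal{SH}_L^0(D_\theta)$, $$f(T)=\frac{1}{2\pi}\int_{\partial D_\varphi\cap\mathbb{C}_J}S_L^{-1}(s,T)ds_Jf(s):=\frac{1}{2\pi}\sum_\pm\int_\mathbb{R}S_L^{-1}(\gamma_\pm(t),T)\frac{\gamma_\pm'(t)}{J}f(\gamma_\pm(t))dt\in\mathcal{B}(V),$$ with $\gamma_\pm(t)=\pm|t|e^{-\operatorname{sgn}(t)J\varphi}$; it does not depend on the choice of $\varphi\in(\omega,\theta)$ and $J\in\mathbb{S}$. Polynomials. An intrinsic polynomial is $p(s)=p_0+p_1s+\dots+p_ms^m$ with real coefficients,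 $p_m\neq 0$; for an operator $A$, $p[A]=p_0+p_1A+\dots+p_mA^m$ with $\operatorname{dom}(p[A])=\operatorname{dom}(A^m)$. *)

theory Defs
  imports "HOL-Analysis.Analysis" "HOL-Computational_Algebra.Polynomial"
begin

section \<open>The Clifford algebra and Clifford modules\<close>

text \<open>
  The number \<open>n \<ge> 1\<close> of generators is the cardinality of a finite linearly ordered index
  type \<^typ>\<open>'n\<close>. The coordinate \<open>s $ A\<close> is the coefficient of \<open>e\<^sub>A\<close>, for \<open>A :: 'n set\<close>, and the
  library norm of \<^type>\<open>vec\<close> is the Euclidean one, i.e. \<open>(norm s)\<^sup>2 = (\<Sum>A. (norm (s $ A))\<^sup>2)\<close>.
  The library's \<open>*\<close> on \<^type>\<open>vec\<close> is componentwise and hence is not the Clifford product.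
\<close>

type_synonym 'n clifford = "(real, 'n set) vec"
type_synonym ('v, 'n) clifford_module = "('v, 'n set) vec"

text \<open>
  \<open>e\<^sub>A e\<^sub>B = cl_sign A B e\<^sub>C\<close> where \<open>C\<close> is the symmetric difference of \<open>A\<close> and \<open>B\<close>: each pair \<open>i > j\<close>
  contributes a transposition, each pair \<open>i = j\<close> the factor \<open>e\<^sub>i\<^sup>2 = -1\<close>.
\<close>

definition cl_sign :: "'n::{finite,linorder} set \<Rightarrow> 'n set \<Rightarrow> real" where
  "cl_sign A B = (- 1) ^ card {(i, j). i \<in> A \<and> j \<in> B \<and> i \<ge> j}"

text \<open>\<open>lmul a v = a v\<close> and \<open>rmul v a = v a\<close>; for \<open>'v = real\<close>, \<open>lmul\<close> is the Clifford product.\<close>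

definition lmul ::
    "'n::{finite,linorder} clifford \<Rightarrow> ('v::real_normed_vector, 'n) clifford_module
      \<Rightarrow> ('v, 'n) clifford_module" where
  "lmul a v = (\<Sum>A\<in>UNIV. \<Sum>B\<in>UNIV. axis (sym_diff A B) ((cl_sign A B * a $ A) *\<^sub>R v $ B))"

definition rmul ::
    "('v::real_normed_vector, 'n::{finite,linorder}) clifford_module \<Rightarrow> 'n clifford
      \<Rightarrow> ('v, 'n) clifford_module" where
  "rmul v a = (\<Sum>A\<in>UNIV. \<Sum>B\<in>UNIV. axis (sym_diff A B) ((cl_sign A B * a $ B) *\<^sub>R v $ A))"

definition cl_one :: "'n::{finite,linorder} clifford" where
  "cl_one = axis {} 1"

primrec cl_power :: "'n::{finite,linorder} clifford \<Rightarrow> nat \<Rightarrow> 'n clifford" where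
  "cl_power s 0 = cl_one"
| "cl_power s (Suc k) = lmul s (cl_power s k)"

definition paravectors :: "'n::{finite,linorder} clifford set" where
  "paravectors = {s. \<forall>A. s $ A \<noteq> 0 \<longrightarrow> card A \<le> 1}"

text \<open>The conjugation of paravectors (on other Clifford numbers it is not the usual one).\<close>

definition cl_cnj :: "'n::{finite,linorder} clifford \<Rightarrow> 'n clifford" where
  "cl_cnj s = (\<chi> A. if A = {} then s $ A else - s $ A)"

definition unit_sphere :: "'n::{finite,linorder} clifford set" where
  "unit_sphere = {s \<in> paravectors. s $ {} = 0 \<and> norm s = 1}"

text \<open>The point \<open>x + J y\<close>, and \<open>e\<^sup>J\<^sup>\<phi> = cos \<phi> + J sin \<phi>\<close>.\<close>

definition slice_point :: "'n::{finite,linorder} clifford \<Rightarrow> real \<Rightarrow> real \<Rightarrow> 'n clifford" where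
  "slice_point J x y = x *\<^sub>R cl_one + y *\<^sub>R J"

definition slice_cis :: "'n::{finite,linorder} clifford \<Rightarrow> real \<Rightarrow> 'n clifford" where
  "slice_cis J \<phi> = slice_point J (cos \<phi>) (sin \<phi>)"

definition axially_symmetric :: "'n::{finite,linorder} clifford set \<Rightarrow> bool" where
  "axially_symmetric U \<longleftrightarrow> U \<subseteq> paravectors \<and>
     (\<forall>x y. \<forall>J\<in>unit_sphere. slice_point J x y \<in> U \<longrightarrow> (\<forall>I\<in>unit_sphere. slice_point I x y \<in> U))"


section \<open>Slice hyperholomorphic functions\<close>

text \<open>
  Functions on \<open>U\<close> are represented by total functions whose values outside \<open>U\<close> are irrelevant.
\<close>

definition slice_domain :: "'n::{finite,linorder} clifford set \<Rightarrow> (real \<times> real) set" where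
  "slice_domain U = {(x, y). \<forall>J\<in>unit_sphere. slice_point J x y \<in> U}"

definition slice_components ::
    "'n::{finite,linorder} clifford set \<Rightarrow> ('n clifford \<Rightarrow> 'n clifford)
      \<Rightarrow> (real \<times> real \<Rightarrow> 'n clifford) \<Rightarrow> (real \<times> real \<Rightarrow> 'n clifford) \<Rightarrow> bool" where
  "slice_components U f f0 f1 \<longleftrightarrow>
     (\<forall>(x, y)\<in>slice_domain U. \<forall>J\<in>unit_sphere.
        f (slice_point J x y) = f0 (x, y) + lmul J (f1 (x, y))) \<and>
     (\<forall>(x, y)\<in>slice_domain U. f0 (x, - y) = f0 (x, y) \<and> f1 (x, - y) = - f1 (x, y)) \<and>
     (\<exists>D0 D1 :: real \<times> real \<Rightarrow> (real \<times> real) \<Rightarrow>\<^sub>L 'n clifford.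
        continuous_on (slice_domain U) D0 \<and> continuous_on (slice_domain U) D1 \<and>
        (\<forall>z\<in>slice_domain U.
           (f0 has_derivative blinfun_apply (D0 z)) (at z) \<and>
           (f1 has_derivative blinfun_apply (D1 z)) (at z) \<and>
           blinfun_apply (D0 z) (1, 0) = blinfun_apply (D1 z) (0, 1) \<and>
           blinfun_apply (D0 z) (0, 1) = - blinfun_apply (D1 z) (1, 0)))"

definition SH_L :: "'n::{finite,linorder} clifford set \<Rightarrow> ('n clifford \<Rightarrow> 'n clifford) set" where
  "SH_L U = {f. openin (top_of_set paravectors) U \<and> axially_symmetric U \<and>
     (\<exists>f0 f1. slice_components U f f0 f1)}"

definition intrinsic :: "'n::{finite,linorder} clifford set \<Rightarrow> ('n clifford \<Rightarrow> 'n clifford) set" where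
  "intrinsic U = {f. openin (top_of_set paravectors) U \<and> axially_symmetric U \<and>
     (\<exists>f0 f1. slice_components U f f0 f1 \<and>
        (\<forall>z\<in>slice_domain U. f0 z \<in> range (\<lambda>r. r *\<^sub>R cl_one) \<and> f1 z \<in> range (\<lambda>r. r *\<^sub>R cl_one)))}"

definition sector_angles :: "real \<Rightarrow> real set" where
  "sector_angles \<omega> = {- \<omega> <..< \<omega>} \<union> {pi - \<omega> <..< pi + \<omega>}"

definition double_sector :: "real \<Rightarrow> 'n::{finite,linorder} clifford set" where
  "double_sector \<omega> =
     {r *\<^sub>R slice_cis J \<phi> | r J \<phi>. 0 < r \<and> J \<in> unit_sphere \<and> \<phi> \<in> sector_angles \<omega>}"

definition SH_L0 :: "real \<Rightarrow> ('n::{finite,linorder} clifford \<Rightarrow> 'n clifford) set" where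
  "SH_L0 \<theta> = {f \<in> SH_L (double_sector \<theta>).
     bounded (f ` double_sector \<theta>) \<and>
     (\<forall>J\<in>unit_sphere. \<forall>\<phi>\<in>sector_angles \<theta>.
        (\<integral>\<^sup>+t\<in>{0<..}. ennreal (norm (f (t *\<^sub>R slice_cis J \<phi>)) / t) \<partial>lborel) < \<infinity>)}"

definition intrinsic0 :: "real \<Rightarrow> ('n::{finite,linorder} clifford \<Rightarrow> 'n clifford) set" where
  "intrinsic0 \<theta> = intrinsic (double_sector \<theta>) \<inter> SH_L0 \<theta>"


section \<open>Operators\<close>

text \<open>
  A not necessarily everywhere defined operator is a partial map, so that its domain is the library's
  \<^const>\<open>dom\<close>, its graph is \<^const>\<open>Map.graph\<close>, and equality of operators includes equality
  of the domains. Bounded everywhere defined operators are elements of \<open>\<Rightarrow>\<^sub>L\<close>, which is only real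
  linear, so right linearity over the Clifford algebra is imposed by \<open>bounded_ops\<close>.
\<close>

definition bounded_ops ::
    "(('v::real_normed_vector, 'n::{finite,linorder}) clifford_module
      \<Rightarrow>\<^sub>L ('v, 'n) clifford_module) set" where
  "bounded_ops = {B. \<forall>v a. blinfun_apply B (rmul v a) = rmul (blinfun_apply B v) a}"

definition closed_ops ::
    "(('v::real_normed_vector, 'n::{finite,linorder}) clifford_module
      \<rightharpoonup> ('v, 'n) clifford_module) set" where
  "closed_ops = {T.
     subspace (dom T) \<and>
     (\<forall>v\<in>dom T. \<forall>a. rmul v a \<in> dom T) \<and>
     (\<forall>v\<in>dom T. \<forall>w\<in>dom T. the (T (v + w)) = the (T v) + the (T w)) \<and>
     (\<forall>v\<in>dom T. \<forall>a. the (T (rmul v a)) = rmul (the (T v)) a) \<and>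
     closed (Map.graph T)}"

definition total_op :: "'a::real_normed_vector \<Rightarrow>\<^sub>L 'a \<Rightarrow> ('a \<rightharpoonup> 'a)" where
  "total_op B = (\<lambda>v. Some (blinfun_apply B v))"

primrec op_power :: "('a \<rightharpoonup> 'a) \<Rightarrow> nat \<Rightarrow> ('a \<rightharpoonup> 'a)" where
  "op_power A 0 = Some"
| "op_power A (Suc k) = A \<circ>\<^sub>m op_power A k"

definition poly_op :: "real poly \<Rightarrow> ('a::real_vector \<rightharpoonup> 'a) \<Rightarrow> ('a \<rightharpoonup> 'a)" where
  "poly_op p A = (\<lambda>v. if v \<in> dom (op_power A (degree p))
     then Some (\<Sum>k\<le>degree p. coeff p k *\<^sub>R the (op_power A k v)) else None)"

definition Q_op ::
    "'n::{finite,linorder} clifford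
      \<Rightarrow> (('v::real_normed_vector, 'n) clifford_module \<rightharpoonup> ('v, 'n) clifford_module)
      \<Rightarrow> (('v, 'n) clifford_module \<rightharpoonup> ('v, 'n) clifford_module)" where
  "Q_op s T = (\<lambda>v. if v \<in> dom (op_power T 2)
     then Some (the (op_power T 2 v) - (2 * s $ {}) *\<^sub>R the (T v) + (norm s)\<^sup>2 *\<^sub>R v) else None)"

text \<open>The graph of \<open>B\<close> is the transpose of the graph of \<open>A\<close>, i.e. \<open>A\<inverse> = B\<close> including domains.\<close>

definition is_inverse_op :: "('a::real_normed_vector \<rightharpoonup> 'a) \<Rightarrow> 'a \<Rightarrow>\<^sub>L 'a \<Rightarrow> bool" where
  "is_inverse_op A B \<longleftrightarrow> (\<forall>v w. A v = Some w \<longleftrightarrow> v = blinfun_apply B w)"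

definition S_resolvent_set ::
    "(('v::real_normed_vector, 'n::{finite,linorder}) clifford_module
      \<rightharpoonup> ('v, 'n) clifford_module) \<Rightarrow> 'n clifford set" where
  "S_resolvent_set T = {s \<in> paravectors. \<exists>B\<in>bounded_ops. is_inverse_op (Q_op s T) B}"

definition S_spectrum ::
    "(('v::real_normed_vector, 'n::{finite,linorder}) clifford_module
      \<rightharpoonup> ('v, 'n) clifford_module) \<Rightarrow> 'n clifford set" where
  "S_spectrum T = paravectors - S_resolvent_set T"

definition Q_inv ::
    "'n::{finite,linorder} clifford
      \<Rightarrow> (('v::real_normed_vector, 'n) clifford_module \<rightharpoonup> ('v, 'n) clifford_module)
      \<Rightarrow> ('v, 'n) clifford_module \<Rightarrow>\<^sub>L ('v, 'n) clifford_module" where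
  "Q_inv s T = (THE B. is_inverse_op (Q_op s T) B)"

text \<open>\<open>S\<^sub>L\<inverse>(s,T)\<close>, meaningful for \<open>s\<close> in the S-resolvent set.\<close>

definition SL_resolvent ::
    "'n::{finite,linorder} clifford
      \<Rightarrow> (('v::real_normed_vector, 'n) clifford_module \<rightharpoonup> ('v, 'n) clifford_module)
      \<Rightarrow> ('v, 'n) clifford_module \<Rightarrow> ('v, 'n) clifford_module" where
  "SL_resolvent s T = (\<lambda>v. blinfun_apply (Q_inv s T) (lmul (cl_cnj s) v)
      - the (T (blinfun_apply (Q_inv s T) v)))"

text \<open>
  The estimate below is \<open>\<parallel>S\<^sub>L\<inverse>(s,T)\<parallel> \<le> C / |s|\<close>, with the operator norm spelled out; the points
  \<open>s\<close> in question lie in the S-resolvent set by the inclusion of the spectrum.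
\<close>

definition bisectorial ::
    "real \<Rightarrow> (('v::real_normed_vector, 'n::{finite,linorder}) clifford_module
      \<rightharpoonup> ('v, 'n) clifford_module) \<Rightarrow> bool" where
  "bisectorial \<omega> T \<longleftrightarrow> T \<in> closed_ops \<and>
     S_spectrum T \<subseteq> closure (double_sector \<omega>) \<and>
     (\<forall>\<phi>\<in>{\<omega><..<pi/2}. \<exists>C\<ge>0. \<forall>s\<in>paravectors - (double_sector \<phi> \<union> {0}).
        \<forall>v. norm (SL_resolvent s T v) \<le> C / norm s * norm v)"


section \<open>The functional calculus\<close>

text \<open>The curve \<open>\<gamma>\<^sub>\<plusminus>\<close>, with \<open>\<sigma> = \<plusminus>1\<close>.\<close>

definition sector_path ::
    "real \<Rightarrow> real \<Rightarrow> 'n::{finite,linorder} clifford \<Rightarrow> real \<Rightarrow> 'n clifford" where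
  "sector_path \<sigma> \<phi> J t = (\<sigma> * \<bar>t\<bar>) *\<^sub>R slice_cis J (- sgn t * \<phi>)"

text \<open>
  \<open>f(T)\<close> computed with the angle \<open>\<phi>\<close> and the imaginary unit \<open>J\<close>. Dividing by \<open>J\<close> is multiplying
  by \<open>- J\<close>, as \<open>J\<^sup>2 = -1\<close>. The integral is the library's Banach space valued one, in operator norm,
  its integrand being the operator \<open>S\<^sub>L\<inverse>(s,T) \<circ> (\<gamma>'(t) / J) f(s)\<close> for \<open>s = \<gamma>(t)\<close>; the path is not
  differentiable at the single, negligible, parameter \<open>t = 0\<close>.
\<close>

definition omega_calculus ::
    "real \<Rightarrow> 'n::{finite,linorder} clifford
      \<Rightarrow> (('v::banach, 'n) clifford_module \<rightharpoonup> ('v, 'n) clifford_module)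
      \<Rightarrow> ('n clifford \<Rightarrow> 'n clifford)
      \<Rightarrow> ('v, 'n) clifford_module \<Rightarrow>\<^sub>L ('v, 'n) clifford_module" where
  "omega_calculus \<phi> J T f = (1 / (2 * pi)) *\<^sub>R
     (\<Sum>\<sigma>\<in>{1, - 1}. integral UNIV (\<lambda>t. Blinfun (\<lambda>v.
        SL_resolvent (sector_path \<sigma> \<phi> J t) T
          (lmul (lmul (lmul (vector_derivative (sector_path \<sigma> \<phi> J) (at t)) (- J))
                      (f (sector_path \<sigma> \<phi> J t))) v))))"

definition poly_comp ::
    "real poly \<Rightarrow> ('n::{finite,linorder} clifford \<Rightarrow> 'n clifford) \<Rightarrow> ('n clifford \<Rightarrow> 'n clifford)" where
  "poly_comp p g = (\<lambda>s. \<Sum>k\<le>degree p. coeff p k *\<^sub>R cl_power (g s) k)"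

end

theory Submission
  imports Defs "HOL-Complex_Analysis.Complex_Analysis"
begin

text \<open>
  Right multiplication with a fixed imaginary unit makes the module a complex vector space on which
  \<open>T\<close> is complex linear, and \<open>R(z) v = Q\<^sub>z[T]\<inverse> (v cnj z) - T Q\<^sub>z[T]\<inverse> v\<close> is the resolvent \<open>(z - T)\<inverse>\<close>. An
  intrinsic function is a holomorphic function \<open>f\<close> of one complex variable that commutes with
  conjugation. In the contour integral the contributions of \<open>s\<close> and its conjugate add up to real
  multiples of \<open>Q\<^sub>s[T]\<inverse>\<close> and \<open>T Q\<^sub>s[T]\<inverse>\<close>, so \<open>f(T)\<close> is the Riesz-Dunford integral of \<open>f(z) R(z)\<close> over the
  boundary of the planar bisector, whatever the imaginary unit. Cauchy's theorem makes this integral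
  independent of the angle, and the resolvent identity with Cauchy's formula makes it multiplicative,
  when the two factors are integrated over different angles.

  In the coordinate \<open>\<zeta> = log z\<close> rays become horizontal lines. A bounded holomorphic function on a strip
  that is integrable along every line tends to \<open>0\<close> uniformly at the ends of smaller strips, which
  justifies the shifts of the line of integration.
\<close>

section \<open>Improper integrals of Banach space valued functions\<close>

text \<open>Scalars acting from the left do not commute with \<open>T\<close>, so products of left
  S-resolvents obey no resolvent identity of the classical form. Right multiplication commutes with
  \<open>T\<close> by right linearity, which restores it. The price is that \<open>R(z)\<close>
  commutes only with right multiplication by the slice of \<open>J\<close>, and that it matches the
  integrand of the calculus only after summation over conjugate points. The analysis is therefore
  done for an abstract resolvent, and Clifford numbers enter at both ends only. Two angles are
  needed for products because \<open>1 / (w - z)\<close> is singular on a common contour. Between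
  rays of different angles \<open>norm (w - z)\<close> is at least a fixed multiple of the modulus,
  a scale invariant bound that fits the measure \<open>dt / t\<close>. The condition on the constant
  coefficient enters because a nonzero constant is not integrable for \<open>dt / t\<close>: only
  powers with positive exponent are ever integrated. The contours are unbounded and have a corner at
  0, so Cauchy's formula is not obtained by closing them but by comparison with
  \<open>1 / sinh\<close>, whose integrals along lines are explicit.\<close>

text \<open>
  The Bochner integral requires a second countable range, which spaces of operators lack. All
  integrals here are gauge integrals, evaluated by antiderivatives that extend continuously to the
  singular end points.
\<close>

lemma has_integral_UNIV_antiderivative:
  fixes A :: "real \<Rightarrow> 'a::banach"
  assumes S: "finite S" and cont: "continuous_on UNIV A"
    and der: "\<And>x. x \<notin> S \<Longrightarrow> (A has_vector_derivative H x) (at x)"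
    and top: "(A \<longlongrightarrow> b) at_top" and bot: "(A \<longlongrightarrow> a) at_bot"
  shows "(H has_integral (b - a)) UNIV"
proof -
  have int: "(H has_integral (A y - A x)) (cbox x y)" if "x \<le> y" for x y
    unfolding interval_cbox[symmetric]
    by (rule fundamental_theorem_of_calculus_interior_strong[OF S that])
       (auto intro: der continuous_on_subset[OF cont])
  show ?thesis
    unfolding has_integral_alt'
  proof (intro conjI allI impI, simp_all only: UNIV_I if_True)
    fix x y :: real
    show "H integrable_on cbox x y"
      using int[of x y] by (cases "x \<le> y") (auto simp: integrable_on_def)
  next
    fix e :: real assume e: "0 < e"
    obtain N1 where N1: "\<And>x. x \<ge> N1 \<Longrightarrow> dist (A x) b < e / 2"
      using tendstoD[OF top, of "e/2"] e by (auto simp: eventually_at_top_linorder)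
    obtain N2 where N2: "\<And>x. x \<le> N2 \<Longrightarrow> dist (A x) a < e / 2"
      using tendstoD[OF bot, of "e/2"] e by (auto simp: eventually_at_bot_linorder)
    define B where "B = max 1 (max N1 (- N2)) + 1"
    have B: "B > 1" "N1 \<le> B - 1" "- N2 \<le> B - 1" by (auto simp: B_def)
    show "\<exists>B>0. \<forall>x y. ball 0 B \<subseteq> cbox x y \<longrightarrow> norm (integral (cbox x y) H - (b - a)) < e"
    proof (intro exI conjI allI impI)
      show "B > 0" using B by simp
      fix x y :: real assume sub: "ball 0 B \<subseteq> cbox x y"
      have "B - 1 \<in> cbox x y" "- (B - 1) \<in> cbox x y"
        using sub B by (auto simp: subset_iff dist_real_def)
      then have xy: "x \<le> - (B - 1)" "B - 1 \<le> y" "x \<le> y" by auto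
      have "integral (cbox x y) H - (b - a) = (A y - b) - (A x - a)"
        using integral_unique[OF int[OF xy(3)]] by simp
      moreover have "norm (A y - b) < e / 2" "norm (A x - a) < e / 2"
        using N1[of y] N2[of x] xy B by (auto simp: dist_norm)
      ultimately show "norm (integral (cbox x y) H - (b - a)) < e"
        by (smt (verit) norm_triangle_ineq4 field_sum_of_halves)
    qed
  qed
qed

text \<open>Freezing \<open>A\<close> at its limit \<open>a\<close> on the left half line gives a
  continuous function on the whole line, for which 0 is the only exceptional point.\<close>

lemma has_integral_Ioi_antiderivative:
  fixes A :: "real \<Rightarrow> 'a::banach"
  assumes der: "\<And>x. x > 0 \<Longrightarrow> (A has_vector_derivative h x) (at x)"
    and top: "(A \<longlongrightarrow> b) at_top" and right: "(A \<longlongrightarrow> a) (at_right 0)"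
  shows "(h has_integral (b - a)) {0<..}"
proof -
  define B where "B x = (if x \<le> 0 then a else A x)" for x
  have derB: "(B has_vector_derivative (if x > 0 then h x else 0)) (at x)" if "x \<notin> {0}" for x
  proof (cases "x > 0")
    case True
    then have "(B has_vector_derivative h x) (at x)"
      by (intro has_vector_derivative_transform_within_open[OF der, where S = "{0<..}"])
         (auto simp: B_def)
    then show ?thesis using True by simp
  next
    case False
    then have x: "x < 0" using that by auto
    then have "(B has_vector_derivative 0) (at x)"
      by (intro has_vector_derivative_transform_within_open[OF has_vector_derivative_const[of a], where S = "{..<0}"])
         (auto simp: B_def)
    then show ?thesis using x by simp
  qed
  have B0: "isCont B 0"
  proof -
    have "(B \<longlongrightarrow> a) (at_right 0)"
      using right by (rule Lim_transform_eventually) (auto simp: B_def eventually_at_filter)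
    moreover have "(B \<longlongrightarrow> a) (at_left 0)"
      by (rule Lim_transform_eventually[OF tendsto_const]) (auto simp: B_def eventually_at_filter)
    ultimately show ?thesis by (simp add: isCont_def filterlim_split_at B_def)
  qed
  have "isCont B x" for x
    using B0 derB[of x] by (cases "x = 0") (auto intro: has_vector_derivative_continuous)
  then have "continuous_on UNIV B" by (simp add: continuous_at_imp_continuous_on)
  moreover have "(B \<longlongrightarrow> b) at_top"
    using top by (rule Lim_transform_eventually)
      (auto simp: B_def intro: eventually_mono[OF eventually_gt_at_top[of 0]])
  moreover have "(B \<longlongrightarrow> a) at_bot"
    by (rule Lim_transform_eventually[OF tendsto_const])
      (auto simp: B_def intro: eventually_mono[OF eventually_le_at_bot[of 0]])
  ultimately have "((\<lambda>x. if x > 0 then h x else 0) has_integral (b - a)) UNIV"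
    using derB by (intro has_integral_UNIV_antiderivative[of "{0}"]) auto
  then show ?thesis
    using has_integral_restrict_UNIV[of "{0<..}" h "b - a"] by (simp add: greaterThan_iff)
qed

section \<open>Antiderivatives of dominated functions\<close>

lemma tendsto_at_top_Cauchy:
  fixes A :: "real \<Rightarrow> 'a::banach"
  assumes "\<And>e. e > 0 \<Longrightarrow> \<exists>N. \<forall>x\<ge>N. \<forall>y\<ge>x. norm (A y - A x) < e"
  shows "\<exists>b. (A \<longlongrightarrow> b) at_top"
proof -
  have "Cauchy (\<lambda>n. A (real n))"
    unfolding Cauchy_altdef2
  proof (intro allI impI)
    fix e :: real assume "e > 0"
    then obtain N where N: "\<And>x y. x \<ge> N \<Longrightarrow> y \<ge> x \<Longrightarrow> norm (A y - A x) < e"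
      using assms by blast
    show "\<exists>M. \<forall>n\<ge>M. dist (A (real n)) (A (real M)) < e"
      by (intro exI[of _ "nat \<lceil>N\<rceil>"] allI impI)
         (auto simp: dist_norm intro!: N, linarith)
  qed
  then obtain b where b: "(\<lambda>n. A (real n)) \<longlonglongrightarrow> b"
    by (metis Cauchy_convergent_iff convergentD)
  have "(A \<longlongrightarrow> b) at_top"
  proof (rule tendstoI)
    fix e :: real assume e: "e > 0"
    then obtain N where N: "\<And>x y. x \<ge> N \<Longrightarrow> y \<ge> x \<Longrightarrow> norm (A y - A x) < e / 2"
      using assms[of "e/2"] by auto
    have "dist (A x) b < e" if "x \<ge> N" for x
    proof -
      have "\<forall>\<^sub>F n in sequentially. norm (A (real n) - A x) \<le> e / 2"
        using eventually_ge_at_top[of "nat \<lceil>x\<rceil>"]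
      proof eventually_elim
        case (elim n)
        then have "x \<le> real n" by linarith
        then show ?case using N[OF that, of "real n"] by simp
      qed
      then have "norm (b - A x) \<le> e / 2"
        by (rule tendsto_upperbound[rotated])
           (auto intro!: tendsto_intros b)
      then show ?thesis using e by (simp add: dist_norm norm_minus_commute)
    qed
    then show "\<forall>\<^sub>F x in at_top. dist (A x) b < e"
      by (auto simp: eventually_at_top_linorder)
  qed
  then show ?thesis by blast
qed

lemma antiderivative_UNIV:
  fixes H :: "real \<Rightarrow> 'a::banach"
  assumes "continuous_on UNIV H"
  obtains A where "\<And>x. (A has_vector_derivative H x) (at x)"
    and "\<And>x y. x \<le> y \<Longrightarrow> integral {x..y} H = A y - A x"
proof -
  have cont: "continuous_on S H" for S using assms continuous_on_subset by blast
  have io: "H integrable_on {x..y}" for x y by (intro integrable_continuous_real cont)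
  define A where "A x = (if x \<ge> 0 then integral {0..x} H else - integral {x..0} H)" for x
  have A: "A y - A x = integral {x..y} H" if "x \<le> y" for x y
    using that Henstock_Kurzweil_Integration.integral_combine[of x 0 y H]
      Henstock_Kurzweil_Integration.integral_combine[of 0 x y H]
      Henstock_Kurzweil_Integration.integral_combine[of x y 0 H] io
    by (auto simp: A_def algebra_simps)
  have der: "(A has_vector_derivative H x) (at x)" for x
  proof -
    \<comment> \<open>The base point \<open>x - 1\<close> puts \<open>x\<close> into the interior of
      the interval, so the derivative is two-sided. Near \<open>x\<close> the function
      \<open>A\<close> differs from this integral by a constant.\<close>
    have "((\<lambda>y. integral {x-1..y} H) has_vector_derivative H x) (at x within {x-1..x+1})"
      by (rule integral_has_vector_derivative) (auto intro: cont)
    then have "((\<lambda>y. integral {x-1..y} H) has_vector_derivative H x) (at x)"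
      by (simp add: at_within_Icc_at)
    then have "((\<lambda>y. A (x - 1) + integral {x-1..y} H) has_vector_derivative H x) (at x)"
      by (auto intro!: derivative_eq_intros)
    then show ?thesis
    proof (rule has_vector_derivative_transform_within_open[of _ _ _ "{x-1<..}"])
      fix y assume "y \<in> {x-1<..}"
      then show "A (x - 1) + integral {x-1..y} H = A y"
        using A[of "x - 1" y] by (simp add: algebra_simps)
    qed auto
  qed
  show ?thesis using that[of A] der A by metis
qed

text \<open>The Cauchy criterion is applied to two boxes that both cover a large ball and differ by
  \<open>{x..y}\<close> only.\<close>

lemma integrable_on_UNIV_tail:
  fixes k :: "real \<Rightarrow> real"
  assumes k: "k integrable_on UNIV" and e: "e > 0"
  shows "\<exists>B>0. \<forall>x y. x \<le> y \<longrightarrow> (B \<le> x \<or> y \<le> - B) \<longrightarrow> integral {x..y} k < e"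
proof -
  have kio: "k integrable_on {x..y}" for x y
    using integrable_on_subcbox[OF k, of x y] by simp
  obtain B where B: "B > 0" and *: "\<And>a b c d. ball 0 B \<subseteq> cbox a b \<Longrightarrow> ball 0 B \<subseteq> cbox c d \<Longrightarrow>
      norm (integral (cbox a b) k - integral (cbox c d) k) < e"
    using integrable_altD(2)[OF k e] by auto
  have sub: "ball 0 B \<subseteq> cbox a b" if "a \<le> - B" "B \<le> b" for a b :: real
    using that by (auto simp: dist_real_def)
  have "integral {x..y} k < e" if "x \<le> y" "B \<le> x" for x y
  proof -
    have "integral {-B..x} k + integral {x..y} k = integral {-B..y} k"
      by (rule Henstock_Kurzweil_Integration.integral_combine) (use that B kio in auto)
    then show ?thesis using *[OF sub[of "-B" y] sub[of "-B" x]] that by auto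
  qed
  moreover have "integral {x..y} k < e" if "x \<le> y" "y \<le> - B" for x y
  proof -
    have "integral {x..y} k + integral {y..B} k = integral {x..B} k"
      by (rule Henstock_Kurzweil_Integration.integral_combine) (use that B kio in auto)
    then show ?thesis using *[OF sub[of x B] sub[of y B]] that by auto
  qed
  ultimately show ?thesis using B by blast
qed

text \<open>Increments of \<open>A\<close> are bounded by integrals of \<open>k\<close>, whose tails
  are small, so \<open>A\<close> is Cauchy at both ends. This takes the place of dominated
  convergence for Banach space valued functions.\<close>

lemma dominated_antiderivative:
  fixes H :: "real \<Rightarrow> 'a::banach"
  assumes cont: "continuous_on UNIV H" and bnd: "\<And>u. norm (H u) \<le> k u"
    and k: "k integrable_on UNIV"
  obtains A a b where "\<And>x. (A has_vector_derivative H x) (at x)"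
    and "(A \<longlongrightarrow> a) at_bot" and "(A \<longlongrightarrow> b) at_top"
proof -
  obtain A where A: "\<And>x. (A has_vector_derivative H x) (at x)"
    and AI: "\<And>x y. x \<le> y \<Longrightarrow> integral {x..y} H = A y - A x"
    by (rule antiderivative_UNIV[OF cont]) blast
  have kio: "k integrable_on {x..y}" for x y
    using integrable_on_subcbox[OF k, of x y] by simp
  have kb: "norm (A y - A x) \<le> integral {x..y} k" if "x \<le> y" for x y
    unfolding AI[OF that, symmetric]
    by (rule integral_norm_bound_integral)
       (auto intro: kio integrable_continuous_real continuous_on_subset[OF cont] bnd)
  note tail = integrable_on_UNIV_tail[OF k]
  have "\<exists>b. (A \<longlongrightarrow> b) at_top"
  proof (rule tendsto_at_top_Cauchy)
    fix e :: real assume "e > 0"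
    then show "\<exists>N. \<forall>x\<ge>N. \<forall>y\<ge>x. norm (A y - A x) < e"
      using tail[of e] kb by (metis order_le_less_trans)
  qed
  moreover have "\<exists>b. ((\<lambda>x. A (- x)) \<longlongrightarrow> b) at_top"
  proof (rule tendsto_at_top_Cauchy)
    fix e :: real assume "e > 0"
    then obtain B where B: "\<And>x y. x \<le> y \<Longrightarrow> y \<le> - B \<Longrightarrow> integral {x..y} k < e"
      using tail[of e] by metis
    show "\<exists>N. \<forall>x\<ge>N. \<forall>y\<ge>x. norm (A (- y) - A (- x)) < e"
    proof (intro exI allI impI)
      fix x y assume "B \<le> x" "x \<le> y"
      then show "norm (A (- y) - A (- x)) < e"
        using B[of "-y" "-x"] kb[of "-y" "-x"] by (simp add: norm_minus_commute)
    qed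
  qed
  ultimately show ?thesis
    using that[of A] A unfolding filterlim_at_bot_mirror by metis
qed

lemma integrable_on_UNIV_dominated:
  fixes H :: "real \<Rightarrow> 'a::banach"
  assumes cont: "continuous_on UNIV H" and bnd: "\<And>u. norm (H u) \<le> k u"
    and k: "k integrable_on UNIV"
  shows "H integrable_on UNIV"
proof -
  obtain A a b where A: "\<And>x. (A has_vector_derivative H x) (at x)"
    and lim: "(A \<longlongrightarrow> a) at_bot" "(A \<longlongrightarrow> b) at_top"
    by (rule dominated_antiderivative[OF assms]) blast
  have "(H has_integral (b - a)) UNIV"
    by (rule has_integral_UNIV_antiderivative[of "{}" A])
       (use A lim in \<open>auto intro: continuous_at_imp_continuous_on has_vector_derivative_continuous\<close>)
  then show ?thesis by blast
qed

text \<open>The substitution \<open>t = exp u\<close> read on antiderivatives: if \<open>A\<close>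
  belongs to the integrand in \<open>u\<close>, then \<open>A \<circ> ln\<close> belongs to
  \<open>h\<close>, and the two ends of the line correspond to 0 and infinity.\<close>

lemma has_integral_Ioi_exp_substitution:
  fixes h :: "real \<Rightarrow> 'a::banach"
  assumes cont: "continuous_on UNIV (\<lambda>u. exp u *\<^sub>R h (exp u))"
    and bnd: "\<And>u. norm (exp u *\<^sub>R h (exp u)) \<le> k u" and k: "k integrable_on UNIV"
  shows "(h has_integral integral UNIV (\<lambda>u. exp u *\<^sub>R h (exp u))) {0<..}"
proof -
  let ?H = "\<lambda>u. exp u *\<^sub>R h (exp u)"
  obtain A a b where A: "\<And>x. (A has_vector_derivative ?H x) (at x)"
    and lim: "(A \<longlongrightarrow> a) at_bot" "(A \<longlongrightarrow> b) at_top"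
    by (rule dominated_antiderivative[OF assms]) blast
  have "(?H has_integral (b - a)) UNIV"
    by (rule has_integral_UNIV_antiderivative[of "{}" A])
       (use A lim in \<open>auto intro: continuous_at_imp_continuous_on has_vector_derivative_continuous\<close>)
  then have I: "integral UNIV ?H = b - a" by (rule integral_unique)
  have "((A \<circ> ln) has_vector_derivative h x) (at x)" if "x > 0" for x
  proof -
    have "((A \<circ> ln) has_vector_derivative ((1 / x) *\<^sub>R ?H (ln x))) (at x)"
      by (rule vector_diff_chain_at)
         (use that A[of "ln x"] in \<open>auto intro!: derivative_eq_intros
            simp: has_real_derivative_iff_has_vector_derivative[symmetric] divide_inverse\<close>)
    then show ?thesis using that by simp
  qed
  moreover have "((A \<circ> ln) \<longlongrightarrow> b) at_top"
    unfolding o_def by (rule filterlim_compose[OF lim(2) ln_at_top])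
  moreover have "((A \<circ> ln) \<longlongrightarrow> a) (at_right 0)"
    unfolding o_def by (rule filterlim_compose[OF lim(1) ln_at_0])
  ultimately show ?thesis
    unfolding I by (intro has_integral_Ioi_antiderivative[of "A \<circ> ln"])
qed

lemma tendsto_integral_symmetric:
  fixes H :: "real \<Rightarrow> 'a::banach"
  assumes "H integrable_on UNIV"
  shows "((\<lambda>N. integral {-N..N} H) \<longlongrightarrow> integral UNIV H) at_top"
proof (rule tendstoI)
  fix e :: real assume "e > 0"
  have "(H has_integral integral UNIV H) UNIV" using assms by (rule integrable_integral)
  then obtain B where B: "B > 0"
    "\<And>a b. ball 0 B \<subseteq> cbox a b \<Longrightarrow> norm (integral (cbox a b) H - integral UNIV H) < e"
    unfolding has_integral_alt' using \<open>e > 0\<close> by auto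
  have "dist (integral {-N..N} H) (integral UNIV H) < e" if "N \<ge> B" for N
  proof -
    have "ball 0 B \<subseteq> cbox (-N) N" using that by (auto simp: dist_real_def)
    then show ?thesis using B(2)[of "-N" N] by (simp add: dist_norm)
  qed
  then show "\<forall>\<^sub>F N in at_top. dist (integral {-N..N} H) (integral UNIV H) < e"
    by (auto simp: eventually_at_top_linorder)
qed

section \<open>Shifting the line of integration\<close>

lemma has_derivative_Complex_line:
  "((\<lambda>u. Complex u \<alpha>) has_derivative (\<lambda>h. Complex h 0)) (at u within S)"
  "((\<lambda>\<alpha>. Complex u \<alpha>) has_derivative (\<lambda>h. Complex 0 h)) (at \<alpha> within S)"
  by (auto simp: Complex_eq intro!: derivative_eq_intros)

text \<open>
  \<open>\<Phi>\<close> is holomorphic with derivative \<open>\<Phi>'\<close> for the complex structure in which \<open>J\<close> is multiplication by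
  the imaginary unit.
\<close>

lemma integral_line_shift:
  fixes \<Phi> \<Phi>' :: "complex \<Rightarrow> 'a::banach" and J :: "'a \<Rightarrow> 'a"
  assumes J: "bounded_linear J" and ab: "a \<le> b"
    and der: "\<And>z. Im z \<in> {a..b} \<Longrightarrow>
      (\<Phi> has_derivative (\<lambda>h. Re h *\<^sub>R \<Phi>' z + Im h *\<^sub>R J (\<Phi>' z))) (at z)"
    and cont: "continuous_on {z. Im z \<in> {a..b}} \<Phi>'"
    and decay: "\<And>e. e > 0 \<Longrightarrow> \<exists>N. \<forall>z. Im z \<in> {a..b} \<longrightarrow> N \<le> \<bar>Re z\<bar> \<longrightarrow> norm (\<Phi> z) \<le> e"
    and ia: "(\<lambda>u. \<Phi> (Complex u a)) integrable_on UNIV"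
    and ib: "(\<lambda>u. \<Phi> (Complex u b)) integrable_on UNIV"
  shows "integral UNIV (\<lambda>u. \<Phi> (Complex u a)) = integral UNIV (\<lambda>u. \<Phi> (Complex u b))"
proof -
  interpret J: bounded_linear J by (rule J)
  obtain K where K: "K > 0" "\<And>x. norm (J x) \<le> norm x * K" using J.pos_bounded by blast
  have du: "((\<lambda>u. \<Phi> (Complex u \<alpha>)) has_vector_derivative \<Phi>' (Complex u \<alpha>)) (at u within S)"
    if "\<alpha> \<in> {a..b}" for u \<alpha> S
    using has_derivative_compose[OF has_derivative_Complex_line(1) der, of u \<alpha> S] that
    by (simp add: has_vector_derivative_def)
  have da: "((\<lambda>\<alpha>. \<Phi> (Complex u \<alpha>)) has_vector_derivative J (\<Phi>' (Complex u \<alpha>))) (at \<alpha> within S)"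
    if "\<alpha> \<in> {a..b}" for u \<alpha> S
    using has_derivative_compose[OF has_derivative_Complex_line(2) der, of u \<alpha> S] that
    by (simp add: has_vector_derivative_def)
  have cPhi: "continuous_on UNIV (\<lambda>u. \<Phi> (Complex u \<alpha>))" if "\<alpha> \<in> {a..b}" for \<alpha>
    by (intro continuous_at_imp_continuous_on ballI has_vector_derivative_continuous[OF du[OF that]])
  have cPhi': "continuous_on S (\<lambda>u. \<Phi>' (Complex u \<alpha>))" if "\<alpha> \<in> {a..b}" for \<alpha> S
    by (rule continuous_on_compose2[OF cont])
       (use that in \<open>auto simp: Complex_eq intro!: continuous_intros\<close>)
  \<comment> \<open>By Leibniz' rule the derivative of \<open>P L\<close> is a boundary term, small for large \<open>L\<close>.\<close>
  define P where "P L \<alpha> = integral (cbox (-L) L) (\<lambda>u. \<Phi> (Complex u \<alpha>))" for L \<alpha>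
  have dP: "(P L has_vector_derivative J (\<Phi> (Complex L \<alpha>) - \<Phi> (Complex (-L) \<alpha>))) (at \<alpha> within {a..b})"
    if "\<alpha> \<in> {a..b}" "L \<ge> 0" for L \<alpha>
  proof -
    have "(P L has_vector_derivative integral (cbox (-L) L) (\<lambda>u. J (\<Phi>' (Complex u \<alpha>)))) (at \<alpha> within {a..b})"
      unfolding P_def
    proof (rule leibniz_rule_vector_derivative[OF da])
      show "continuous_on ({a..b} \<times> cbox (- L) L) (\<lambda>(\<alpha>, u). J (\<Phi>' (Complex u \<alpha>)))"
        unfolding split_beta
        by (intro J.continuous_on continuous_on_compose2[OF cont])
           (auto simp: Complex_eq intro!: continuous_intros)
    qed (use that in \<open>auto intro!: integrable_continuous_real continuous_on_subset[OF cPhi]\<close>)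
    moreover have "((\<lambda>u. \<Phi>' (Complex u \<alpha>)) has_integral (\<Phi> (Complex L \<alpha>) - \<Phi> (Complex (-L) \<alpha>))) (cbox (-L) L)"
      unfolding interval_cbox[symmetric]
      by (rule fundamental_theorem_of_calculus) (use that in \<open>auto intro!: du\<close>)
    then have "integral (cbox (-L) L) (\<lambda>u. J (\<Phi>' (Complex u \<alpha>))) = J (\<Phi> (Complex L \<alpha>) - \<Phi> (Complex (-L) \<alpha>))"
      using has_integral_linear[OF _ J] by (auto simp: o_def intro: integral_unique)
    ultimately show ?thesis by simp
  qed
  have "((\<lambda>L. P L a - P L b) \<longlongrightarrow> 0) at_top"
  proof (rule tendstoI)
    fix e :: real assume e: "e > 0"
    \<comment> \<open>The mean value bound is at most \<open>2 * d * K * c\<close>, which the choice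
      of \<open>d\<close> makes equal to \<open>e / 2\<close>. The summand 1 keeps \<open>c\<close>
      positive when \<open>a = b\<close>.\<close>
    define c where "c = b - a + 1"
    have c: "c > 0" using ab by (simp add: c_def)
    define d where "d = e / (2 * (2 * K * c))"
    have d: "d > 0" using e K c by (simp add: d_def)
    then obtain N where N: "\<And>z. Im z \<in> {a..b} \<Longrightarrow> N \<le> \<bar>Re z\<bar> \<Longrightarrow> norm (\<Phi> z) \<le> d"
      using decay by blast
    have "dist (P L a - P L b) 0 < e" if L: "L \<ge> max N 0" for L
    proof -
      have "norm (P L a - P L b) \<le> (2 * d * K) * norm (a - b)"
      proof (rule differentiable_bound[OF convex_real_interval(5)])
        fix \<alpha> assume al: "\<alpha> \<in> {a..b}"
        show "(P L has_derivative (\<lambda>h. h *\<^sub>R J (\<Phi> (Complex L \<alpha>) - \<Phi> (Complex (-L) \<alpha>)))) (at \<alpha> within {a..b})"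
          using dP[OF al, of L] L by (simp add: has_vector_derivative_def)
        have "norm (\<Phi> (Complex L \<alpha>) - \<Phi> (Complex (-L) \<alpha>)) \<le> d + d"
          using N[of "Complex L \<alpha>"] N[of "Complex (-L) \<alpha>"] al L
          by (intro order_trans[OF norm_triangle_ineq4] add_mono) auto
        then have "norm (J (\<Phi> (Complex L \<alpha>) - \<Phi> (Complex (-L) \<alpha>))) \<le> 2 * d * K"
          using K by (intro order_trans[OF K(2)] mult_right_mono) auto
        then show "onorm (\<lambda>h. h *\<^sub>R J (\<Phi> (Complex L \<alpha>) - \<Phi> (Complex (-L) \<alpha>))) \<le> 2 * d * K"
          by (intro onorm_le) (auto simp: mult.commute intro!: mult_left_mono)
      qed (use ab in auto)
      also have "\<dots> \<le> (2 * d * K) * c"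
        using d K ab by (intro mult_left_mono) (auto simp: c_def)
      also have "\<dots> = e / 2" using K(1) c by (simp add: d_def)
      finally show ?thesis using e by (simp add: dist_norm)
    qed
    then show "\<forall>\<^sub>F L in at_top. dist (P L a - P L b) 0 < e"
      unfolding eventually_at_top_linorder by blast
  qed
  moreover have "((\<lambda>L. P L a - P L b) \<longlongrightarrow>
      integral UNIV (\<lambda>u. \<Phi> (Complex u a)) - integral UNIV (\<lambda>u. \<Phi> (Complex u b))) at_top"
    unfolding P_def interval_cbox[symmetric]
    by (intro tendsto_diff tendsto_integral_symmetric ia ib)
  ultimately have "0 = integral UNIV (\<lambda>u. \<Phi> (Complex u a)) - integral UNIV (\<lambda>u. \<Phi> (Complex u b))"
    by (rule tendsto_unique[OF trivial_limit_at_top_linorder])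
  then show ?thesis by simp
qed

text \<open>Cutting off the inner integral at \<open>N\<close> costs at most \<open>k u\<close>
  times the tail of \<open>l\<close>. Integrated over \<open>u\<close> this is at most the integral
  of \<open>k\<close> times that tail, which tends to 0.\<close>

lemma tendsto_integral_box:
  fixes \<Phi> :: "real \<Rightarrow> real \<Rightarrow> 'a::banach"
  assumes cont: "continuous_on UNIV (\<lambda>(u, v). \<Phi> u v)"
    and bnd: "\<And>u v. norm (\<Phi> u v) \<le> k u * l v"
    and k: "k integrable_on UNIV" and l: "l integrable_on UNIV"
    and k0: "\<And>u. 0 \<le> k u" and l0: "\<And>v. 0 \<le> l v"
    and I: "(\<lambda>u. integral UNIV (\<Phi> u)) integrable_on UNIV"
  shows "((\<lambda>N. integral {-N..N} (\<lambda>u. integral {-N..N} (\<Phi> u))) \<longlongrightarrow>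
    integral UNIV (\<lambda>u. integral UNIV (\<Phi> u))) at_top"
proof -
  have "continuous_on UNIV (\<lambda>v. (u, v))" for u :: real by (intro continuous_intros)
  from continuous_on_compose2[OF cont this] have cv: "continuous_on UNIV (\<Phi> u)" for u by simp
  have sub: "f integrable_on {x..y}" if "f integrable_on UNIV" for f :: "real \<Rightarrow> 'b::banach" and x y
    using integrable_on_subcbox[OF that, of x y] by simp
  have Phi: "\<Phi> u integrable_on UNIV" for u
    by (rule integrable_on_UNIV_dominated[OF cv bnd]) (use integrable_on_cmult_left[OF l] in simp)
  have tail: "norm (integral UNIV (\<Phi> u) - integral {-N..N} (\<Phi> u))
      \<le> k u * (integral UNIV l - integral {-N..N} l)" for u N
  proof -
    have r: "(\<lambda>v. if v \<in> {-N..N} then f v else 0) integrable_on UNIV"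
      if "f integrable_on UNIV" for f :: "real \<Rightarrow> 'b::banach"
      using that sub integrable_restrict_UNIV by blast
    have e: "integral UNIV (\<lambda>v. f v - (if v \<in> {-N..N} then f v else 0))
        = integral UNIV f - integral {-N..N} f"
      if "f integrable_on UNIV" for f :: "real \<Rightarrow> 'b::banach"
      using integral_diff[OF that r[OF that]] by (simp only: integral_restrict_UNIV)
    have "norm (integral UNIV (\<lambda>v. \<Phi> u v - (if v \<in> {-N..N} then \<Phi> u v else 0)))
        \<le> integral UNIV (\<lambda>v. k u * (l v - (if v \<in> {-N..N} then l v else 0)))"
    proof (rule integral_norm_bound_integral)
      show "(\<lambda>v. \<Phi> u v - (if v \<in> {-N..N} then \<Phi> u v else 0)) integrable_on UNIV"
        by (intro integrable_diff r Phi)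
      show "(\<lambda>v. k u * (l v - (if v \<in> {-N..N} then l v else 0))) integrable_on UNIV"
        using integrable_cmul[OF integrable_diff[OF l r[OF l]], of "k u"] by simp
    qed (use bnd in auto)
    then show ?thesis unfolding e[OF Phi] integral_mult_right e[OF l] by simp
  qed
  have "((\<lambda>N. integral {-N..N} (\<lambda>u. integral UNIV (\<Phi> u)) - integral {-N..N} (\<lambda>u. integral {-N..N} (\<Phi> u)))
      \<longlongrightarrow> 0) at_top"
  proof (rule Lim_null_comparison)
    have "((\<lambda>N. integral UNIV k * (integral UNIV l - integral {-N..N} l)) \<longlongrightarrow>
        integral UNIV k * (integral UNIV l - integral UNIV l)) at_top"
      by (intro tendsto_intros tendsto_integral_symmetric l)
    then show "((\<lambda>N. integral UNIV k * (integral UNIV l - integral {-N..N} l)) \<longlongrightarrow> 0) at_top" by simp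
    have "norm (integral {-N..N} (\<lambda>u. integral UNIV (\<Phi> u)) - integral {-N..N} (\<lambda>u. integral {-N..N} (\<Phi> u)))
       \<le> integral UNIV k * (integral UNIV l - integral {-N..N} l)" for N
    proof -
      have i2: "(\<lambda>u. integral {-N..N} (\<Phi> u)) integrable_on {-N..N}"
        using integral_integrable_2dim[of "-N" "-N" N N "\<lambda>(u, v). \<Phi> u v"] continuous_on_subset[OF cont]
        by simp
      have "norm (integral {-N..N} (\<lambda>u. integral UNIV (\<Phi> u) - integral {-N..N} (\<Phi> u)))
          \<le> integral {-N..N} (\<lambda>u. k u * (integral UNIV l - integral {-N..N} l))"
        by (rule integral_norm_bound_integral)
           (use integrable_cmul[OF sub[OF k, of "-N" N], of "integral UNIV l - integral {-N..N} l"]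
             in \<open>auto intro!: integrable_diff sub[OF I] i2 tail simp: mult.commute\<close>)
      also have "\<dots> = integral {-N..N} k * (integral UNIV l - integral {-N..N} l)" by simp
      also have "\<dots> \<le> integral UNIV k * (integral UNIV l - integral {-N..N} l)"
        by (intro mult_right_mono integral_subset_le)
           (auto simp: k sub k0 l l0 intro!: integral_subset_le)
      finally show ?thesis using integral_diff[OF sub[OF I] i2] by simp
    qed
    then show "\<forall>\<^sub>F N in at_top. norm (integral {-N..N} (\<lambda>u. integral UNIV (\<Phi> u))
        - integral {-N..N} (\<lambda>u. integral {-N..N} (\<Phi> u))) \<le> integral UNIV k * (integral UNIV l - integral {-N..N} l)"
      by simp
  qed
  from tendsto_diff[OF tendsto_integral_symmetric[OF I] this] show ?thesis by simp
qed

text \<open>Over a square the order may be changed by continuity, and both iterated integrals are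
  limits over the same squares. Integrability of the inner integrals is a hypothesis because they
  are computed in closed form where the lemma is applied.\<close>

lemma integral_swap_UNIV:
  fixes \<Phi> :: "real \<Rightarrow> real \<Rightarrow> 'a::banach"
  assumes cont: "continuous_on UNIV (\<lambda>(u, v). \<Phi> u v)"
    and bnd: "\<And>u v. norm (\<Phi> u v) \<le> k u * l v"
    and k: "k integrable_on UNIV" and l: "l integrable_on UNIV"
    and k0: "\<And>u. 0 \<le> k u" and l0: "\<And>v. 0 \<le> l v"
    and I1: "(\<lambda>u. integral UNIV (\<Phi> u)) integrable_on UNIV"
    and I2: "(\<lambda>v. integral UNIV (\<lambda>u. \<Phi> u v)) integrable_on UNIV"
  shows "integral UNIV (\<lambda>u. integral UNIV (\<Phi> u)) = integral UNIV (\<lambda>v. integral UNIV (\<lambda>u. \<Phi> u v))"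
proof -
  have "((\<lambda>N. integral {-N..N} (\<lambda>v. integral {-N..N} (\<lambda>u. \<Phi> u v))) \<longlongrightarrow>
    integral UNIV (\<lambda>v. integral UNIV (\<lambda>u. \<Phi> u v))) at_top"
  proof (rule tendsto_integral_box[of "\<lambda>v u. \<Phi> u v" l k])
    show "continuous_on UNIV (\<lambda>(v, u). \<Phi> u v)"
      using continuous_on_compose2[OF cont continuous_on_swap, of UNIV]
      by (simp add: split_beta prod.swap_def)
  qed (use assms in \<open>auto simp: mult.commute\<close>)
  moreover have "integral {-N..N} (\<lambda>v. integral {-N..N} (\<lambda>u. \<Phi> u v))
      = integral {-N..N} (\<lambda>u. integral {-N..N} (\<Phi> u))" for N
    using integral_swap_continuous[of "-N" "-N" N N \<Phi>] continuous_on_subset[OF cont] by simp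
  ultimately have "((\<lambda>N. integral {-N..N} (\<lambda>u. integral {-N..N} (\<Phi> u))) \<longlongrightarrow>
    integral UNIV (\<lambda>v. integral UNIV (\<lambda>u. \<Phi> u v))) at_top" by simp
  with tendsto_integral_box[OF cont bnd k l k0 l0 I1] show ?thesis
    by (rule tendsto_unique[rotated]) simp
qed

text \<open>A value above \<open>e\<close> keeps \<open>k\<close> above \<open>e / 2\<close> on an
  adjacent interval of length \<open>d\<close>, whose integral is then too large for a tail. The
  interval is taken on the side away from 0, so that it stays in the tail.\<close>

lemma Lipschitz_integrable_decay:
  fixes k :: "real \<Rightarrow> real"
  assumes lip: "\<And>x y. \<bar>k x - k y\<bar> \<le> M * \<bar>x - y\<bar>" and M: "M > 0"
    and k: "k integrable_on UNIV" and e: "e > 0"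
  shows "\<exists>N. \<forall>u. N \<le> \<bar>u\<bar> \<longrightarrow> k u \<le> e"
proof -
  define d where "d = e / (2 * M)"
  have d: "d > 0" "M * d = e / 2" using e M by (auto simp: d_def)
  obtain B where B: "B > 0"
    "\<And>x y. x \<le> y \<Longrightarrow> (B \<le> x \<or> y \<le> - B) \<Longrightarrow> integral {x..y} k < d * (e / 2)"
    using integrable_on_UNIV_tail[OF k, of "d * (e / 2)"] d e by auto
  have low: "d * (e / 2) \<le> integral {x..x + d} k" if "k u > e" "u \<in> {x..x+d}" for x u
  proof -
    have "integral {x..x+d} (\<lambda>_. e / 2) \<le> integral {x..x+d} k"
    proof (rule integral_le)
      show "k integrable_on {x..x+d}" using integrable_on_subcbox[OF k, of x "x+d"] by simp
      fix y assume "y \<in> {x..x+d}"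
      then have "M * \<bar>u - y\<bar> \<le> M * d" using that M by (intro mult_left_mono) auto
      then show "e / 2 \<le> k y" using lip[of u y] that d by linarith
    qed auto
    then show ?thesis using d by simp
  qed
  have "k u \<le> e" if "B \<le> \<bar>u\<bar>" for u
  proof (rule ccontr)
    assume "\<not> k u \<le> e"
    then show False
      using low[of u u] low[of u "u - d"] B(2)[of u "u + d"] B(2)[of "u - d" u] d that
      by (cases "u \<ge> 0") auto
  qed
  then show ?thesis by blast
qed

text \<open>
  By Cauchy's inequality \<open>F\<close> is Lipschitz on the smaller strip, so it tends to \<open>0\<close> on every line, and
  finitely many lines control the whole strip.
\<close>

lemma strip_decay:
  fixes F :: "complex \<Rightarrow> complex"
  assumes hol: "F holomorphic_on {z. \<bar>Im z\<bar> < \<theta>}"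
    and bnd: "\<And>z. \<bar>Im z\<bar> < \<theta> \<Longrightarrow> norm (F z) \<le> B"
    and int: "\<And>\<alpha>. \<bar>\<alpha>\<bar> < \<theta> \<Longrightarrow> (\<lambda>u. norm (F (Complex u \<alpha>))) integrable_on UNIV"
    and ph: "\<phi> < \<theta>" and e: "e > 0"
  shows "\<exists>N. \<forall>z. \<bar>Im z\<bar> \<le> \<phi> \<longrightarrow> N \<le> \<bar>Re z\<bar> \<longrightarrow> norm (F z) \<le> e"
proof (cases "0 \<le> \<phi>")
  case False
  then show ?thesis by (intro exI[of _ 0]) auto
next
  case phi0: True
  define r where "r = (\<theta> - \<phi>) / 2"
  have r: "r > 0" "\<phi> + r < \<theta>" using ph by (auto simp: r_def field_simps)
  \<comment> \<open>Cauchy's inequality on discs of radius \<open>r\<close>, which fit into the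
    larger strip, bounds the derivative by \<open>\<bar>B\<bar> / r\<close>. The summand 1 allows
    division by \<open>M\<close>.\<close>
  define M where "M = \<bar>B\<bar> / r + 1"
  have M: "M > 0" using r by (simp add: M_def add_nonneg_pos)
  let ?S = "{z. \<bar>Im z\<bar> < \<theta>}"
  have "open ?S" by (intro open_Collect_less continuous_intros)
  have der: "(F has_field_derivative deriv F z) (at z)" if "z \<in> ?S" for z
    using hol \<open>open ?S\<close> that holomorphic_derivI by blast
  have dM: "norm (deriv F z) \<le> M" if z: "\<bar>Im z\<bar> \<le> \<phi>" for z
  proof -
    have sub: "cball z r \<subseteq> ?S"
    proof
      fix w assume "w \<in> cball z r"
      then have "\<bar>Im (z - w)\<bar> \<le> r" using abs_Im_le_cmod[of "z - w"] by (simp add: dist_norm)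
      then show "w \<in> ?S" using z r by auto
    qed
    have "norm ((deriv ^^ 1) F z) \<le> fact 1 * B / r ^ 1"
    proof (rule Cauchy_inequality)
      show "F holomorphic_on ball z r" using hol sub by (meson ball_subset_cball holomorphic_on_subset order_trans)
      show "continuous_on (cball z r) F" using hol sub holomorphic_on_imp_continuous_on continuous_on_subset by blast
      show "norm (F x) \<le> B" if "norm (z - x) = r" for x
        using that sub by (intro bnd) (auto simp: dist_norm subset_iff)
    qed (use r in auto)
    also have "\<dots> \<le> \<bar>B\<bar> / r" using r by (simp add: divide_right_mono)
    finally show ?thesis by (simp add: M_def)
  qed
  have cs: "convex {z. \<bar>Im z\<bar> \<le> \<phi>}"
  proof -
    have "{z. \<bar>Im z\<bar> \<le> \<phi>} = {z. Im z \<le> \<phi>} \<inter> {z. Im z \<ge> - \<phi>}" by auto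
    then show ?thesis by (simp add: convex_Int convex_halfspace_Im_le convex_halfspace_Im_ge)
  qed
  have lip: "norm (F z - F w) \<le> M * norm (z - w)" if "\<bar>Im z\<bar> \<le> \<phi>" "\<bar>Im w\<bar> \<le> \<phi>" for z w
    by (rule field_differentiable_bound[OF cs])
       (use that dM ph der in \<open>auto intro!: has_field_derivative_at_within[OF der]\<close>)
  define \<eta> where "\<eta> = e / (2 * M)"
  have eta: "\<eta> > 0" "M * \<eta> = e / 2" using e M by (auto simp: \<eta>_def)
  have "\<exists>N. \<forall>z. \<bar>Im z\<bar> \<le> \<phi> \<longrightarrow> \<bar>Im z - \<alpha>\<bar> < \<eta> \<longrightarrow> N \<le> \<bar>Re z\<bar> \<longrightarrow> norm (F z) \<le> e"
    if al: "\<bar>\<alpha>\<bar> \<le> \<phi>" for \<alpha>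
  proof -
    have "\<exists>N. \<forall>u. N \<le> \<bar>u\<bar> \<longrightarrow> norm (F (Complex u \<alpha>)) \<le> e / 2"
    proof (rule Lipschitz_integrable_decay[OF _ M])
      fix x y
      have "\<bar>norm (F (Complex x \<alpha>)) - norm (F (Complex y \<alpha>))\<bar> \<le> norm (F (Complex x \<alpha>) - F (Complex y \<alpha>))"
        by (rule norm_triangle_ineq3)
      also have "\<dots> \<le> M * norm (Complex x \<alpha> - Complex y \<alpha>)" using al by (intro lip) auto
      also have "norm (Complex x \<alpha> - Complex y \<alpha>) = \<bar>x - y\<bar>" by (simp add: cmod_def)
      finally show "\<bar>norm (F (Complex x \<alpha>)) - norm (F (Complex y \<alpha>))\<bar> \<le> M * \<bar>x - y\<bar>" .
    qed (use al ph e in \<open>auto intro!: int\<close>)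
    then obtain N where N: "\<And>u. N \<le> \<bar>u\<bar> \<Longrightarrow> norm (F (Complex u \<alpha>)) \<le> e / 2" by blast
    have "norm (F z) \<le> e" if "\<bar>Im z\<bar> \<le> \<phi>" "\<bar>Im z - \<alpha>\<bar> < \<eta>" "N \<le> \<bar>Re z\<bar>" for z
    proof -
      have "norm (F z - F (Complex (Re z) \<alpha>)) \<le> M * norm (z - Complex (Re z) \<alpha>)"
        using that al by (intro lip) auto
      also have "norm (z - Complex (Re z) \<alpha>) = \<bar>Im z - \<alpha>\<bar>" by (simp add: cmod_def)
      also have "M * \<bar>Im z - \<alpha>\<bar> \<le> M * \<eta>" using that M by (intro mult_left_mono) auto
      finally have "norm (F z - F (Complex (Re z) \<alpha>)) \<le> e / 2" using eta by simp
      moreover have "norm (F (Complex (Re z) \<alpha>)) \<le> e / 2" using N that by simp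
      ultimately show ?thesis
        using norm_triangle_ineq[of "F z - F (Complex (Re z) \<alpha>)" "F (Complex (Re z) \<alpha>)"] by simp
    qed
    then show ?thesis by blast
  qed
  then obtain N where N: "\<And>\<alpha> z. \<bar>\<alpha>\<bar> \<le> \<phi> \<Longrightarrow> \<bar>Im z\<bar> \<le> \<phi> \<Longrightarrow> \<bar>Im z - \<alpha>\<bar> < \<eta> \<Longrightarrow> N \<alpha> \<le> \<bar>Re z\<bar> \<Longrightarrow> norm (F z) \<le> e"
    by metis
  obtain C where C: "C \<subseteq> {-\<phi>..\<phi>}" "finite C" "{-\<phi>..\<phi>} \<subseteq> (\<Union>\<alpha>\<in>C. ball \<alpha> \<eta>)"
    by (rule compactE_image[of "{-\<phi>..\<phi>}" "{-\<phi>..\<phi>}" "\<lambda>\<alpha>. ball \<alpha> \<eta>"]) (use eta in auto)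
  have "norm (F z) \<le> e" if z: "\<bar>Im z\<bar> \<le> \<phi>" "Max (N ` C) \<le> \<bar>Re z\<bar>" for z
  proof -
    have "Im z \<in> {-\<phi>..\<phi>}" using z by auto
    then obtain \<alpha> where al: "\<alpha> \<in> C" "\<bar>Im z - \<alpha>\<bar> < \<eta>" using C(3) by (force simp: dist_real_def)
    moreover have "N \<alpha> \<le> Max (N ` C)" using al C by simp
    moreover have "\<bar>\<alpha>\<bar> \<le> \<phi>" using al C(1) by force
    ultimately show ?thesis using N[of \<alpha> z] z by auto
  qed
  then show ?thesis by blast
qed

section \<open>Cauchy's formula on a bisector\<close>

lemma holomorphic_line_shift:
  fixes \<Phi> :: "complex \<Rightarrow> complex"
  assumes hol: "\<Phi> holomorphic_on U" and U: "open U" and sub: "\<And>z. Im z \<in> {a..b} \<Longrightarrow> z \<in> U"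
    and ab: "a \<le> b"
    and decay: "\<And>e. e > 0 \<Longrightarrow> \<exists>N. \<forall>z. Im z \<in> {a..b} \<longrightarrow> N \<le> \<bar>Re z\<bar> \<longrightarrow> norm (\<Phi> z) \<le> e"
    and ia: "(\<lambda>u. \<Phi> (Complex u a)) integrable_on UNIV"
    and ib: "(\<lambda>u. \<Phi> (Complex u b)) integrable_on UNIV"
  shows "integral UNIV (\<lambda>u. \<Phi> (Complex u a)) = integral UNIV (\<lambda>u. \<Phi> (Complex u b))"
proof (rule integral_line_shift[where J = "\<lambda>x. \<i> * x" and \<Phi>' = "deriv \<Phi>"])
  fix z assume "Im z \<in> {a..b}"
  then have "(\<Phi> has_derivative (*) (deriv \<Phi> z)) (at z)"
    using hol U sub holomorphic_derivI has_field_derivative_imp_has_derivative by blast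
  moreover have "(*) (deriv \<Phi> z) = (\<lambda>h. Re h *\<^sub>R deriv \<Phi> z + Im h *\<^sub>R (\<i> * deriv \<Phi> z))"
    by (auto simp: fun_eq_iff complex_eq_iff)
  ultimately show "(\<Phi> has_derivative (\<lambda>h. Re h *\<^sub>R deriv \<Phi> z + Im h *\<^sub>R (\<i> * deriv \<Phi> z))) (at z)"
    by simp
next
  have "continuous_on U (deriv \<Phi>)"
    using hol U holomorphic_deriv holomorphic_on_imp_continuous_on by blast
  then show "continuous_on {z. Im z \<in> {a..b}} (deriv \<Phi>)"
    by (rule continuous_on_subset) (use sub in auto)
qed (use assms in \<open>auto intro: bounded_linear_mult_right\<close>)

text \<open>An antiderivative of \<open>1 / sinh x\<close> is the logarithm of
  \<open>tanh (x / 2) = (s - 1) / (s + 1)\<close> with \<open>s = exp x\<close>. On the line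
  \<open>s\<close> lies in the upper half plane, which this Moebius map preserves, so the factor
  \<open>- \<i>\<close> leads to the right half plane, where \<open>Ln\<close> is holomorphic. The
  end values \<open>Ln \<i>\<close> and \<open>Ln (- \<i>)\<close> give the integral; the second
  line is the conjugate of the first.\<close>

lemma has_integral_inverse_sinh_line:
  assumes \<beta>: "0 < \<beta>" "\<beta> < pi"
  shows "((\<lambda>u. 1 / sinh (Complex (u - c) \<beta>)) has_integral - (\<i> * pi)) UNIV"
    and "((\<lambda>u. 1 / sinh (Complex (u - c) (- \<beta>))) has_integral \<i> * pi) UNIV"
proof -
  define s where "s u = exp (Complex (u - c) \<beta>)" for u
  define A where "A u = Ln (- \<i> * ((s u - 1) / (s u + 1)))" for u
  have Im: "Im (s u) > 0" for u using sin_gt_zero[OF \<beta>] by (simp add: s_def Im_exp)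
  have ne: "s u + 1 \<noteq> 0" "s u - 1 \<noteq> 0" for u
    using Im[of u] by (auto simp: complex_eq_iff)
  have Re: "Re (- \<i> * ((s u - 1) / (s u + 1))) > 0" for u
  proof -
    have "Im ((s u - 1) / (s u + 1)) = 2 * Im (s u) / (norm (s u + 1))\<^sup>2"
      by (simp add: Im_divide cmod_power2 algebra_simps)
    also have "\<dots> > 0" using Im[of u] ne[of u] by simp
    finally have "Im ((s u - 1) / (s u + 1)) > 0" .
    moreover have "Re (- \<i> * x) = Im x" for x by simp
    ultimately show ?thesis by metis
  qed
  have ds: "(s has_vector_derivative s u) (at u)" for u
  proof -
    have "((\<lambda>u. Complex (u - c) \<beta>) has_vector_derivative 1) (at u)"
      by (auto simp: Complex_eq intro!: derivative_eq_intros)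
    from field_vector_diff_chain_at[OF this DERIV_exp] show ?thesis
      by (simp add: s_def[abs_def] o_def)
  qed
  have dA: "(A has_vector_derivative 1 / sinh (Complex (u - c) \<beta>)) (at u)" for u
  proof -
    have "((\<lambda>w. Ln (- \<i> * ((w - 1) / (w + 1)))) has_field_derivative
        (1 / (- \<i> * ((s u - 1) / (s u + 1)))) * (- \<i> * (((s u + 1) - (s u - 1)) / (s u + 1)\<^sup>2))) (at (s u))"
      using Re[of u] ne[of u]
      by (auto intro!: derivative_eq_intros simp: complex_nonpos_Reals_iff power2_eq_square divide_simps)
         (simp add: algebra_simps)
    from field_vector_diff_chain_at[OF ds this]
    have "(A has_vector_derivative s u * ((1 / (- \<i> * ((s u - 1) / (s u + 1)))) *
        (- \<i> * (((s u + 1) - (s u - 1)) / (s u + 1)\<^sup>2)))) (at u)"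
      by (simp add: A_def[abs_def] o_def)
    also have "s u * ((1 / (- \<i> * ((s u - 1) / (s u + 1)))) * (- \<i> * (((s u + 1) - (s u - 1)) / (s u + 1)\<^sup>2)))
        = 2 * s u / ((s u - 1) * (s u + 1))"
    proof -
      have eq: "x * ((1 / (- \<i> * (p / q))) * (- \<i> * (r / q\<^sup>2))) = x * r / (p * q)"
        if "p \<noteq> 0" "q \<noteq> 0" for x p q r :: complex
        using that by (simp add: field_simps power2_eq_square)
      show ?thesis by (subst eq[OF ne(2) ne(1)]) (simp add: mult.commute)
    qed
    also have "\<dots> = 1 / sinh (Complex (u - c) \<beta>)"
    proof -
      have "sinh (Complex (u - c) \<beta>) = (s u - 1 / s u) / 2"
        by (simp add: sinh_field_def s_def exp_minus inverse_eq_divide)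
      moreover have "s u \<noteq> 0" by (simp add: s_def)
      then have "(s u - 1 / s u) / 2 = (s u - 1) * (s u + 1) / (2 * s u)"
        by (simp add: field_simps)
      ultimately show ?thesis by simp
    qed
    finally show ?thesis .
  qed
  have s0: "(s \<longlongrightarrow> 0) at_bot"
  proof (rule tendsto_norm_zero_cancel)
    have "((\<lambda>u::real. exp (u - c)) \<longlongrightarrow> 0) at_bot"
      unfolding exp_diff divide_inverse by (rule tendsto_mult_left_zero[OF exp_at_bot])
    then show "((\<lambda>u. norm (s u)) \<longlongrightarrow> 0) at_bot" by (simp add: s_def norm_exp_eq_Re)
  qed
  have sinf: "((\<lambda>u. inverse (s u)) \<longlongrightarrow> 0) at_top"
  proof (rule tendsto_norm_zero_cancel)
    have "((\<lambda>u::real. inverse (exp u) * exp c) \<longlongrightarrow> 0) at_top"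
      by (rule tendsto_mult_left_zero[OF tendsto_inverse_0_at_top[OF exp_at_top]])
    then show "((\<lambda>u. norm (inverse (s u))) \<longlongrightarrow> 0) at_top" by (simp add: s_def norm_inverse norm_exp_eq_Re exp_diff divide_inverse mult.commute)
  qed
  have "(A \<longlongrightarrow> Ln (- \<i> * ((0 - 1) / (0 + 1)))) at_bot"
    unfolding A_def by (intro tendsto_intros s0) (auto simp: complex_nonpos_Reals_iff)
  then have bot: "(A \<longlongrightarrow> \<i> * pi / 2) at_bot" by simp
  have "A = (\<lambda>u. Ln (- \<i> * ((1 - inverse (s u)) / (1 + inverse (s u)))))"
    unfolding A_def
  proof
    fix u
    have "s u \<noteq> 0" by (simp add: s_def)
    then have "(s u - 1) / (s u + 1) = (1 - inverse (s u)) / (1 + inverse (s u))"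
      using ne[of u] by (simp add: divide_simps add.commute)
    then show "Ln (- \<i> * ((s u - 1) / (s u + 1))) = Ln (- \<i> * ((1 - inverse (s u)) / (1 + inverse (s u))))"
      by simp
  qed
  moreover have "((\<lambda>u. Ln (- \<i> * ((1 - inverse (s u)) / (1 + inverse (s u))))) \<longlongrightarrow> Ln (- \<i> * ((1 - 0) / (1 + 0)))) at_top"
    by (intro tendsto_intros sinf) (auto simp: complex_nonpos_Reals_iff)
  ultimately have top: "(A \<longlongrightarrow> - (\<i> * pi / 2)) at_top" by simp
  have "((\<lambda>u. 1 / sinh (Complex (u - c) \<beta>)) has_integral (- (\<i> * pi / 2) - \<i> * pi / 2)) UNIV"
    by (rule has_integral_UNIV_antiderivative[of "{}" A])
       (use dA top bot in \<open>auto intro: continuous_at_imp_continuous_on has_vector_derivative_continuous\<close>)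
  then show I: "((\<lambda>u. 1 / sinh (Complex (u - c) \<beta>)) has_integral - (\<i> * pi)) UNIV" by simp
  have "cnj (sinh (Complex x \<beta>)) = sinh (Complex x (- \<beta>))" for x
    by (simp add: sinh_field_def exp_cnj complex_cnj)
  with has_integral_linear[OF I bounded_linear_cnj]
  show "((\<lambda>u. 1 / sinh (Complex (u - c) (- \<beta>))) has_integral \<i> * pi) UNIV"
    by (simp add: o_def)
qed

text \<open>If \<open>c\<close> is the cosine of an angle, \<open>sqrt (1 - c\<^sup>2)\<close> is
  its sine, the distance of 1 from the ray in that direction. The proof completes a square in
  \<open>norm q\<close>.\<close>

lemma norm_one_minus_ge:
  fixes q :: complex
  assumes "Re q \<le> c * norm q" and "0 \<le> c"
  shows "sqrt (1 - c\<^sup>2) \<le> norm (1 - q)"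
proof -
  have "1 - c\<^sup>2 \<le> 1 - 2 * (c * norm q) + (norm q)\<^sup>2"
    using zero_le_power2[of "norm q - c"] by (simp add: power2_eq_square algebra_simps)
  also have "\<dots> \<le> 1 - 2 * Re q + (norm q)\<^sup>2" using assms by simp
  also have "\<dots> = (norm (1 - q))\<^sup>2" by (simp add: cmod_power2) (simp add: power2_eq_square algebra_simps)
  finally show ?thesis by (rule real_le_lsqrt[OF norm_ge_zero])
qed

lemma cos_abs_diff_less_one:
  fixes y :: real
  assumes "y \<noteq> 0" "\<bar>y\<bar> < pi" shows "cos y < 1" "- 1 < cos y"
proof -
  have "cos \<bar>y\<bar> < cos 0" using assms by (intro cos_monotone_0_pi) auto
  then show "cos y < 1" by simp
  have "cos pi < cos \<bar>y\<bar>" using assms by (intro cos_monotone_0_pi) auto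
  then show "- 1 < cos y" by simp
qed

text \<open>The quotient of the two points stays away in angle from the positive real axis. For
  equal signs its angle is at least \<open>\<phi>2 - \<phi>1\<close>; for opposite signs it is
  within \<open>\<phi>1 + \<phi>2 < pi\<close> of \<open>pi\<close>.
  \<open>norm_one_minus_ge\<close> turns this into a distance relative to the modulus, uniform in
  both moduli.\<close>

lemma bisector_separation:
  assumes ph: "0 \<le> \<phi>1" "\<phi>1 < \<phi>2" "\<phi>2 < pi / 2"
  obtains k where "k > 0"
    and "\<And>\<sigma> \<tau> \<zeta> \<zeta>0. \<sigma> \<in> {1, -1} \<Longrightarrow> \<tau> \<in> {1, -1} \<Longrightarrow> \<bar>Im \<zeta>0 - Im \<zeta>\<bar> \<le> \<phi>1 + \<phi>2 \<Longrightarrow>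
      (\<sigma> = \<tau> \<Longrightarrow> \<phi>2 - \<phi>1 \<le> \<bar>Im \<zeta>0 - Im \<zeta>\<bar>) \<Longrightarrow>
      k * norm (of_real \<sigma> * exp \<zeta>) \<le> norm (of_real \<sigma> * exp \<zeta> - of_real \<tau> * exp \<zeta>0)"
proof -
  \<comment> \<open>The cosine bounds of the cases of equal and of opposite signs; the maximum with
    0 meets the hypothesis \<open>0 \<le> c\<close> of \<open>norm_one_minus_ge\<close>.\<close>
  define c where "c = max 0 (max (cos (\<phi>2 - \<phi>1)) (- cos (\<phi>1 + \<phi>2)))"
  have c: "0 \<le> c" "c < 1"
    using cos_abs_diff_less_one[of "\<phi>2 - \<phi>1"] cos_abs_diff_less_one[of "\<phi>1 + \<phi>2"] ph
    by (auto simp: c_def)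
  show ?thesis
  proof (rule that[of "sqrt (1 - c\<^sup>2)"])
    show "0 < sqrt (1 - c\<^sup>2)" using c by (simp add: power_less_one_iff abs_square_less_1)
    fix \<sigma> \<tau> :: real and \<zeta> \<zeta>0 :: complex
    assume s: "\<sigma> \<in> {1, -1}" "\<tau> \<in> {1, -1}"
      and y: "\<bar>Im \<zeta>0 - Im \<zeta>\<bar> \<le> \<phi>1 + \<phi>2" "\<sigma> = \<tau> \<Longrightarrow> \<phi>2 - \<phi>1 \<le> \<bar>Im \<zeta>0 - Im \<zeta>\<bar>"
    let ?w = "of_real \<sigma> * exp \<zeta> :: complex" and ?z = "of_real \<tau> * exp \<zeta>0 :: complex"
    have "\<sigma> * \<tau> * cos (Im \<zeta>0 - Im \<zeta>) \<le> c"
    proof (cases "\<sigma> = \<tau>")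
      case True
      then have "cos \<bar>Im \<zeta>0 - Im \<zeta>\<bar> \<le> cos (\<phi>2 - \<phi>1)"
        using y ph by (intro cos_monotone_0_pi_le) auto
      then show ?thesis using True s by (auto simp: c_def)
    next
      case False
      have "cos (\<phi>1 + \<phi>2) \<le> cos \<bar>Im \<zeta>0 - Im \<zeta>\<bar>"
        using y ph by (intro cos_monotone_0_pi_le) auto
      then show ?thesis using False s by (auto simp: c_def)
    qed
    moreover have q: "?z / ?w = of_real (\<sigma> * \<tau>) * exp (\<zeta>0 - \<zeta>)"
      using s by (auto simp: exp_diff)
    ultimately have "Re (?z / ?w) \<le> c * norm (?z / ?w)"
      using s mult_right_mono[of "\<sigma> * \<tau> * cos (Im \<zeta>0 - Im \<zeta>)" c "exp (Re \<zeta>0 - Re \<zeta>)"]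
      unfolding q by (auto simp: Re_exp norm_mult norm_exp_eq_Re mult.commute)
    from norm_one_minus_ge[OF this c(1)]
    have "sqrt (1 - c\<^sup>2) * norm ?w \<le> norm ((1 - ?z / ?w) * ?w)"
      unfolding norm_mult[of "1 - _"] by (intro mult_right_mono) auto
    also have "(1 - ?z / ?w) * ?w = ?w - ?z" using s by (auto simp: left_diff_distrib)
    finally show "sqrt (1 - c\<^sup>2) * norm ?w \<le> norm (?w - ?z)" .
  qed
qed

text \<open>For \<open>0 < \<theta> < pi / 2\<close> this says that \<open>z\<close> or
  \<open>- z\<close> has argument of modulus below \<open>\<theta>\<close>, with the tangent
  multiplied out. Openness and invariance under conjugation and negation are then visible, and 0 is
  excluded by strictness.\<close>

definition bisector :: "real \<Rightarrow> complex set" where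
  "bisector \<theta> = {z. \<bar>Im z\<bar> * cos \<theta> < \<bar>Re z\<bar> * sin \<theta>}"

text \<open>\<open>u\<close> and \<open>\<epsilon>\<phi>\<close> are the logarithmic polar coordinates of the point in the half plane of sign \<open>\<sigma>\<close>.\<close>

definition ray_point :: "real \<Rightarrow> real \<Rightarrow> real \<Rightarrow> real \<Rightarrow> complex" where
  "ray_point \<phi> \<sigma> \<epsilon> u = of_real \<sigma> * exp (Complex u (\<epsilon> * \<phi>))"

text \<open>Complex counterpart of \<open>SH_L0\<close>: for \<open>u = ln t\<close> the measure
  \<open>dt / t\<close> becomes \<open>du\<close>. Symmetry under conjugation is kept apart, in
  \<open>represents\<close>.\<close>

definition bisector_fun :: "real \<Rightarrow> (complex \<Rightarrow> complex) \<Rightarrow> bool" where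
  "bisector_fun \<theta> f \<longleftrightarrow> f holomorphic_on bisector \<theta> \<and> (\<exists>B. \<forall>z\<in>bisector \<theta>. norm (f z) \<le> B) \<and>
     (\<forall>\<sigma>\<in>{1, -1}. \<forall>\<alpha>. \<bar>\<alpha>\<bar> < \<theta> \<longrightarrow> (\<lambda>u. norm (f (of_real \<sigma> * exp (Complex u \<alpha>)))) integrable_on UNIV)"

text \<open>Cauchy integral over the boundary of the half of the bisector with sign
  \<open>\<sigma>\<close>. Along a ray \<open>dw = w du\<close>; the sign
  \<open>- \<epsilon>\<close> orients the boundary counterclockwise, outward for
  \<open>\<epsilon> = -1\<close> and inward for \<open>\<epsilon> = 1\<close>.\<close>

definition cauchy_int :: "(complex \<Rightarrow> complex) \<Rightarrow> real \<Rightarrow> real \<Rightarrow> complex \<Rightarrow> complex" where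
  "cauchy_int f \<phi> \<sigma> z = (\<Sum>\<epsilon>\<in>{1, -1}. - of_real \<epsilon> / (2 * pi * \<i>) *
     integral UNIV (\<lambda>u. f (ray_point \<phi> \<sigma> \<epsilon> u) * (ray_point \<phi> \<sigma> \<epsilon> u / (ray_point \<phi> \<sigma> \<epsilon> u - z))))"

lemma open_bisector: "open (bisector \<theta>)"
  unfolding bisector_def by (intro open_Collect_less continuous_intros)

lemma exp_in_bisector_iff:
  assumes "\<sigma> \<in> {1, -1}" "\<bar>Im \<zeta>\<bar> \<le> pi / 2" "0 < \<theta>" "\<theta> < pi / 2"
  shows "of_real \<sigma> * exp \<zeta> \<in> bisector \<theta> \<longleftrightarrow> \<bar>Im \<zeta>\<bar> < \<theta>"
proof -
  have s: "\<bar>\<sigma>\<bar> = 1" using assms by auto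
  have "cos (Im \<zeta>) \<ge> 0" using assms by (intro cos_ge_zero) auto
  moreover have "\<bar>sin (Im \<zeta>)\<bar> = sin \<bar>Im \<zeta>\<bar>"
  proof (cases "Im \<zeta> \<ge> 0")
    case True
    then have "sin (Im \<zeta>) \<ge> 0" using assms by (intro sin_ge_zero) auto
    then show ?thesis using True by simp
  next
    case False
    then have "sin (- Im \<zeta>) \<ge> 0" using assms by (intro sin_ge_zero) auto
    then show ?thesis using False by simp
  qed
  moreover have "cos (Im \<zeta>) = cos \<bar>Im \<zeta>\<bar>" by simp
  ultimately have "of_real \<sigma> * exp \<zeta> \<in> bisector \<theta> \<longleftrightarrow>
      sin \<bar>Im \<zeta>\<bar> * cos \<theta> < cos \<bar>Im \<zeta>\<bar> * sin \<theta>"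
    using s by (simp add: bisector_def Re_exp Im_exp abs_mult mult.assoc del: cos_abs_real)
  also have "\<dots> \<longleftrightarrow> 0 < sin (\<theta> - \<bar>Im \<zeta>\<bar>)" by (simp add: sin_diff mult.commute del: cos_abs_real)
  also have "\<dots> \<longleftrightarrow> \<bar>Im \<zeta>\<bar> < \<theta>"
  proof
    assume "\<bar>Im \<zeta>\<bar> < \<theta>"
    then show "0 < sin (\<theta> - \<bar>Im \<zeta>\<bar>)" using assms by (intro sin_gt_zero) auto
  next
    assume *: "0 < sin (\<theta> - \<bar>Im \<zeta>\<bar>)"
    show "\<bar>Im \<zeta>\<bar> < \<theta>"
    proof (rule ccontr)
      assume "\<not> \<bar>Im \<zeta>\<bar> < \<theta>"
      then have "0 \<le> sin (\<bar>Im \<zeta>\<bar> - \<theta>)" using assms by (intro sin_ge_zero) auto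
      then show False using * sin_minus[of "\<theta> - \<bar>Im \<zeta>\<bar>"] by simp
    qed
  qed
  finally show ?thesis .
qed

context
  fixes \<theta> :: real and f :: "complex \<Rightarrow> complex"
  assumes th: "0 < \<theta>" "\<theta> < pi / 2" and f: "bisector_fun \<theta> f"
begin

lemma bisector_fun_strip:
  assumes s: "\<sigma> \<in> {1, -1}"
  shows "(\<lambda>\<zeta>. f (of_real \<sigma> * exp \<zeta>)) holomorphic_on {z. \<bar>Im z\<bar> < \<theta>}"
    and "\<bar>\<alpha>\<bar> < \<theta> \<Longrightarrow> (\<lambda>u. norm (f (of_real \<sigma> * exp (Complex u \<alpha>)))) integrable_on UNIV"
    and "\<phi> < \<theta> \<Longrightarrow> e > 0 \<Longrightarrow> \<exists>N. \<forall>z. \<bar>Im z\<bar> \<le> \<phi> \<longrightarrow> N \<le> \<bar>Re z\<bar> \<longrightarrow> norm (f (of_real \<sigma> * exp z)) \<le> e"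
    and "\<bar>\<alpha>\<bar> < \<theta> \<Longrightarrow> continuous_on UNIV (\<lambda>u. f (of_real \<sigma> * exp (Complex u \<alpha>)))"
proof -
  have mem: "of_real \<sigma> * exp z \<in> bisector \<theta>" if "\<bar>Im z\<bar> < \<theta>" for z
    using exp_in_bisector_iff[OF s, of z] th that by auto
  have "f holomorphic_on bisector \<theta>" using f by (simp add: bisector_fun_def)
  moreover have "(\<lambda>\<zeta>. of_real \<sigma> * exp \<zeta>) holomorphic_on {z. \<bar>Im z\<bar> < \<theta>}"
    by (intro holomorphic_intros)
  moreover have "(\<lambda>\<zeta>. of_real \<sigma> * exp \<zeta>) ` {z. \<bar>Im z\<bar> < \<theta>} \<subseteq> bisector \<theta>" using mem by auto
  ultimately show hol: "(\<lambda>\<zeta>. f (of_real \<sigma> * exp \<zeta>)) holomorphic_on {z. \<bar>Im z\<bar> < \<theta>}"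
    using holomorphic_on_compose_gen[of _ _ f "bisector \<theta>"] by (auto simp: o_def)
  show int: "(\<lambda>u. norm (f (of_real \<sigma> * exp (Complex u \<alpha>)))) integrable_on UNIV" if "\<bar>\<alpha>\<bar> < \<theta>" for \<alpha>
    using f s that unfolding bisector_fun_def by blast
  obtain B where "\<And>z. z \<in> bisector \<theta> \<Longrightarrow> norm (f z) \<le> B" using f unfolding bisector_fun_def by blast
  with mem hol int show "\<exists>N. \<forall>z. \<bar>Im z\<bar> \<le> \<phi> \<longrightarrow> N \<le> \<bar>Re z\<bar> \<longrightarrow> norm (f (of_real \<sigma> * exp z)) \<le> e"
    if "\<phi> < \<theta>" "e > 0" for \<phi> e
    using strip_decay[of "\<lambda>\<zeta>. f (of_real \<sigma> * exp \<zeta>)" \<theta> B \<phi> e] that by auto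
  show "continuous_on UNIV (\<lambda>u. f (of_real \<sigma> * exp (Complex u \<alpha>)))" if "\<bar>\<alpha>\<bar> < \<theta>"
    by (rule continuous_on_compose2[OF holomorphic_on_imp_continuous_on[OF hol], of _ "\<lambda>u. Complex u \<alpha>"])
       (use that in \<open>auto simp: Complex_eq intro!: continuous_intros\<close>)
qed

lemma kernel_integrable:
  assumes s: "\<sigma> \<in> {1, -1}" and al: "\<bar>\<alpha>\<bar> < \<theta>" and k: "k > 0"
    and low: "\<And>u. k * norm (of_real \<sigma> * exp (Complex u \<alpha>)) \<le> norm (of_real \<sigma> * exp (Complex u \<alpha>) - z)"
  shows "(\<lambda>u. f (of_real \<sigma> * exp (Complex u \<alpha>)) *
     (of_real \<sigma> * exp (Complex u \<alpha>) / (of_real \<sigma> * exp (Complex u \<alpha>) - z))) integrable_on UNIV"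
proof (rule integrable_on_UNIV_dominated)
  let ?w = "\<lambda>u. of_real \<sigma> * exp (Complex u \<alpha>)"
  have s1: "norm \<sigma> = 1" using s by auto
  have ne: "?w u - z \<noteq> 0" for u
  proof -
    have "0 < k * norm (?w u)" using k s1 by (simp add: norm_mult)
    then show ?thesis using low[of u] by (metis norm_zero not_le)
  qed
  show "continuous_on UNIV (\<lambda>u. f (?w u) * (?w u / (?w u - z)))"
    by (intro continuous_intros bisector_fun_strip(4)[OF s al])
       (use ne in \<open>auto simp: Complex_eq intro!: continuous_intros\<close>)
  show "(\<lambda>u. norm (f (?w u)) * (1 / k)) integrable_on UNIV"
    using integrable_cmul[OF bisector_fun_strip(2)[OF s al], of "1 / k"] by (simp add: mult.commute)
  show "norm (f (?w u) * (?w u / (?w u - z))) \<le> norm (f (?w u)) * (1 / k)" for u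
  proof -
    have "norm (?w u / (?w u - z)) \<le> 1 / k"
      using low[of u] k ne[of u] by (simp add: norm_divide divide_simps mult.commute)
    then show ?thesis unfolding norm_mult[of "f (?w u)"] by (intro mult_left_mono) auto
  qed
qed

text \<open>The lower bound keeps the kernel holomorphic and bounded by \<open>1 / k\<close> on the
  closed strip. Both boundary lines therefore carry the same integral, and they enter
  \<open>cauchy_int\<close> with opposite signs.\<close>

lemma cauchy_int_outside:
  assumes ph: "0 \<le> \<phi>" "\<phi> < \<theta>" and s: "\<sigma> \<in> {1, -1}" and k: "k > 0"
    and low: "\<And>\<zeta>. \<bar>Im \<zeta>\<bar> \<le> \<phi> \<Longrightarrow> k * norm (of_real \<sigma> * exp \<zeta>) \<le> norm (of_real \<sigma> * exp \<zeta> - z)"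
  shows "cauchy_int f \<phi> \<sigma> z = 0"
proof -
  let ?w = "\<lambda>\<zeta>. of_real \<sigma> * exp \<zeta>"
  define \<Phi> where "\<Phi> \<zeta> = f (?w \<zeta>) * (?w \<zeta> / (?w \<zeta> - z))" for \<zeta>
  have s1: "norm \<sigma> = 1" using s by auto
  have ne: "?w \<zeta> - z \<noteq> 0" if "\<bar>Im \<zeta>\<bar> \<le> \<phi>" for \<zeta>
  proof -
    have "0 < k * norm (?w \<zeta>)" using k s1 by (simp add: norm_mult)
    then show ?thesis using low[OF that] by (metis norm_zero not_le)
  qed
  have io: "(\<lambda>u. \<Phi> (Complex u \<alpha>)) integrable_on UNIV" if "\<bar>\<alpha>\<bar> \<le> \<phi>" for \<alpha>
    unfolding \<Phi>_def by (rule kernel_integrable[OF s _ k]) (use that ph low in auto)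
  have "integral UNIV (\<lambda>u. \<Phi> (Complex u (- \<phi>))) = integral UNIV (\<lambda>u. \<Phi> (Complex u \<phi>))"
  proof (rule holomorphic_line_shift)
    let ?U = "{\<zeta>. \<bar>Im \<zeta>\<bar> < \<theta>} \<inter> {\<zeta>. ?w \<zeta> - z \<noteq> 0}"
    show "open ?U"
      by (intro open_Int open_Collect_less open_Collect_neq continuous_intros)
    show "\<Phi> holomorphic_on ?U"
      unfolding \<Phi>_def
      by (intro holomorphic_intros holomorphic_on_subset[OF bisector_fun_strip(1)[OF s]]) auto
    show "\<zeta> \<in> ?U" if "Im \<zeta> \<in> {-\<phi>..\<phi>}" for \<zeta>
    proof -
      have "\<bar>Im \<zeta>\<bar> \<le> \<phi>" using that by auto
      then show ?thesis using ne[of \<zeta>] ph by auto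
    qed
  next
    fix e :: real assume e: "e > 0"
    then obtain N where N: "\<And>z. \<bar>Im z\<bar> \<le> \<phi> \<Longrightarrow> N \<le> \<bar>Re z\<bar> \<Longrightarrow> norm (f (?w z)) \<le> e * k"
      using bisector_fun_strip(3)[OF s ph(2), of "e * k"] k by auto
    have "norm (\<Phi> \<zeta>) \<le> e" if "\<bar>Im \<zeta>\<bar> \<le> \<phi>" "N \<le> \<bar>Re \<zeta>\<bar>" for \<zeta>
    proof -
      have "norm (?w \<zeta> / (?w \<zeta> - z)) \<le> 1 / k"
        using low[OF that(1)] k ne[OF that(1)] by (simp add: norm_divide divide_simps mult.commute)
      then have "norm (\<Phi> \<zeta>) \<le> (e * k) * (1 / k)"
        unfolding \<Phi>_def norm_mult[of "f (?w \<zeta>)"] using N[OF that] by (intro mult_mono) (use e k in auto)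
      then show ?thesis using k by simp
    qed
    then show "\<exists>N. \<forall>z. Im z \<in> {-\<phi>..\<phi>} \<longrightarrow> N \<le> \<bar>Re z\<bar> \<longrightarrow> norm (\<Phi> z) \<le> e"
      by (intro exI[of _ N]) auto
  qed (use ph io in auto)
  then show ?thesis by (simp add: cauchy_int_def ray_point_def \<Phi>_def)
qed

text \<open>
  With \<open>w = \<sigma> exp \<zeta>\<close> and \<open>z = \<sigma> exp \<zeta>0\<close> the kernel \<open>w / (w - z)\<close> has, as a function of \<open>\<zeta>\<close>, the same residue at
  \<open>\<zeta>0\<close> as \<open>1 / sinh (\<zeta> - \<zeta>0)\<close>, whose integrals are known. After subtracting the latter, the line of
  integration can be shifted across \<open>\<zeta>0\<close>.
\<close>

lemma cauchy_int_inside: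
  assumes ph: "\<phi> < \<theta>" and s: "\<sigma> \<in> {1, -1}" and z0: "\<bar>Im \<zeta>0\<bar> < \<phi>"
  shows "cauchy_int f \<phi> \<sigma> (of_real \<sigma> * exp \<zeta>0) = f (of_real \<sigma> * exp \<zeta>0)"
proof -
  let ?w = "\<lambda>\<zeta>. of_real \<sigma> * exp \<zeta>"
  define z where "z = ?w \<zeta>0"
  let ?U = "{\<zeta>. \<bar>Im \<zeta>\<bar> < \<theta>}"
  have s1: "norm \<sigma> = 1" "\<sigma> \<noteq> 0" using s by auto
  have U: "open ?U" by (intro open_Collect_less continuous_intros)
  have z0U: "\<zeta>0 \<in> ?U" using ph z0 by auto
  \<comment> \<open>With \<open>x = \<zeta> - \<zeta>0\<close> the kernel is
    \<open>exp x / (exp x - 1) = ((exp x + 1) / 2) / sinh x\<close>, so the difference to be shifted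
    is \<open>N / S\<close>. Both \<open>N\<close> and \<open>S\<close> vanish at
    \<open>\<zeta>0\<close>; passing to their difference quotients \<open>P\<close> and
    \<open>Q\<close> removes the singularity.\<close>
  define N where "N \<zeta> = f (?w \<zeta>) * ((exp (\<zeta> - \<zeta>0) + 1) / 2) - f z" for \<zeta>
  define P where "P \<zeta> = (if \<zeta> = \<zeta>0 then deriv N \<zeta>0 else (N \<zeta> - N \<zeta>0) / (\<zeta> - \<zeta>0))" for \<zeta>
  define S where "S \<zeta> = sinh (\<zeta> - \<zeta>0)" for \<zeta>
  define Q where "Q \<zeta> = (if \<zeta> = \<zeta>0 then deriv S \<zeta>0 else (S \<zeta> - S \<zeta>0) / (\<zeta> - \<zeta>0))" for \<zeta>
  define G where "G \<zeta> = P \<zeta> / Q \<zeta>" for \<zeta>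
  have N0: "N \<zeta>0 = 0" by (simp add: N_def z_def)
  have S0: "S \<zeta>0 = 0" by (simp add: S_def)
  have holN: "N holomorphic_on ?U"
    unfolding N_def by (intro holomorphic_intros bisector_fun_strip(1)[OF s]) auto
  have holS: "S holomorphic_on ?U"
    unfolding S_def sinh_field_def by (intro holomorphic_intros) auto
  \<comment> \<open>Zeros of \<open>sinh\<close> are the integer multiples of
    \<open>\<i> * pi\<close>, whereas imaginary parts of two points of the strip differ by less than
    \<open>pi\<close>.\<close>
  have Sne: "S \<zeta> \<noteq> 0" if "\<zeta> \<in> ?U" "\<zeta> \<noteq> \<zeta>0" for \<zeta>
  proof
    assume "S \<zeta> = 0"
    then have "exp (\<zeta> - \<zeta>0) = exp (- (\<zeta> - \<zeta>0))" by (simp add: S_def sinh_field_def)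
    then have "exp (2 * (\<zeta> - \<zeta>0)) = 1" 
      by (metis exp_add exp_zero mult_2 right_minus)
    then obtain n :: int where n: "Re (2 * (\<zeta> - \<zeta>0)) = 0" "Im (2 * (\<zeta> - \<zeta>0)) = of_int (2 * n) * pi"
      unfolding exp_eq_1 by blast
    then have im: "Im \<zeta> - Im \<zeta>0 = of_int n * pi" by simp
    then have "\<bar>of_int n * pi\<bar> < pi" using that z0 ph th by auto
    then have "\<bar>real_of_int n\<bar> < 1" by (simp add: abs_mult)
    then have "n = 0" by linarith
    then show False using n im that(2) by (auto simp: complex_eq_iff)
  qed
  have dS: "deriv S \<zeta>0 = 1"
    unfolding S_def by (rule DERIV_imp_deriv) (auto intro!: derivative_eq_intros)
  have Qne: "Q \<zeta> \<noteq> 0" if "\<zeta> \<in> ?U" for \<zeta>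
    using Sne[OF that] by (auto simp: Q_def dS S0)
  have holG: "G holomorphic_on ?U"
    unfolding G_def
  proof (intro holomorphic_intros)
    show "P holomorphic_on ?U" unfolding P_def[abs_def] by (rule pole_lemma_open[OF holN U])
    show "Q holomorphic_on ?U" unfolding Q_def[abs_def] by (rule pole_lemma_open[OF holS U])
  qed (use Qne in auto)
  have G: "G \<zeta> = f (?w \<zeta>) * (?w \<zeta> / (?w \<zeta> - z)) - f z * (1 / sinh (\<zeta> - \<zeta>0))"
    if "\<zeta> \<in> ?U" "\<zeta> \<noteq> \<zeta>0" for \<zeta>
  proof -
    define x where "x = \<zeta> - \<zeta>0"
    have E: "exp \<zeta> = exp x * exp \<zeta>0" by (simp add: x_def flip: exp_add)
    have "sinh x \<noteq> 0" using Sne[OF that] by (simp add: S_def x_def)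
    then have sx: "exp x * exp x - 1 \<noteq> 0" "sinh x = (exp x * exp x - 1) / (2 * exp x)"
      by (auto simp: sinh_field_def exp_minus field_simps)
    then have "(exp x - 1) * (exp x + 1) \<noteq> 0" by (simp add: algebra_simps)
    then have e1: "exp x - 1 \<noteq> 0" "exp x + 1 \<noteq> 0" by auto
    have "?w \<zeta> / (?w \<zeta> - z) = (exp x * ?w \<zeta>0) / ((exp x - 1) * ?w \<zeta>0)"
      unfolding E z_def by (simp add: algebra_simps)
    also have "\<dots> = exp x / (exp x - 1)" using s1 by (subst mult_divide_mult_cancel_right) auto
    finally have w: "?w \<zeta> / (?w \<zeta> - z) = exp x / (exp x - 1)" .
    have "((exp x + 1) / 2) / sinh x = exp x / (exp x - 1)"
    proof -
      have "exp x * exp x - 1 = (exp x - 1) * (exp x + 1)" by (simp add: algebra_simps)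
      then show ?thesis unfolding sx(2) using e1 by (simp add: divide_simps)
    qed
    moreover have "N \<zeta> / sinh x = f (?w \<zeta>) * (((exp x + 1) / 2) / sinh x) - f z * (1 / sinh x)"
      by (simp add: N_def x_def diff_divide_distrib)
    ultimately have "N \<zeta> / sinh x = f (?w \<zeta>) * (exp x / (exp x - 1)) - f z * (1 / sinh x)"
      by (simp only:)
    moreover have "G \<zeta> = N \<zeta> / sinh x"
      using that by (simp add: G_def P_def Q_def N0 S0 S_def x_def)
    ultimately show ?thesis unfolding w by (simp add: x_def)
  qed
  \<comment> \<open>At horizontal distance at least 1 the moduli differ by a factor of at least 2,
    so the kernel is bounded by 2 there, whatever the imaginary parts.\<close>
  have far: "norm (?w \<zeta>) * (1 / 2) \<le> norm (?w \<zeta> - z)" if "\<bar>Re \<zeta> - Re \<zeta>0\<bar> \<ge> 1" for \<zeta>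
  proof -
    define r where "r = Re \<zeta>0 - Re \<zeta>"
    have nz: "norm z = exp r * norm (?w \<zeta>)"
      using s1 by (simp add: z_def norm_mult norm_exp_eq_Re r_def flip: exp_add)
    have e2: "2 \<le> exp (1::real)" using exp_ge_add_one_self[of 1] by simp
    have "r \<ge> 1 \<or> r \<le> -1" using that by (auto simp: r_def)
    then consider "r \<ge> 1" | "r \<le> -1" by blast
    then have "1 / 2 \<le> \<bar>1 - exp r\<bar>"
    proof cases
      case 1
      then have "exp 1 \<le> exp r" by simp
      then show ?thesis using e2 by linarith
    next
      case 2
      then have "exp r \<le> exp (-1)" by simp
      also have "exp (-1::real) \<le> 1 / 2" using e2 by (simp add: exp_minus divide_simps)
      finally show ?thesis by linarith
    qed
    then have "norm (?w \<zeta>) * (1 / 2) \<le> norm (?w \<zeta>) * \<bar>1 - exp r\<bar>" by (intro mult_left_mono) auto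
    also have "\<dots> = \<bar>norm (?w \<zeta>) - norm z\<bar>" 
    proof -
      have "norm (?w \<zeta>) - norm z = norm (?w \<zeta>) * (1 - exp r)" by (simp add: nz algebra_simps)
      then show ?thesis by (simp only: abs_mult abs_norm_cancel)
    qed
    also have "\<dots> \<le> norm (?w \<zeta> - z)" by (rule norm_triangle_ineq3)
    finally show ?thesis .
  qed
  \<comment> \<open>Linear growth of \<open>sinh\<close> in the real part is all that the decay of
    the subtracted term requires.\<close>
  have sinhb: "\<bar>Re x\<bar> \<le> norm (sinh x)" for x :: complex
  proof -
    have "\<bar>Re x\<bar> \<le> sinh \<bar>Re x\<bar>"
      using real_le_x_sinh[of "\<bar>Re x\<bar>"] by (simp add: sinh_field_def exp_minus)
    also have "\<dots> = \<bar>norm (exp x) - norm (exp (- x))\<bar> / 2"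
      unfolding norm_exp_eq_Re by (cases "Re x \<ge> 0") (auto simp: sinh_field_def abs_if)
    also have "\<dots> \<le> norm (exp x - exp (- x)) / 2" by (intro divide_right_mono norm_triangle_ineq3) auto
    also have "\<dots> = norm (sinh x)" by (simp add: sinh_field_def norm_divide)
    finally show ?thesis .
  qed
  have line: "(\<lambda>u. f (?w (Complex u \<alpha>)) * (?w (Complex u \<alpha>) / (?w (Complex u \<alpha>) - z))) integrable_on UNIV"
    if al: "\<bar>\<alpha>\<bar> = \<phi>" for \<alpha>
  proof -
    have a: "\<bar>\<alpha>\<bar> < \<theta>" and ph2: "\<phi> < pi / 2" using al ph th by auto
    show ?thesis
    proof (rule bisector_separation[OF abs_ge_zero z0 ph2])
      fix c :: real assume c: "c > 0" and sep: "\<And>\<sigma> \<tau> \<zeta> \<zeta>'. \<sigma> \<in> {1, -1} \<Longrightarrow> \<tau> \<in> {1, -1} \<Longrightarrow>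
        \<bar>Im \<zeta>' - Im \<zeta>\<bar> \<le> \<bar>Im \<zeta>0\<bar> + \<phi> \<Longrightarrow> (\<sigma> = \<tau> \<Longrightarrow> \<phi> - \<bar>Im \<zeta>0\<bar> \<le> \<bar>Im \<zeta>' - Im \<zeta>\<bar>) \<Longrightarrow>
        c * norm (of_real \<sigma> * exp \<zeta>) \<le> norm (of_real \<sigma> * exp \<zeta> - of_real \<tau> * exp \<zeta>')"
      show ?thesis
      proof (rule kernel_integrable[OF s a c])
        fix u show "c * norm (?w (Complex u \<alpha>)) \<le> norm (?w (Complex u \<alpha>) - z)"
          unfolding z_def by (rule sep[OF s s]) (use al in auto)
      qed
    qed
  qed
  have sinh1: "((\<lambda>u. 1 / sinh (Complex u \<phi> - \<zeta>0)) has_integral - (\<i> * pi)) UNIV"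
  proof -
    have "Complex u \<phi> - \<zeta>0 = Complex (u - Re \<zeta>0) (\<phi> - Im \<zeta>0)" for u by (simp add: complex_eq_iff)
    then show ?thesis
      using has_integral_inverse_sinh_line(1)[of "\<phi> - Im \<zeta>0" "Re \<zeta>0"] z0 ph th by simp
  qed
  have sinh2: "((\<lambda>u. 1 / sinh (Complex u (-\<phi>) - \<zeta>0)) has_integral \<i> * pi) UNIV"
  proof -
    have "Complex u (-\<phi>) - \<zeta>0 = Complex (u - Re \<zeta>0) (- (\<phi> + Im \<zeta>0))" for u by (simp add: complex_eq_iff)
    then show ?thesis
      using has_integral_inverse_sinh_line(2)[of "\<phi> + Im \<zeta>0" "Re \<zeta>0"] z0 ph th by simp
  qed
  define k where "k \<alpha> u = f (?w (Complex u \<alpha>)) * (?w (Complex u \<alpha>) / (?w (Complex u \<alpha>) - z))" for \<alpha> u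
  have Gl: "G (Complex u \<alpha>) = k \<alpha> u - f z * (1 / sinh (Complex u \<alpha> - \<zeta>0))" if "\<bar>\<alpha>\<bar> = \<phi>" for u \<alpha>
    unfolding k_def by (rule G) (use that z0 ph in auto)
  have ki: "k \<alpha> integrable_on UNIV" if "\<bar>\<alpha>\<bar> = \<phi>" for \<alpha> using line[OF that] by (simp add: k_def[abs_def])
  have G1: "((\<lambda>u. G (Complex u \<phi>)) has_integral (integral UNIV (k \<phi>) - f z * - (\<i> * pi))) UNIV"
    unfolding Gl[of \<phi>, OF abs_of_pos[OF order_le_less_trans[OF abs_ge_zero z0]]]
    by (intro has_integral_diff integrable_integral has_integral_mult_right sinh1 ki) (use z0 in auto)
  have al2: "\<bar>-\<phi>\<bar> = \<phi>" using z0 by auto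
  have G2: "((\<lambda>u. G (Complex u (-\<phi>))) has_integral (integral UNIV (k (-\<phi>)) - f z * (\<i> * pi))) UNIV"
    unfolding Gl[OF al2]
    by (intro has_integral_diff integrable_integral has_integral_mult_right sinh2 ki al2)
  have "integral UNIV (\<lambda>u. G (Complex u (-\<phi>))) = integral UNIV (\<lambda>u. G (Complex u \<phi>))"
  proof (rule holomorphic_line_shift[OF holG U])
    fix e :: real assume e: "e > 0"
    then obtain M where M: "\<And>z. \<bar>Im z\<bar> \<le> \<phi> \<Longrightarrow> M \<le> \<bar>Re z\<bar> \<Longrightarrow> norm (f (?w z)) \<le> e / 4"
      using bisector_fun_strip(3)[OF s ph(1), of "e / 4"] by auto
    \<comment> \<open>Beyond \<open>M\<close> the function \<open>f\<close> is at most
      \<open>e / 4\<close>; horizontal distance 1 makes \<open>far\<close> applicable; distance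
      \<open>norm (f z) * 2 / e\<close> pushes the subtracted term below
      \<open>e / 2\<close>.\<close>
    define K where "K = max M (\<bar>Re \<zeta>0\<bar> + max 1 (norm (f z) * 2 / e))"
    have "norm (G \<zeta>) \<le> e" if "\<bar>Im \<zeta>\<bar> \<le> \<phi>" "K \<le> \<bar>Re \<zeta>\<bar>" for \<zeta>
    proof -
      have d: "\<bar>Re \<zeta> - Re \<zeta>0\<bar> \<ge> 1" "\<bar>Re \<zeta> - Re \<zeta>0\<bar> \<ge> norm (f z) * 2 / e"
        using that by (auto simp: K_def)
      have wz: "?w \<zeta> - z \<noteq> 0"
      proof -
        have "0 < norm (?w \<zeta>) * (1/2)" using s1 by (simp add: norm_mult)
        then show ?thesis using far[OF d(1)] by (metis norm_zero not_le)
      qed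
      have "norm (?w \<zeta> / (?w \<zeta> - z)) \<le> 2"
        using far[OF d(1)] wz by (simp add: norm_divide divide_simps)
      moreover have "norm (f (?w \<zeta>)) \<le> e / 4" using M that by (auto simp: K_def)
      ultimately have 1: "norm (f (?w \<zeta>) * (?w \<zeta> / (?w \<zeta> - z))) \<le> (e / 4) * 2"
        unfolding norm_mult[of "f (?w \<zeta>)"] using e by (intro mult_mono) auto
      have "norm (f z) * 2 / e \<le> norm (sinh (\<zeta> - \<zeta>0))" and p: "1 \<le> norm (sinh (\<zeta> - \<zeta>0))"
        using d sinhb[of "\<zeta> - \<zeta>0"] by auto
      then have "norm (f z) * 2 \<le> e * norm (sinh (\<zeta> - \<zeta>0))" using e by (simp add: divide_simps mult.commute)
      then have 2: "norm (f z * (1 / sinh (\<zeta> - \<zeta>0))) \<le> e / 2"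
        using p e by (simp add: norm_mult norm_divide divide_simps)
      have U: "\<zeta> \<in> ?U" "\<zeta> \<noteq> \<zeta>0" using that ph d by auto
      from order_trans[OF norm_triangle_ineq4 add_mono[OF 1 2]] show ?thesis
        unfolding G[OF U] by simp
    qed
    then show "\<exists>N. \<forall>z. Im z \<in> {-\<phi>..\<phi>} \<longrightarrow> N \<le> \<bar>Re z\<bar> \<longrightarrow> norm (G z) \<le> e"
      by (intro exI[of _ K]) auto
  qed (use z0 ph G1 G2 in auto)
  then have "integral UNIV (k (-\<phi>)) - f z * (\<i> * pi) = integral UNIV (k \<phi>) - f z * - (\<i> * pi)"
    using G1 G2 by (simp add: integral_unique)
  \<comment> \<open>The shift itself contributes nothing; the residue comes from the two different
    integrals of \<open>1 / sinh\<close>.\<close>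
  then have "integral UNIV (k (-\<phi>)) - integral UNIV (k \<phi>) = 2 * pi * \<i> * f z" by (simp add: algebra_simps)
  moreover have "cauchy_int f \<phi> \<sigma> z = (integral UNIV (k (-\<phi>)) - integral UNIV (k \<phi>)) / (2 * pi * \<i>)"
    by (simp add: cauchy_int_def ray_point_def k_def[abs_def] diff_divide_distrib)
  ultimately have "cauchy_int f \<phi> \<sigma> z = f z" by simp
  then show ?thesis by (simp add: z_def)
qed

end

section \<open>The Riesz-Dunford calculus of an abstract resolvent\<close>

lemma bisector_fun_mult:
  assumes th: "0 < \<theta>" "\<theta> < pi / 2" and f: "bisector_fun \<theta> f" and g: "bisector_fun \<theta> g"
  shows "bisector_fun \<theta> (\<lambda>z. f z * g z)"
  unfolding bisector_fun_def
proof (intro conjI ballI allI impI)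
  show "(\<lambda>z. f z * g z) holomorphic_on bisector \<theta>"
    using f g by (auto simp: bisector_fun_def intro: holomorphic_intros)
  obtain B where B: "\<And>z. z \<in> bisector \<theta> \<Longrightarrow> norm (f z) \<le> B" using f by (auto simp: bisector_fun_def)
  obtain C where C: "\<And>z. z \<in> bisector \<theta> \<Longrightarrow> norm (g z) \<le> C" using g by (auto simp: bisector_fun_def)
  have *: "norm (f z * g z) \<le> \<bar>B\<bar> * norm (g z)" if "z \<in> bisector \<theta>" for z
    unfolding norm_mult using B[OF that] by (intro mult_right_mono) auto
  have "norm (f z * g z) \<le> \<bar>B\<bar> * C" if "z \<in> bisector \<theta>" for z
    using *[OF that] mult_left_mono[OF C[OF that], of "\<bar>B\<bar>"] by linarith
  then show "\<exists>B. \<forall>z\<in>bisector \<theta>. norm (f z * g z) \<le> B" by blast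
  fix \<sigma> \<alpha> :: real assume s: "\<sigma> \<in> {1, -1}" and al: "\<bar>\<alpha>\<bar> < \<theta>"
  show "(\<lambda>u. norm (f (of_real \<sigma> * exp (Complex u \<alpha>)) * g (of_real \<sigma> * exp (Complex u \<alpha>)))) integrable_on UNIV"
  proof (rule integrable_on_UNIV_dominated)
    show "(\<lambda>u. \<bar>B\<bar> * norm (g (of_real \<sigma> * exp (Complex u \<alpha>)))) integrable_on UNIV"
      using integrable_cmul[OF bisector_fun_strip(2)[OF th g s al], of "\<bar>B\<bar>"] by simp
    show "continuous_on UNIV (\<lambda>u. norm (f (of_real \<sigma> * exp (Complex u \<alpha>)) * g (of_real \<sigma> * exp (Complex u \<alpha>))))"
      by (intro continuous_intros bisector_fun_strip(4)[OF th f s al] bisector_fun_strip(4)[OF th g s al])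
    fix u
    show "norm (norm (f (of_real \<sigma> * exp (Complex u \<alpha>)) * g (of_real \<sigma> * exp (Complex u \<alpha>))))
        \<le> \<bar>B\<bar> * norm (g (of_real \<sigma> * exp (Complex u \<alpha>)))"
      using * exp_in_bisector_iff[OF s, of "Complex u \<alpha>" \<theta>] th al by simp
  qed
qed

text \<open>Restricted to positive exponents, since the constant 1 is not integrable along
  lines.\<close>

lemma bisector_fun_power:
  assumes th: "0 < \<theta>" "\<theta> < pi / 2" and f: "bisector_fun \<theta> f"
  shows "bisector_fun \<theta> (\<lambda>z. f z ^ Suc k)"
  by (induction k) (use bisector_fun_mult[OF th f] f in auto)

lemma bisector_fun_lincomb:
  assumes th: "0 < \<theta>" "\<theta> < pi / 2" and "finite S" and "\<And>k. k \<in> S \<Longrightarrow> bisector_fun \<theta> (h k)"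
  shows "bisector_fun \<theta> (\<lambda>z. \<Sum>k\<in>S. of_real (c k) * h k z)"
  using assms(3,4)
proof (induction S rule: finite_induct)
  case empty
  then show ?case by (auto simp: bisector_fun_def integrable_0)
next
  case (insert j S)
  let ?g = "\<lambda>z. \<Sum>k\<in>S. of_real (c k) * h k z" and ?f = "\<lambda>z. of_real (c j) * h j z + (\<Sum>k\<in>S. of_real (c k) * h k z)"
  have g: "bisector_fun \<theta> ?g" and h: "bisector_fun \<theta> (h j)" using insert by auto
  obtain B where B: "\<And>z. z \<in> bisector \<theta> \<Longrightarrow> norm (h j z) \<le> B" using h by (auto simp: bisector_fun_def)
  obtain C where C: "\<And>z. z \<in> bisector \<theta> \<Longrightarrow> norm (?g z) \<le> C" using g unfolding bisector_fun_def by blast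
  have *: "norm (?f z) \<le> \<bar>c j\<bar> * norm (h j z) + norm (?g z)" for z
    using norm_triangle_ineq[of "of_real (c j) * h j z" "?g z"] by (simp add: norm_mult)
  have "bisector_fun \<theta> ?f"
    unfolding bisector_fun_def
  proof (intro conjI ballI allI impI)
    show "?f holomorphic_on bisector \<theta>"
      by (intro holomorphic_on_add holomorphic_on_mult holomorphic_on_const)
         (use h g in \<open>simp_all add: bisector_fun_def\<close>)
    have "norm (?f z) \<le> \<bar>c j\<bar> * B + C" if "z \<in> bisector \<theta>" for z
      using *[of z] C[OF that] mult_left_mono[OF B[OF that], of "\<bar>c j\<bar>"] by linarith
    then show "\<exists>B. \<forall>z\<in>bisector \<theta>. norm (?f z) \<le> B" by blast
    fix \<sigma> \<alpha> :: real assume s: "\<sigma> \<in> {1, -1}" and al: "\<bar>\<alpha>\<bar> < \<theta>"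
    show "(\<lambda>u. norm (?f (of_real \<sigma> * exp (Complex u \<alpha>)))) integrable_on UNIV"
    proof (rule integrable_on_UNIV_dominated)
      show "(\<lambda>u. \<bar>c j\<bar> * norm (h j (of_real \<sigma> * exp (Complex u \<alpha>)))
          + norm (?g (of_real \<sigma> * exp (Complex u \<alpha>)))) integrable_on UNIV"
        using integrable_add[OF integrable_cmul[OF bisector_fun_strip(2)[OF th h s al], of "\<bar>c j\<bar>"]
            bisector_fun_strip(2)[OF th g s al]] by simp
      show "continuous_on UNIV (\<lambda>u. norm (?f (of_real \<sigma> * exp (Complex u \<alpha>))))"
        by (intro continuous_on_norm continuous_on_add continuous_on_mult continuous_on_const
            bisector_fun_strip(4)[OF th h s al] bisector_fun_strip(4)[OF th g s al])
    qed (use * in simp)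
  qed
  then show ?case using insert by (simp cong: if_cong)
qed

text \<open>Resolvent bounds are available only beyond angles larger than \<open>\<omega>\<close>.
  By continuity in the angle, every point outside the closed bisector leaves room for such an
  angle.\<close>

lemma outside_bisector_margin:
  assumes om: "\<omega> < pi / 2" and z: "\<bar>Re z\<bar> * sin \<omega> < \<bar>Im z\<bar> * cos \<omega>"
  obtains \<phi> where "\<omega> < \<phi>" "\<phi> < pi / 2" "\<bar>Re z\<bar> * sin \<phi> < \<bar>Im z\<bar> * cos \<phi>"
proof -
  have "\<forall>\<^sub>F \<phi> in at_right \<omega>. 0 < \<bar>Im z\<bar> * cos \<phi> - \<bar>Re z\<bar> * sin \<phi>"
  proof (rule order_tendstoD(1))
    show "((\<lambda>\<phi>. \<bar>Im z\<bar> * cos \<phi> - \<bar>Re z\<bar> * sin \<phi>) \<longlongrightarrow> \<bar>Im z\<bar> * cos \<omega> - \<bar>Re z\<bar> * sin \<omega>) (at_right \<omega>)"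
      by (intro tendsto_intros)
  qed (use z in simp)
  moreover have "\<forall>\<^sub>F \<phi> in at_right \<omega>. \<phi> \<in> {\<omega><..<pi/2}"
    using om by (intro eventually_at_right_real) auto
  ultimately have "\<forall>\<^sub>F \<phi> in at_right \<omega>. \<omega> < \<phi> \<and> \<phi> < pi / 2 \<and> \<bar>Re z\<bar> * sin \<phi> < \<bar>Im z\<bar> * cos \<phi>"
    by eventually_elim auto
  then have "\<exists>\<phi>. \<omega> < \<phi> \<and> \<phi> < pi / 2 \<and> \<bar>Re z\<bar> * sin \<phi> < \<bar>Im z\<bar> * cos \<phi>"
    using eventually_happens[of _ "at_right \<omega>"] trivial_limit_at_right_real by blast
  then show ?thesis using that by blast
qed

text \<open>
  \<open>sc\<close> is the multiplication by complex scalars and \<open>m\<close> the composition of operators. The scalars need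
  to commute with the values of the resolvent only, whence the form of \<open>m_sc\<close>.
\<close>

locale bisectorial_resolvent =
  fixes sc :: "complex \<Rightarrow> 'b::banach \<Rightarrow> 'b" and m :: "'b \<Rightarrow> 'b \<Rightarrow> 'b"
    and R :: "complex \<Rightarrow> 'b" and \<omega> :: real
  assumes sc_bilinear: "bounded_bilinear sc" and m_bilinear: "bounded_bilinear m"
    and sc_mult: "\<And>z w x. sc (z * w) x = sc z (sc w x)" and sc_one: "\<And>x. sc 1 x = x"
    and om: "0 < \<omega>" "\<omega> < pi / 2"
    and resolvent: "\<And>z w. \<bar>Re z\<bar> * sin \<omega> < \<bar>Im z\<bar> * cos \<omega> \<Longrightarrow> \<bar>Re w\<bar> * sin \<omega> < \<bar>Im w\<bar> * cos \<omega> \<Longrightarrow>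
      R z - R w = sc (w - z) (m (R z) (R w))"
    and m_sc: "\<And>z w a b. \<bar>Re z\<bar> * sin \<omega> < \<bar>Im z\<bar> * cos \<omega> \<Longrightarrow> \<bar>Re w\<bar> * sin \<omega> < \<bar>Im w\<bar> * cos \<omega> \<Longrightarrow>
      m (sc a (R z)) (sc b (R w)) = sc (a * b) (m (R z) (R w))"
    and bound: "\<And>\<phi>. \<omega> < \<phi> \<Longrightarrow> \<phi> < pi / 2 \<Longrightarrow>
      \<exists>M. \<forall>z. z \<noteq> 0 \<longrightarrow> z \<notin> bisector \<phi> \<longrightarrow> norm (R z) \<le> M / norm z"
begin

sublocale sc: bounded_bilinear sc by (rule sc_bilinear)
sublocale m: bounded_bilinear m by (rule m_bilinear)

definition \<Omega> :: "complex set" where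
  "\<Omega> = {z. \<bar>Re z\<bar> * sin \<omega> < \<bar>Im z\<bar> * cos \<omega>}"

lemma open_Omega: "open \<Omega>"
  unfolding \<Omega>_def by (intro open_Collect_less continuous_intros)

text \<open>Brings complex linear derivatives into the shape required by
  \<open>integral_line_shift\<close>, with \<open>sc \<i>\<close> as complex structure.\<close>

lemma sc_Re_Im: "sc h x = Re h *\<^sub>R x + Im h *\<^sub>R sc \<i> x"
proof -
  have "h = Re h *\<^sub>R 1 + Im h *\<^sub>R \<i>" by (simp add: complex_eq_iff)
  then have "sc h x = sc (Re h *\<^sub>R 1 + Im h *\<^sub>R \<i>) x" by simp
  then show ?thesis by (simp add: sc.add_left sc.scaleR_left sc_one)
qed

text \<open>The resolvent identity bounds the difference by a multiple of
  \<open>norm (z - w) * norm (R w)\<close>, and near \<open>z\<close> the factor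
  \<open>norm (R w)\<close> is bounded through a slightly larger angle.\<close>

lemma isCont_R:
  assumes z: "z \<in> \<Omega>"
  shows "isCont R z"
proof -
  obtain \<phi> where ph: "\<omega> < \<phi>" "\<phi> < pi / 2" "\<bar>Re z\<bar> * sin \<phi> < \<bar>Im z\<bar> * cos \<phi>"
    using outside_bisector_margin[OF om(2)] z unfolding \<Omega>_def by blast
  obtain M where M: "\<And>w. w \<noteq> 0 \<Longrightarrow> w \<notin> bisector \<phi> \<Longrightarrow> norm (R w) \<le> M / norm w"
    using bound[OF ph(1,2)] by blast
  obtain K where K: "K > 0" "\<And>a x. norm (sc a x) \<le> norm a * norm x * K" using sc.pos_bounded by blast
  obtain L where L: "L > 0" "\<And>x y. norm (m x y) \<le> norm x * norm y * L" using m.pos_bounded by blast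
  have z0: "z \<noteq> 0" using ph(3) by auto
  let ?U = "{w. \<bar>Re w\<bar> * sin \<phi> < \<bar>Im w\<bar> * cos \<phi>} \<inter> \<Omega>"
  have U: "open ?U"
    by (intro open_Int open_Omega open_Collect_less continuous_intros)
  have ev: "\<forall>\<^sub>F w in at z. norm (R w - R z) \<le> norm (z - w) * ((M / norm w) * norm (R z) * L) * K"
  proof -
    have "\<forall>\<^sub>F w in at z. w \<in> ?U"
      using U ph(3) z by (intro eventually_at_in_open') auto
    then show ?thesis
    proof eventually_elim
      case (elim w)
      then have w: "w \<noteq> 0" "w \<notin> bisector \<phi>" "w \<in> \<Omega>" by (auto simp: bisector_def)
      have "norm (R w - R z) \<le> norm (z - w) * norm (m (R w) (R z)) * K"
        using K(2) resolvent[of w z] w z by (simp add: \<Omega>_def)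
      also have "\<dots> \<le> norm (z - w) * ((M / norm w) * norm (R z) * L) * K"
        using M[OF w(1,2)] K L
        by (intro mult_right_mono mult_left_mono order_trans[OF L(2)]) auto
      finally show ?case .
    qed
  qed
  have "((\<lambda>w. norm (z - w) * ((M / norm w) * norm (R z) * L) * K) \<longlongrightarrow> norm (z - z) * ((M / norm z) * norm (R z) * L) * K) (at z)"
    by (intro tendsto_intros) (use z0 in auto)
  then have "((\<lambda>w. norm (z - w) * ((M / norm w) * norm (R z) * L) * K) \<longlongrightarrow> 0) (at z)" by simp
  then have "((\<lambda>w. R w - R z) \<longlongrightarrow> 0) (at z)" by (rule Lim_null_comparison[OF ev])
  then show ?thesis unfolding isCont_def by (rule LIM_zero_cancel)
qed

text \<open>By the resolvent identity the remainder of the linear approximation is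
  \<open>sc (z - w) (m (R w - R z) (R z))\<close>, which is of smaller order by continuity of
  \<open>R\<close>.\<close>

lemma has_derivative_R:
  assumes z: "z \<in> \<Omega>"
  shows "(R has_derivative (\<lambda>h. sc (- h) (m (R z) (R z)))) (at z)"
  unfolding has_derivative_at_within
proof (intro conjI)
  show "bounded_linear (\<lambda>h. sc (- h) (m (R z) (R z)))"
    using bounded_linear_compose[OF sc.bounded_linear_left bounded_linear_minus[OF bounded_linear_ident]] .
  obtain K where K: "K > 0" "\<And>a x. norm (sc a x) \<le> norm a * norm x * K" using sc.pos_bounded by blast
  have "((\<lambda>w. norm (m (R w - R z) (R z)) * K) \<longlongrightarrow> norm (m (R z - R z) (R z)) * K) (at z)"
    using isCont_R[OF z] unfolding isCont_def by (intro tendsto_intros m.tendsto)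
  then have lim: "((\<lambda>w. norm (m (R w - R z) (R z)) * K) \<longlongrightarrow> 0) (at z)" by (simp add: m.zero_left)
  show "((\<lambda>w. (R w - R z - sc (- (w - z)) (m (R z) (R z))) /\<^sub>R norm (w - z)) \<longlongrightarrow> 0) (at z)"
  proof (rule Lim_null_comparison[OF _ lim])
    have "\<forall>\<^sub>F w in at z. w \<in> \<Omega>"
      using open_Omega z by (intro eventually_at_in_open') auto
    moreover have "\<forall>\<^sub>F w in at z. w \<noteq> z" by (simp add: eventually_at_filter)
    ultimately show "\<forall>\<^sub>F w in at z. norm ((R w - R z - sc (- (w - z)) (m (R z) (R z))) /\<^sub>R norm (w - z))
        \<le> norm (m (R w - R z) (R z)) * K"
    proof eventually_elim
      case (elim w)
      have "R w - R z - sc (- (w - z)) (m (R z) (R z)) = sc (z - w) (m (R w - R z) (R z))"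
      proof -
        have eq: "R w - R z = sc (z - w) (m (R w) (R z))"
          using resolvent[of w z] elim z by (simp add: \<Omega>_def)
        show ?thesis unfolding m.diff_left unfolding sc.diff_right eq by simp
      qed
      then show ?case
        using K(2)[of "z - w" "m (R w - R z) (R z)"] elim
        by (simp add: divide_simps norm_minus_commute mult_ac)
    qed
  qed
qed

section \<open>The operator integral over the four boundary rays\<close>

definition signs :: "(real \<times> real) set" where "signs = {1, -1} \<times> {1, -1}"

abbreviation pt where "pt \<phi> p u \<equiv> ray_point \<phi> (fst p) (snd p) u"

text \<open>The scalar factor of \<open>f(z) R(z) dz / (2 pi i)\<close>, with
  \<open>dz = z du\<close> along a ray and the orientation \<open>- \<epsilon>\<close> of
  \<open>cauchy_int\<close>.\<close>

definition coef :: "real \<Rightarrow> (complex \<Rightarrow> complex) \<Rightarrow> real \<times> real \<Rightarrow> real \<Rightarrow> complex" where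
  "coef \<phi> f p u = - of_real (snd p) / (2 * pi * \<i>) * (f (pt \<phi> p u) * pt \<phi> p u)"

definition Op :: "real \<Rightarrow> (complex \<Rightarrow> complex) \<Rightarrow> 'b" where
  "Op \<phi> f = (\<Sum>p\<in>signs. integral UNIV (\<lambda>u. sc (coef \<phi> f p u) (R (pt \<phi> p u))))"

lemma finite_signs [simp]: "finite signs" by (simp add: signs_def)

lemma sum_signs: "(\<Sum>p\<in>signs. h p) = (\<Sum>\<sigma>\<in>{1, -1}. \<Sum>\<epsilon>\<in>{1, -1}. h (\<sigma>, \<epsilon>))"
  by (simp add: signs_def sum.cartesian_product add.assoc)

lemma exp_in_Omega:
  assumes "\<sigma> \<in> {1, -1}" "\<omega> < \<bar>Im \<zeta>\<bar>" "\<bar>Im \<zeta>\<bar> < pi / 2"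
  shows "of_real \<sigma> * exp \<zeta> \<in> \<Omega>"
proof -
  have s: "\<bar>\<sigma>\<bar> = 1" using assms by auto
  have c: "0 < cos \<bar>Im \<zeta>\<bar>" "0 < sin (\<bar>Im \<zeta>\<bar> - \<omega>)" "0 < sin \<bar>Im \<zeta>\<bar>"
    using assms om by (auto intro!: cos_gt_zero_pi sin_gt_zero simp del: cos_abs_real)
  have "\<bar>sin (Im \<zeta>)\<bar> = sin \<bar>Im \<zeta>\<bar>"
  proof (cases "Im \<zeta> \<ge> 0")
    case True then show ?thesis using c by simp
  next
    case False then show ?thesis using c by simp
  qed
  then have "\<bar>cos (Im \<zeta>)\<bar> * sin \<omega> < \<bar>sin (Im \<zeta>)\<bar> * cos \<omega>"
    using c by (simp add: sin_diff mult.commute)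
  then show ?thesis using s by (simp add: \<Omega>_def Re_exp Im_exp abs_mult mult.assoc)
qed

context
  fixes \<theta> :: real
  assumes th: "\<omega> < \<theta>" "\<theta> < pi / 2"
begin

lemma th0: "0 < \<theta>" using th om by simp

lemma pt_eq: "pt \<phi> p u = of_real (fst p) * exp (Complex u (snd p * \<phi>))"
  by (simp add: ray_point_def)

lemma signs_D:
  assumes "p \<in> signs" and "0 < \<phi>"
  shows "fst p \<in> {1, -1}" "\<bar>snd p * \<phi>\<bar> = \<phi>" "norm (snd p) = 1"
  using assms by (auto simp: signs_def)

lemma pt_Omega: "p \<in> signs \<Longrightarrow> \<omega> < \<phi> \<Longrightarrow> \<phi> < \<theta> \<Longrightarrow> pt \<phi> p u \<in> \<Omega>"
  unfolding pt_eq using signs_D[of p \<phi>] om th by (intro exp_in_Omega) auto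

lemma continuous_pt: "continuous_on S (pt \<phi> p)"
  unfolding ray_point_def by (auto simp: Complex_eq intro!: continuous_intros)

lemma continuous_R_pt:
  assumes "p \<in> signs" "\<omega> < \<phi>" "\<phi> < \<theta>"
  shows "continuous_on S (\<lambda>u. R (pt \<phi> p u))"
proof (rule continuous_on_compose2[of \<Omega> R])
  show "continuous_on \<Omega> R" using isCont_R by (simp add: continuous_at_imp_continuous_on)
qed (use continuous_pt pt_Omega[OF assms] in auto)

lemma continuous_f_pt:
  assumes "p \<in> signs" "\<omega> < \<phi>" "\<phi> < \<theta>" "bisector_fun \<theta> f"
  shows "continuous_on UNIV (\<lambda>u. f (pt \<phi> p u))"
  unfolding pt_eq
  by (rule bisector_fun_strip(4)[OF th0 th(2) assms(4)])
     (use signs_D[OF assms(1), of \<phi>] om assms in auto)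

lemma integrable_f_pt:
  assumes "p \<in> signs" "\<omega> < \<phi>" "\<phi> < \<theta>" "bisector_fun \<theta> f"
  shows "(\<lambda>u. norm (f (pt \<phi> p u))) integrable_on UNIV"
  unfolding pt_eq
  by (rule bisector_fun_strip(2)[OF th0 th(2) assms(4)])
     (use signs_D[OF assms(1), of \<phi>] om assms in auto)

text \<open>The factor \<open>z\<close> from \<open>dz = z du\<close> cancels the decay
  \<open>1 / norm z\<close> of the resolvent, so that along rays the function alone controls the
  integrand.\<close>

lemma norm_integrand_le:
  assumes "\<omega> < \<phi>" "\<phi> < pi / 2"
  obtains C where "C \<ge> 0" "\<And>z a. z \<noteq> 0 \<Longrightarrow> z \<notin> bisector \<phi> \<Longrightarrow> norm (sc (a * z) (R z)) \<le> norm a * C"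
proof -
  obtain M where M: "\<And>w. w \<noteq> 0 \<Longrightarrow> w \<notin> bisector \<phi> \<Longrightarrow> norm (R w) \<le> M / norm w"
    using bound[OF assms] by blast
  obtain K where K: "K > 0" "\<And>a x. norm (sc a x) \<le> norm a * norm x * K" using sc.pos_bounded by blast
  show ?thesis
  proof (rule that[of "\<bar>M\<bar> * K"])
    fix z a :: complex assume z: "z \<noteq> 0" "z \<notin> bisector \<phi>"
    have "norm (sc (a * z) (R z)) \<le> norm (a * z) * norm (R z) * K" by (rule K)
    also have "\<dots> \<le> norm (a * z) * (\<bar>M\<bar> / norm z) * K"
    proof -
      have "norm (R z) \<le> \<bar>M\<bar> / norm z"
        using M[OF z] by (rule order_trans) (simp add: divide_right_mono)
      then show ?thesis using K by (intro mult_right_mono mult_left_mono) auto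
    qed
    also have "\<dots> = norm a * (\<bar>M\<bar> * K)" using z by (simp add: norm_mult)
    finally show "norm (sc (a * z) (R z)) \<le> norm a * (\<bar>M\<bar> * K)" .
  qed (use K in simp)
qed

lemma pt_not_bisector:
  assumes "p \<in> signs" "\<omega> < \<phi>" "\<phi> < \<theta>"
  shows "pt \<phi> p u \<noteq> 0" "pt \<phi> p u \<notin> bisector \<phi>"
proof -
  have p: "fst p \<in> {1, -1}" "\<bar>snd p * \<phi>\<bar> = \<phi>" using signs_D[OF assms(1), of \<phi>] om assms by auto
  then show "pt \<phi> p u \<noteq> 0" by (auto simp: pt_eq)
  show "pt \<phi> p u \<notin> bisector \<phi>"
    unfolding pt_eq using exp_in_bisector_iff[OF p(1), of "Complex u (snd p * \<phi>)" \<phi>] p assms om th by simp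
qed

lemma coef_integrable:
  assumes "p \<in> signs" "\<omega> < \<phi>" "\<phi> < \<theta>" "bisector_fun \<theta> f"
  shows "(\<lambda>u. sc (coef \<phi> f p u) (R (pt \<phi> p u))) integrable_on UNIV"
    and "continuous_on UNIV (coef \<phi> f p)"
proof -
  show c: "continuous_on UNIV (coef \<phi> f p)"
    unfolding coef_def by (intro continuous_intros continuous_f_pt[OF assms] continuous_pt) auto
  obtain C where C: "C \<ge> 0" "\<And>z a. z \<noteq> 0 \<Longrightarrow> z \<notin> bisector \<phi> \<Longrightarrow> norm (sc (a * z) (R z)) \<le> norm a * C"
    using norm_integrand_le[of \<phi>] assms th by auto
  show "(\<lambda>u. sc (coef \<phi> f p u) (R (pt \<phi> p u))) integrable_on UNIV"
  proof (rule integrable_on_UNIV_dominated)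
    show "continuous_on UNIV (\<lambda>u. sc (coef \<phi> f p u) (R (pt \<phi> p u)))"
      by (intro sc.continuous_on c continuous_R_pt assms)
    show "(\<lambda>u. (C / (2 * pi)) * norm (f (pt \<phi> p u))) integrable_on UNIV"
      using integrable_cmul[OF integrable_f_pt[OF assms], of "C / (2 * pi)"] by simp
    fix u
    have "coef \<phi> f p u = (- of_real (snd p) / (2 * pi * \<i>) * f (pt \<phi> p u)) * pt \<phi> p u"
      by (simp add: coef_def)
    then show "norm (sc (coef \<phi> f p u) (R (pt \<phi> p u))) \<le> (C / (2 * pi)) * norm (f (pt \<phi> p u))"
      using C(2)[OF pt_not_bisector[OF assms(1-3)], of "- of_real (snd p) / (2 * pi * \<i>) * f (pt \<phi> p u)" u]
        signs_D(3)[OF assms(1), of 1]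
      by (simp add: norm_mult norm_divide mult.commute)
  qed
qed

lemma Op_lincomb:
  assumes ph: "\<omega> < \<phi>" "\<phi> < \<theta>" and S: "finite S" "\<And>k. k \<in> S \<Longrightarrow> bisector_fun \<theta> (h k)"
  shows "Op \<phi> (\<lambda>z. \<Sum>k\<in>S. of_real (c k) * h k z) = (\<Sum>k\<in>S. c k *\<^sub>R Op \<phi> (h k))"
proof -
  have "coef \<phi> (\<lambda>z. \<Sum>k\<in>S. of_real (c k) * h k z) p u = (\<Sum>k\<in>S. c k *\<^sub>R coef \<phi> (h k) p u)" for p u
    by (simp add: coef_def sum_distrib_left sum_distrib_right scaleR_conv_of_real mult_ac)
  then have "Op \<phi> (\<lambda>z. \<Sum>k\<in>S. of_real (c k) * h k z)
      = (\<Sum>p\<in>signs. integral UNIV (\<lambda>u. \<Sum>k\<in>S. c k *\<^sub>R sc (coef \<phi> (h k) p u) (R (pt \<phi> p u))))"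
    by (simp add: Op_def sc.sum_left sc.scaleR_left)
  also have "\<dots> = (\<Sum>p\<in>signs. \<Sum>k\<in>S. c k *\<^sub>R integral UNIV (\<lambda>u. sc (coef \<phi> (h k) p u) (R (pt \<phi> p u))))"
    by (intro sum.cong refl)
       (subst integral_sum, auto intro!: S integrable_cmul coef_integrable ph)
  also have "\<dots> = (\<Sum>k\<in>S. c k *\<^sub>R Op \<phi> (h k))"
    unfolding Op_def scaleR_sum_right by (rule sum.swap)
  finally show ?thesis .
qed

text \<open>The four rays are shifted separately: between the two angles the resolvent is
  holomorphic, and since \<open>z R(z)\<close> is bounded there, the decay of \<open>f\<close>
  suffices at the ends.\<close>

lemma Op_angle_independent_less:
  assumes ph: "\<omega> < \<phi>1" "\<phi>1 \<le> \<phi>2" "\<phi>2 < \<theta>" and f: "bisector_fun \<theta> f"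
  shows "Op \<phi>1 f = Op \<phi>2 f"
  unfolding Op_def
proof (rule sum.cong[OF refl])
  fix p assume p: "p \<in> signs"
  define s where "s \<zeta> = - of_real (snd p) / (2 * pi * \<i>) * (f (of_real (fst p) * exp \<zeta>) * (of_real (fst p) * exp \<zeta>))" for \<zeta>
  let ?w = "\<lambda>\<zeta>. of_real (fst p) * exp \<zeta> :: complex"
  define \<Phi> where "\<Phi> \<zeta> = sc (s \<zeta>) (R (?w \<zeta>))" for \<zeta>
  \<comment> \<open>Product and chain rule, with \<open>- R\<^sup>2\<close> as derivative of the
    resolvent and \<open>?w\<close> as its own derivative.\<close>
  define \<Phi>' where "\<Phi>' \<zeta> = sc (deriv s \<zeta>) (R (?w \<zeta>)) - sc (s \<zeta> * ?w \<zeta>) (m (R (?w \<zeta>)) (R (?w \<zeta>)))" for \<zeta>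
  have fp: "fst p \<in> {1, -1}" using signs_D[OF p, of 1] by simp
  define S where "S = {\<zeta>::complex. \<phi>1 \<le> \<bar>Im \<zeta>\<bar> \<and> \<bar>Im \<zeta>\<bar> \<le> \<phi>2}"
  have W: "?w \<zeta> \<in> \<Omega>" "\<bar>Im \<zeta>\<bar> < \<theta>" "?w \<zeta> \<noteq> 0" "?w \<zeta> \<notin> bisector \<phi>1" if "\<zeta> \<in> S" for \<zeta>
    using that ph th om fp exp_in_Omega[OF fp, of \<zeta>] exp_in_bisector_iff[OF fp, of \<zeta> \<phi>1]
    by (auto simp: S_def)
  have U: "open {\<zeta>::complex. \<bar>Im \<zeta>\<bar> < \<theta>}" by (intro open_Collect_less continuous_intros)
  have hols: "s holomorphic_on {\<zeta>. \<bar>Im \<zeta>\<bar> < \<theta>}"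
    unfolding s_def by (intro holomorphic_intros bisector_fun_strip(1)[OF th0 th(2) f fp]) auto
  have eqs: "integral UNIV (\<lambda>u. \<Phi> (Complex u a)) = integral UNIV (\<lambda>u. \<Phi> (Complex u b))"
    if ab: "a \<le> b" "\<And>x. x \<in> {a..b} \<Longrightarrow> \<phi>1 \<le> \<bar>x\<bar> \<and> \<bar>x\<bar> \<le> \<phi>2"
      and int: "(\<lambda>u. \<Phi> (Complex u a)) integrable_on UNIV" "(\<lambda>u. \<Phi> (Complex u b)) integrable_on UNIV" for a b
  proof (rule integral_line_shift[of "sc \<i>" a b \<Phi> \<Phi>'])
    show "bounded_linear (sc \<i>)" by (rule sc.bounded_linear_right)
    have inS: "\<zeta> \<in> S" if "Im \<zeta> \<in> {a..b}" for \<zeta> using ab(2)[OF that] by (simp add: S_def)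
    show "(\<Phi> has_derivative (\<lambda>h. Re h *\<^sub>R \<Phi>' \<zeta> + Im h *\<^sub>R sc \<i> (\<Phi>' \<zeta>))) (at \<zeta>)" if "Im \<zeta> \<in> {a..b}" for \<zeta>
    proof -
      note w = W[OF inS[OF that]]
      have ds: "(s has_derivative (*) (deriv s \<zeta>)) (at \<zeta>)"
        using hols U w(2) holomorphic_derivI has_field_derivative_imp_has_derivative by blast
      have dw: "(?w has_derivative (*) (?w \<zeta>)) (at \<zeta>)"
        using has_field_derivative_imp_has_derivative[of ?w "?w \<zeta>"] by (auto intro!: derivative_eq_intros)
      have dR: "((\<lambda>\<zeta>. R (?w \<zeta>)) has_derivative (\<lambda>h. sc (- (?w \<zeta> * h)) (m (R (?w \<zeta>)) (R (?w \<zeta>))))) (at \<zeta>)"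
        using has_derivative_compose[OF dw has_derivative_R[OF w(1)]] .
      have "(\<Phi> has_derivative (\<lambda>h. sc (s \<zeta>) (sc (- (?w \<zeta> * h)) (m (R (?w \<zeta>)) (R (?w \<zeta>)))) + sc (deriv s \<zeta> * h) (R (?w \<zeta>)))) (at \<zeta>)"
        unfolding \<Phi>_def[abs_def] by (rule sc.FDERIV[OF ds dR])
      moreover have "(\<lambda>h. sc (s \<zeta>) (sc (- (?w \<zeta> * h)) (m (R (?w \<zeta>)) (R (?w \<zeta>)))) + sc (deriv s \<zeta> * h) (R (?w \<zeta>)))
          = (\<lambda>h. sc h (\<Phi>' \<zeta>))"
        by (simp add: fun_eq_iff \<Phi>'_def sc.diff_right sc.minus_left sc.minus_right mult_ac flip: sc_mult)
      ultimately show ?thesis unfolding sc_Re_Im[symmetric] by simp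
    qed
    show "continuous_on {\<zeta>. Im \<zeta> \<in> {a..b}} \<Phi>'"
    proof -
      have cR: "continuous_on {\<zeta>. Im \<zeta> \<in> {a..b}} (\<lambda>\<zeta>. R (?w \<zeta>))"
        by (rule continuous_on_compose2[of \<Omega> R])
           (use isCont_R W(1) inS in \<open>auto simp: continuous_at_imp_continuous_on intro!: continuous_intros\<close>)
      have sub: "{\<zeta>. Im \<zeta> \<in> {a..b}} \<subseteq> {\<zeta>. \<bar>Im \<zeta>\<bar> < \<theta>}" using W(2) inS by blast
      show ?thesis unfolding \<Phi>'_def
        by (intro continuous_intros sc.continuous_on m.continuous_on cR
            holomorphic_on_imp_continuous_on[THEN continuous_on_subset, OF _ sub] holomorphic_deriv[OF hols U] hols)
    qed
    fix e :: real assume e: "e > 0"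
    obtain C where C: "C \<ge> 0" "\<And>z a. z \<noteq> 0 \<Longrightarrow> z \<notin> bisector \<phi>1 \<Longrightarrow> norm (sc (a * z) (R z)) \<le> norm a * C"
      using norm_integrand_le[of \<phi>1] ph th by auto
    have "e / (C + 1) > 0" using e C by simp
    then obtain N where N: "\<And>z. \<bar>Im z\<bar> \<le> \<phi>2 \<Longrightarrow> N \<le> \<bar>Re z\<bar> \<Longrightarrow> norm (f (?w z)) \<le> e / (C + 1)"
      using bisector_fun_strip(3)[OF th0 th(2) f fp ph(3)] by blast
    have "norm (\<Phi> \<zeta>) \<le> e" if i: "Im \<zeta> \<in> {a..b}" and n: "N \<le> \<bar>Re \<zeta>\<bar>" for \<zeta>
    proof -
      note w = W[OF inS[OF i]]
      have "norm (\<Phi> \<zeta>) = norm (sc ((- of_real (snd p) / (2 * pi * \<i>) * f (?w \<zeta>)) * ?w \<zeta>) (R (?w \<zeta>)))"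
        by (simp add: \<Phi>_def s_def mult.assoc)
      also have "\<dots> \<le> norm (- of_real (snd p) / (2 * pi * \<i>) * f (?w \<zeta>)) * C"
        by (rule C(2)[OF w(3,4)])
      also have "\<dots> = (1 / (2 * pi)) * (norm (f (?w \<zeta>)) * C)"
        using signs_D(3)[OF p, of 1] by (simp add: norm_mult norm_divide)
      also have "\<dots> \<le> 1 * ((e / (C + 1)) * (C + 1))"
        using N[OF _ n] inS[OF i] C(1) e pi_gt3
        by (intro mult_mono) (auto simp: S_def)
      finally show ?thesis using C by simp
    qed
    then show "\<exists>N. \<forall>z. Im z \<in> {a..b} \<longrightarrow> N \<le> \<bar>Re z\<bar> \<longrightarrow> norm (\<Phi> z) \<le> e" by blast
  qed (use ab int in auto)
  have co: "sc (coef \<phi> f p u) (R (pt \<phi> p u)) = \<Phi> (Complex u (snd p * \<phi>))" for \<phi> u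
    by (simp add: \<Phi>_def s_def coef_def ray_point_def)
  have int: "(\<lambda>u. \<Phi> (Complex u (snd p * \<phi>))) integrable_on UNIV" if "\<omega> < \<phi>" "\<phi> < \<theta>" for \<phi>
    using coef_integrable(1)[OF p that f] unfolding co .
  show "integral UNIV (\<lambda>u. sc (coef \<phi>1 f p u) (R (pt \<phi>1 p u))) = integral UNIV (\<lambda>u. sc (coef \<phi>2 f p u) (R (pt \<phi>2 p u)))"
    unfolding co
  proof (cases "snd p = 1")
    case True
    have "integral UNIV (\<lambda>u. \<Phi> (Complex u \<phi>1)) = integral UNIV (\<lambda>u. \<Phi> (Complex u \<phi>2))"
    proof (rule eqs)
      show "\<phi>1 \<le> \<bar>x\<bar> \<and> \<bar>x\<bar> \<le> \<phi>2" if "x \<in> {\<phi>1..\<phi>2}" for x using that ph om by auto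
    qed (use int[of \<phi>1] int[of \<phi>2] True ph in simp_all)
    then show "integral UNIV (\<lambda>u. \<Phi> (Complex u (snd p * \<phi>1))) = integral UNIV (\<lambda>u. \<Phi> (Complex u (snd p * \<phi>2)))"
      by (simp only: True mult_1)
  next
    case False
    then have m1: "snd p = -1" using p by (auto simp: signs_def)
    \<comment> \<open>For the sign \<open>-1\<close> the larger angle is the smaller ordinate, so
      the two lines exchange their roles.\<close>
    have "integral UNIV (\<lambda>u. \<Phi> (Complex u (- \<phi>2))) = integral UNIV (\<lambda>u. \<Phi> (Complex u (- \<phi>1)))"
    proof (rule eqs)
      show "\<phi>1 \<le> \<bar>x\<bar> \<and> \<bar>x\<bar> \<le> \<phi>2" if "x \<in> {-\<phi>2..-\<phi>1}" for x using that ph om by auto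
    qed (use int[of \<phi>1] int[of \<phi>2] m1 ph in simp_all)
    then show "integral UNIV (\<lambda>u. \<Phi> (Complex u (snd p * \<phi>1))) = integral UNIV (\<lambda>u. \<Phi> (Complex u (snd p * \<phi>2)))"
      by (simp only: m1 mult_minus_left mult_1)
  qed
qed

lemma Op_angle_independent:
  assumes "\<omega> < \<phi>1" "\<phi>1 < \<theta>" "\<omega> < \<phi>2" "\<phi>2 < \<theta>" and "bisector_fun \<theta> f"
  shows "Op \<phi>1 f = Op \<phi>2 f"
proof (cases "\<phi>1 \<le> \<phi>2")
  case True
  show ?thesis by (rule Op_angle_independent_less) (use True assms in simp_all)
next
  case False
  show ?thesis by (rule Op_angle_independent_less[symmetric]) (use False assms in simp_all)
qed

lemma cauchy_int_signs:
  "(\<Sum>p\<in>signs. integral UNIV (\<lambda>u. coef \<phi> f p u / (pt \<phi> p u - z)))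
    = (\<Sum>\<sigma>\<in>{1, -1}. cauchy_int f \<phi> \<sigma> z)"
proof -
  have "integral UNIV (\<lambda>u. coef \<phi> f p u / (pt \<phi> p u - z)) = - of_real (snd p) / (2 * pi * \<i>) *
      integral UNIV (\<lambda>u. f (pt \<phi> p u) * (pt \<phi> p u / (pt \<phi> p u - z)))" for p
    unfolding integral_mult_right[symmetric] by (simp add: coef_def mult.assoc)
  then show ?thesis by (simp only: sum_signs cauchy_int_def fst_conv snd_conv)
qed

lemma coef_quotient_integrable:
  assumes "p \<in> signs" "\<omega> < \<phi>" "\<phi> < \<theta>" and f: "bisector_fun \<theta> f" and k: "k > 0"
    and low: "\<And>u. k * norm (pt \<phi> p u) \<le> norm (pt \<phi> p u - z)"
  shows "(\<lambda>u. coef \<phi> f p u / (pt \<phi> p u - z)) integrable_on UNIV"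
proof -
  have p: "fst p \<in> {1, -1}" "\<bar>snd p * \<phi>\<bar> < \<theta>" using signs_D[OF assms(1), of \<phi>] om assms by auto
  have "(\<lambda>u. f (pt \<phi> p u) * (pt \<phi> p u / (pt \<phi> p u - z))) integrable_on UNIV"
    unfolding pt_eq by (rule kernel_integrable[OF th0 th(2) f p k]) (use low in \<open>simp add: pt_eq\<close>)
  from integrable_on_mult_right[OF this, of "- of_real (snd p) / (2 * pi * \<i>)"]
  show ?thesis by (simp add: coef_def mult.assoc)
qed

text \<open>
  The product of the two integrands is split by the resolvent identity. As \<open>\<phi>1 < \<phi>2\<close>, Cauchy's formula
  for \<open>g\<close> evaluates one part to \<open>f g\<close>, and in the other part, after changing the order of integration,
  the inner integral of \<open>f\<close> vanishes.
\<close>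

lemma Op_mult_less:
  assumes ph: "\<omega> < \<phi>1" "\<phi>1 < \<phi>2" "\<phi>2 < \<theta>"
    and f: "bisector_fun \<theta> f" and g: "bisector_fun \<theta> g"
  shows "m (Op \<phi>1 f) (Op \<phi>2 g) = Op \<phi>1 (\<lambda>z. f z * g z)"
proof -
  have ph': "\<phi>1 < \<theta>" "\<omega> < \<phi>2" "0 < \<phi>1" "0 < \<phi>2" "\<phi>1 + \<phi>2 < pi" "\<phi>2 < pi / 2" "\<phi>1 < pi / 2"
    using ph om th by auto
  have fg: "bisector_fun \<theta> (\<lambda>z. f z * g z)" by (rule bisector_fun_mult[OF th0 th(2) f g])
  define Z where "Z p u = pt \<phi>1 p u" for p u
  define W where "W q v = pt \<phi>2 q v" for q v
  define a where "a p u = coef \<phi>1 f p u" for p u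
  define b where "b q v = coef \<phi>2 g q v" for q v
  define \<Psi> where "\<Psi> p q u v = sc (a p u * b q v / (W q v - Z p u)) (R (W q v))" for p q u v
  obtain k where k: "k > 0" and sep: "\<And>\<sigma> \<tau> \<zeta> \<zeta>0. \<sigma> \<in> {1, -1} \<Longrightarrow> \<tau> \<in> {1, -1} \<Longrightarrow> \<bar>Im \<zeta>0 - Im \<zeta>\<bar> \<le> \<phi>1 + \<phi>2 \<Longrightarrow>
      (\<sigma> = \<tau> \<Longrightarrow> \<phi>2 - \<phi>1 \<le> \<bar>Im \<zeta>0 - Im \<zeta>\<bar>) \<Longrightarrow>
      k * norm (of_real \<sigma> * exp \<zeta>) \<le> norm (of_real \<sigma> * exp \<zeta> - of_real \<tau> * exp \<zeta>0)"
    using bisector_separation[OF less_imp_le[OF ph'(3)] ph(2) ph'(6)] by metis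
  have angle: "\<bar>snd p * \<phi>1 - snd q * \<phi>2\<bar> \<le> \<phi>1 + \<phi>2" "\<phi>2 - \<phi>1 \<le> \<bar>snd p * \<phi>1 - snd q * \<phi>2\<bar>"
    if "p \<in> signs" "q \<in> signs" for p q
    using that ph ph' by (auto simp: signs_def)
  have sepW: "k * norm (W q v) \<le> norm (W q v - Z p u)" and sepZ: "k * norm (Z p u) \<le> norm (Z p u - W q v)"
    if "p \<in> signs" "q \<in> signs" for p q u v
    unfolding Z_def W_def pt_eq
    using angle[OF that] signs_D(1)[OF that(1), of 1] signs_D(1)[OF that(2), of 1]
    by (intro sep; simp add: abs_minus_commute)+
  have nz: "W q v \<noteq> 0" "Z p u \<noteq> 0" "W q v \<noteq> Z p u" if "p \<in> signs" "q \<in> signs" for p q u v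
  proof -
    show 0: "W q v \<noteq> 0" "Z p u \<noteq> 0"
      unfolding W_def Z_def using pt_not_bisector(1) that ph ph' by auto
    have "0 < k * norm (W q v)" using k 0 by simp
    then show "W q v \<noteq> Z p u" using sepW[OF that, of v u] by auto
  qed
  have Om: "W q v \<in> \<Omega>" "Z q u \<in> \<Omega>" if "q \<in> signs" for q u v
    unfolding W_def Z_def using pt_Omega that ph ph' by auto
  \<comment> \<open>\<open>Z p u\<close> lies inside the half of the larger contour with its own
    sign and outside the opposite half, so Cauchy's formula contributes once.\<close>
  have inside: "(\<Sum>q\<in>signs. integral UNIV (\<lambda>v. b q v / (W q v - Z p u))) = g (Z p u)" if p: "p \<in> signs" for p u
  proof -
    have fp: "fst p \<in> {1, -1}" "\<bar>snd p * \<phi>1\<bar> = \<phi>1" using signs_D[OF p, of \<phi>1] ph' by auto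
    have "cauchy_int g \<phi>2 (fst p) (Z p u) = g (Z p u)"
      unfolding Z_def pt_eq by (rule cauchy_int_inside[OF th0 th(2) g ph(3) fp(1)]) (use fp ph in simp)
    moreover have "cauchy_int g \<phi>2 (- fst p) (Z p u) = 0"
    proof (rule cauchy_int_outside[OF th0 th(2) g _ ph(3) _ k])
      fix \<zeta> :: complex assume "\<bar>Im \<zeta>\<bar> \<le> \<phi>2"
      then show "k * norm (of_real (- fst p) * exp \<zeta>) \<le> norm (of_real (- fst p) * exp \<zeta> - Z p u)"
        unfolding Z_def pt_eq using fp by (intro sep) auto
    qed (use fp ph' in auto)
    ultimately have "(\<Sum>\<sigma>\<in>{1, -1}. cauchy_int g \<phi>2 \<sigma> (Z p u)) = g (Z p u)" using fp(1) by auto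
    then show ?thesis unfolding b_def W_def cauchy_int_signs .
  qed
  \<comment> \<open>\<open>W q v\<close> has the larger angle and is therefore outside both halves
    of the smaller contour.\<close>
  have outside: "(\<Sum>p\<in>signs. integral UNIV (\<lambda>u. a p u / (Z p u - W q v))) = 0" if q: "q \<in> signs" for q v
  proof -
    have fq: "fst q \<in> {1, -1}" "\<bar>snd q * \<phi>2\<bar> = \<phi>2" using signs_D[OF q, of \<phi>2] ph' by auto
    have "cauchy_int f \<phi>1 \<sigma> (W q v) = 0" if s: "\<sigma> \<in> {1, -1}" for \<sigma>
    proof (rule cauchy_int_outside[OF th0 th(2) f _ ph'(1) s k])
      fix \<zeta> :: complex assume "\<bar>Im \<zeta>\<bar> \<le> \<phi>1"
      then show "k * norm (of_real \<sigma> * exp \<zeta>) \<le> norm (of_real \<sigma> * exp \<zeta> - W q v)"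
        unfolding W_def pt_eq using fq s by (intro sep) auto
    qed (use ph' in auto)
    then show ?thesis unfolding a_def Z_def cauchy_int_signs by simp
  qed
  obtain C where C: "C \<ge> 0" "\<And>z c. z \<noteq> 0 \<Longrightarrow> z \<notin> bisector \<phi>2 \<Longrightarrow> norm (sc (c * z) (R z)) \<le> norm c * C"
    using norm_integrand_le[OF ph'(2,6)] by metis
  define D where "D = C / (k * (2 * pi)\<^sup>2)"
  have D: "D \<ge> 0" using C k by (simp add: D_def)
  have Psi_le: "norm (\<Psi> p q u v) \<le> D * norm (f (Z p u)) * norm (g (W q v))"
    if pq: "p \<in> signs" "q \<in> signs" for p q u v
  proof -
    \<comment> \<open>Each factor from \<open>dz = z du\<close> finds its partner: \<open>Z\<close>
      goes with the Cauchy kernel, giving a quotient bounded by \<open>1 / k\<close>, and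
      \<open>W\<close> with the resolvent. What remains is a function of \<open>u\<close> times a
      function of \<open>v\<close>, as the exchange of integrals requires.\<close>
    define x where "x = Z p u / (W q v - Z p u)"
    define c where "c = (- of_real (snd p) / (2 * pi * \<i>)) * f (Z p u) * x * (- of_real (snd q) / (2 * pi * \<i>)) * g (W q v)"
    have x: "norm x \<le> 1 / k"
      using sepZ[OF pq, of u v] nz(3)[OF pq, of v u] k
      by (simp add: x_def norm_divide norm_minus_commute divide_simps mult.commute)
    have "a p u * b q v / (W q v - Z p u) = c * W q v"
      by (simp add: a_def b_def coef_def c_def x_def W_def Z_def mult_ac)
    then have "norm (\<Psi> p q u v) \<le> norm c * C"
      unfolding \<Psi>_def W_def
      using C(2)[of "pt \<phi>2 q v" c] pt_not_bisector[OF pq(2) ph'(2) ph(3)] by (simp add: W_def)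
    also have "norm c = norm x * (norm (f (Z p u)) * norm (g (W q v)) / (2 * pi)\<^sup>2)"
      using signs_D(3)[OF pq(1), of 1] signs_D(3)[OF pq(2), of 1]
      by (simp add: c_def norm_mult norm_divide power2_eq_square)
    also have "\<dots> * C \<le> (1 / k) * (norm (f (Z p u)) * norm (g (W q v)) / (2 * pi)\<^sup>2) * C"
      using x C by (intro mult_right_mono) auto
    also have "\<dots> = D * norm (f (Z p u)) * norm (g (W q v))" by (simp add: D_def)
    finally show ?thesis .
  qed
  have cZ: "continuous_on S (Z p)" and cW: "continuous_on S (W q)" for S p q
    unfolding Z_def[abs_def] W_def[abs_def] by (rule continuous_pt)+
  have ca: "continuous_on S (a p)" if "p \<in> signs" for p S
    using coef_integrable(2)[OF that ph(1) ph'(1) f] continuous_on_subset unfolding a_def by blast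
  have cb: "continuous_on S (b q)" if "q \<in> signs" for q S
    using coef_integrable(2)[OF that ph'(2) ph(3) g] continuous_on_subset unfolding b_def by blast
  have cR: "continuous_on S (\<lambda>v. R (W q v))" if "q \<in> signs" for q S
    unfolding W_def by (rule continuous_R_pt[OF that ph'(2) ph(3)])
  have cPsi: "continuous_on S (\<lambda>(u, v). \<Psi> p q u v)" if "p \<in> signs" "q \<in> signs" for p q S
  proof -
    have "continuous_on S (\<lambda>x. a p (fst x))" "continuous_on S (\<lambda>x. b q (snd x))"
      "continuous_on S (\<lambda>x. Z p (fst x))" "continuous_on S (\<lambda>x. W q (snd x))" "continuous_on S (\<lambda>x. R (W q (snd x)))"
      by (rule continuous_on_compose2[OF ca[OF that(1)] continuous_on_fst[OF continuous_on_id] subset_UNIV]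
          continuous_on_compose2[OF cb[OF that(2)] continuous_on_snd[OF continuous_on_id] subset_UNIV]
          continuous_on_compose2[OF cZ continuous_on_fst[OF continuous_on_id] subset_UNIV]
          continuous_on_compose2[OF cW continuous_on_snd[OF continuous_on_id] subset_UNIV]
          continuous_on_compose2[OF cR[OF that(2)] continuous_on_snd[OF continuous_on_id] subset_UNIV])+
    then show ?thesis
      unfolding \<Psi>_def split_beta
      by (intro sc.continuous_on continuous_on_divide continuous_on_mult continuous_on_diff) (use nz[OF that] in auto)
  qed
  define G where "G = Op \<phi>2 g"
  have Gsum: "m x G = (\<Sum>q\<in>signs. integral UNIV (\<lambda>v. m x (sc (b q v) (R (W q v)))))" for x
  proof -
    have "m x G = (\<Sum>q\<in>signs. m x (integral UNIV (\<lambda>v. sc (b q v) (R (W q v)))))"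
      by (simp add: G_def Op_def b_def W_def m.sum_right)
    also have "\<dots> = (\<Sum>q\<in>signs. integral UNIV (\<lambda>v. m x (sc (b q v) (R (W q v)))))"
    proof (rule sum.cong[OF refl])
      fix q assume q: "q \<in> signs"
      have "(\<lambda>v. sc (b q v) (R (W q v))) integrable_on UNIV"
        using coef_integrable(1)[OF q ph'(2) ph(3) g] by (simp add: b_def W_def)
      from integral_linear[OF this m.bounded_linear_right[of x]]
      show "m x (integral UNIV (\<lambda>v. sc (b q v) (R (W q v)))) = integral UNIV (\<lambda>v. m x (sc (b q v) (R (W q v))))"
        by (simp add: o_def)
    qed
    finally show ?thesis .
  qed
  have split: "m (sc (a p u) (R (Z p u))) (sc (b q v) (R (W q v)))
      = sc (a p u * (b q v / (W q v - Z p u))) (R (Z p u)) - \<Psi> p q u v"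
    if pq: "p \<in> signs" "q \<in> signs" for p q u v
  proof -
    have "R (Z p u) - R (W q v) = sc (W q v - Z p u) (m (R (Z p u)) (R (W q v)))"
      using Om(2)[OF pq(1)] Om(1)[OF pq(2)] by (intro resolvent) (simp_all add: \<Omega>_def)
    then have "sc (a p u * b q v / (W q v - Z p u)) (R (Z p u) - R (W q v))
        = sc (a p u * b q v / (W q v - Z p u) * (W q v - Z p u)) (m (R (Z p u)) (R (W q v)))"
      by (simp only: sc_mult)
    also have "a p u * b q v / (W q v - Z p u) * (W q v - Z p u) = a p u * b q v"
      using nz(3)[OF pq, of v u] by simp
    also have "sc (a p u * b q v) (m (R (Z p u)) (R (W q v))) = m (sc (a p u) (R (Z p u))) (sc (b q v) (R (W q v)))"
      using Om(2)[OF pq(1)] Om(1)[OF pq(2)] by (intro m_sc[symmetric]) (simp_all add: \<Omega>_def)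
    finally show ?thesis by (simp add: sc.diff_right \<Psi>_def)
  qed
  have PsiI: "(\<lambda>v. \<Psi> p q u v) integrable_on UNIV" if pq: "p \<in> signs" "q \<in> signs" for p q u
  proof (rule integrable_on_UNIV_dominated)
    show "continuous_on UNIV (\<lambda>v. \<Psi> p q u v)"
      using continuous_on_compose2[OF cPsi[OF pq] continuous_on_Pair[OF continuous_on_const continuous_on_id] subset_UNIV]
      by simp
    show "norm (\<Psi> p q u v) \<le> D * norm (f (Z p u)) * norm (g (W q v))" for v by (rule Psi_le[OF pq])
    show "(\<lambda>v. D * norm (f (Z p u)) * norm (g (W q v))) integrable_on UNIV"
      using integrable_cmul[OF integrable_f_pt[OF pq(2) ph'(2) ph(3) g], of "D * norm (f (Z p u))"]
      by (simp add: W_def)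
  qed
  have PsiI': "(\<lambda>u. \<Psi> p q u v) integrable_on UNIV" if pq: "p \<in> signs" "q \<in> signs" for p q v
  proof (rule integrable_on_UNIV_dominated)
    show "continuous_on UNIV (\<lambda>u. \<Psi> p q u v)"
      using continuous_on_compose2[OF cPsi[OF pq] continuous_on_Pair[OF continuous_on_id continuous_on_const] subset_UNIV]
      by simp
    show "norm (\<Psi> p q u v) \<le> (D * norm (g (W q v))) * norm (f (Z p u))" for u
      using Psi_le[OF pq, of u v] by (simp add: mult_ac)
    show "(\<lambda>u. (D * norm (g (W q v))) * norm (f (Z p u))) integrable_on UNIV"
      using integrable_cmul[OF integrable_f_pt[OF pq(1) ph(1) ph'(1) f], of "D * norm (g (W q v))"]
      by (simp add: Z_def)
  qed
  \<comment> \<open>All sixteen pairs of rays are exchanged at once, because Cauchy's formula holds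
    only for the sum over a full contour.\<close>
  define \<Phi> where "\<Phi> u v = (\<Sum>p\<in>signs. \<Sum>q\<in>signs. \<Psi> p q u v)" for u v
  \<comment> \<open>\<open>split\<close> is solved for \<open>\<Psi>\<close> and integrated over
    \<open>v\<close>: Cauchy's formula turns the scalar part into the integrand for
    \<open>f * g\<close>.\<close>
  have row: "(\<Sum>q\<in>signs. integral UNIV (\<Psi> p q u))
      = sc (coef \<phi>1 (\<lambda>z. f z * g z) p u) (R (pt \<phi>1 p u)) - m (sc (a p u) (R (Z p u))) G"
    if p: "p \<in> signs" for p u
  proof -
    have "integral UNIV (\<lambda>v. m (sc (a p u) (R (Z p u))) (sc (b q v) (R (W q v))))
        = sc (a p u * integral UNIV (\<lambda>v. b q v / (W q v - Z p u))) (R (Z p u)) - integral UNIV (\<Psi> p q u)"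
      if q: "q \<in> signs" for q
    proof -
      have bi: "(\<lambda>v. b q v / (W q v - Z p u)) integrable_on UNIV"
        unfolding b_def W_def
        by (rule coef_quotient_integrable[OF q ph'(2) ph(3) g k]) (use sepW[OF p q] in \<open>simp add: W_def\<close>)
      have bl: "bounded_linear (\<lambda>x. sc (a p u * x) (R (Z p u)))"
        using bounded_linear_compose[OF sc.bounded_linear_left bounded_linear_mult_right] .
      show ?thesis
        using integrable_linear[OF bi bl] integral_linear[OF bi bl] PsiI[OF p q]
        unfolding split[OF p q] by (subst integral_diff) (auto simp: o_def)
    qed
    then have "m (sc (a p u) (R (Z p u))) G
        = sc (a p u * (\<Sum>q\<in>signs. integral UNIV (\<lambda>v. b q v / (W q v - Z p u)))) (R (Z p u))
          - (\<Sum>q\<in>signs. integral UNIV (\<Psi> p q u))"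
      unfolding Gsum by (simp add: sum_subtractf sc.sum_left sum_distrib_left)
    then show ?thesis
      unfolding inside[OF p] by (simp add: a_def coef_def Z_def mult_ac)
  qed
  have aI: "(\<lambda>u. m (sc (a p u) (R (Z p u))) G) integrable_on UNIV"
    and aE: "integral UNIV (\<lambda>u. m (sc (a p u) (R (Z p u))) G) = m (integral UNIV (\<lambda>u. sc (a p u) (R (Z p u)))) G"
    if p: "p \<in> signs" for p
    using integrable_linear[OF coef_integrable(1)[OF p ph(1) ph'(1) f] m.bounded_linear_left[of G]]
      integral_linear[OF coef_integrable(1)[OF p ph(1) ph'(1) f] m.bounded_linear_left[of G]]
    by (simp_all add: o_def a_def Z_def)
  have inner: "integral UNIV (\<Phi> u) = (\<Sum>p\<in>signs. sc (coef \<phi>1 (\<lambda>z. f z * g z) p u) (R (pt \<phi>1 p u)) - m (sc (a p u) (R (Z p u))) G)" for u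
  proof -
    have "integral UNIV (\<Phi> u) = (\<Sum>p\<in>signs. \<Sum>q\<in>signs. integral UNIV (\<Psi> p q u))"
      unfolding \<Phi>_def[abs_def] by (simp add: integral_sum integrable_sum PsiI)
    then show ?thesis using row by simp
  qed
  have inner': "integral UNIV (\<lambda>u. \<Phi> u v) = 0" for v
  proof -
    have "integral UNIV (\<lambda>u. \<Psi> p q u v) = sc (- (integral UNIV (\<lambda>u. a p u / (Z p u - W q v)) * b q v)) (R (W q v))"
      if pq: "p \<in> signs" "q \<in> signs" for p q
    proof -
      have ai: "(\<lambda>u. a p u / (Z p u - W q v)) integrable_on UNIV"
        unfolding a_def Z_def
        by (rule coef_quotient_integrable[OF pq(1) ph(1) ph'(1) f k]) (use sepZ[OF pq] in \<open>simp add: Z_def\<close>)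
      have bl: "bounded_linear (\<lambda>x. sc (- (x * b q v)) (R (W q v)))"
        using bounded_linear_compose[OF sc.bounded_linear_left bounded_linear_minus[OF bounded_linear_mult_left]] .
      have "\<Psi> p q u v = sc (- (a p u / (Z p u - W q v) * b q v)) (R (W q v))" for u
        using nz(3)[OF pq, of v u] by (simp add: \<Psi>_def minus_divide_right)
      then show ?thesis using integral_linear[OF ai bl] by (simp add: o_def)
    qed
    then have "(\<Sum>p\<in>signs. integral UNIV (\<lambda>u. \<Psi> p q u v))
        = sc (- ((\<Sum>p\<in>signs. integral UNIV (\<lambda>u. a p u / (Z p u - W q v))) * b q v)) (R (W q v))"
      if q: "q \<in> signs" for q
      using q by (simp add: sc.sum_left sc.minus_left sum_negf sum_distrib_right)
    then have "(\<Sum>q\<in>signs. \<Sum>p\<in>signs. integral UNIV (\<lambda>u. \<Psi> p q u v)) = 0"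
      using outside by (simp add: sc.zero_left)
    then have "(\<Sum>p\<in>signs. \<Sum>q\<in>signs. integral UNIV (\<lambda>u. \<Psi> p q u v)) = 0" by (subst sum.swap)
    then show ?thesis
      unfolding \<Phi>_def by (simp add: integral_sum integrable_sum PsiI')
  qed
  have "integral UNIV (\<lambda>u. integral UNIV (\<Phi> u)) = integral UNIV (\<lambda>v. integral UNIV (\<lambda>u. \<Phi> u v))"
  proof (rule integral_swap_UNIV)
    show "continuous_on UNIV (\<lambda>(u, v). \<Phi> u v)"
      using cPsi unfolding \<Phi>_def split_beta by (intro continuous_on_sum) auto
    show "norm (\<Phi> u v) \<le> (D * (\<Sum>p\<in>signs. norm (f (Z p u)))) * (\<Sum>q\<in>signs. norm (g (W q v)))" for u v
    proof -
      have "norm (\<Phi> u v) \<le> (\<Sum>p\<in>signs. \<Sum>q\<in>signs. D * norm (f (Z p u)) * norm (g (W q v)))"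
        unfolding \<Phi>_def by (intro sum_norm_le Psi_le)
      also have "\<dots> = (D * (\<Sum>p\<in>signs. norm (f (Z p u)))) * (\<Sum>q\<in>signs. norm (g (W q v)))"
        by (simp only: sum_distrib_left[of D] sum_product)
      finally show ?thesis .
    qed
    have "(\<lambda>u. \<Sum>p\<in>signs. norm (f (Z p u))) integrable_on UNIV"
      using integrable_f_pt[OF _ ph(1) ph'(1) f] by (intro integrable_sum) (auto simp: Z_def)
    from integrable_cmul[OF this, of D]
    show "(\<lambda>u. D * (\<Sum>p\<in>signs. norm (f (Z p u)))) integrable_on UNIV" by simp
    show "(\<lambda>v. \<Sum>q\<in>signs. norm (g (W q v))) integrable_on UNIV"
      using integrable_f_pt[OF _ ph'(2) ph(3) g] by (intro integrable_sum) (auto simp: W_def)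
    show "(\<lambda>u. integral UNIV (\<Phi> u)) integrable_on UNIV"
      unfolding inner by (intro integrable_sum integrable_diff aI coef_integrable(1) fg ph ph') auto
    show "(\<lambda>v. integral UNIV (\<lambda>u. \<Phi> u v)) integrable_on UNIV" unfolding inner' by (rule integrable_0)
  qed (use D in \<open>auto intro!: sum_nonneg mult_nonneg_nonneg\<close>)
  then have "integral UNIV (\<lambda>u. integral UNIV (\<Phi> u)) = 0" by (simp add: inner')
  moreover have "integral UNIV (\<lambda>u. integral UNIV (\<Phi> u)) = Op \<phi>1 (\<lambda>z. f z * g z) - m (Op \<phi>1 f) G"
  proof -
    have "integral UNIV (\<lambda>u. integral UNIV (\<Phi> u)) = (\<Sum>p\<in>signs.
        integral UNIV (\<lambda>u. sc (coef \<phi>1 (\<lambda>z. f z * g z) p u) (R (pt \<phi>1 p u)))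
        - integral UNIV (\<lambda>u. m (sc (a p u) (R (Z p u))) G))"
      unfolding inner
      by (subst integral_sum)
         (auto intro!: sum.cong integral_diff integrable_diff aI coef_integrable(1) fg ph ph')
    also have "\<dots> = Op \<phi>1 (\<lambda>z. f z * g z) - m (Op \<phi>1 f) G"
      using aE by (simp add: sum_subtractf Op_def m.sum_left flip: a_def Z_def)
    finally show ?thesis .
  qed
  ultimately show ?thesis by (simp add: G_def)
qed

lemma Op_mult:
  assumes ph: "\<omega> < \<phi>" "\<phi> < \<theta>" and f: "bisector_fun \<theta> f" and g: "bisector_fun \<theta> g"
  shows "Op \<phi> (\<lambda>z. f z * g z) = m (Op \<phi> f) (Op \<phi> g)"
proof -
  \<comment> \<open>The second factor is moved to a larger angle, where \<open>Op_mult_less\<close>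
    applies.\<close>
  obtain \<psi> where psi: "\<phi> < \<psi>" "\<psi> < \<theta>" using dense[OF ph(2)] by blast
  have "Op \<psi> g = Op \<phi> g" by (rule Op_angle_independent) (use ph psi g in auto)
  with Op_mult_less[OF ph(1) psi f g] show ?thesis by simp
qed

end

end

section \<open>The Clifford algebra\<close>

lemma sym_diff_cancel: "sym_diff A (sym_diff A B) = B" by blast

lemma axis_sym_diff_nth:
  "axis (sym_diff A B) x $ C = (if B = sym_diff A C then x else 0)"
  "axis (sym_diff A B) x $ C = (if A = sym_diff B C then x else 0)"
proof -
  have "sym_diff A B = C \<longleftrightarrow> B = sym_diff A C" "sym_diff A B = C \<longleftrightarrow> A = sym_diff B C" by blast+
  then show "axis (sym_diff A B) x $ C = (if B = sym_diff A C then x else 0)"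
    and "axis (sym_diff A B) x $ C = (if A = sym_diff B C then x else 0)"
    by (simp_all only: axis_def vec_lambda_beta eq_commute[of C])
qed

text \<open>For given \<open>A\<close> only \<open>B = sym_diff A C\<close> contributes to the
  coordinate \<open>C\<close>.\<close>

lemma lmul_nth: "lmul a v $ C = (\<Sum>A\<in>UNIV. (cl_sign A (sym_diff A C) * a $ A) *\<^sub>R v $ sym_diff A C)"
proof -
  have "(\<Sum>B\<in>UNIV. axis (sym_diff A B) ((cl_sign A B * a $ A) *\<^sub>R v $ B)) $ C
      = (cl_sign A (sym_diff A C) * a $ A) *\<^sub>R v $ sym_diff A C" for A
  proof -
    have "(\<Sum>B\<in>UNIV. axis (sym_diff A B) ((cl_sign A B * a $ A) *\<^sub>R v $ B)) $ C
        = (\<Sum>B\<in>UNIV. if B = sym_diff A C then (cl_sign A B * a $ A) *\<^sub>R v $ B else 0)"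
      unfolding sum_component by (intro sum.cong refl) (rule axis_sym_diff_nth)
    then show ?thesis by (simp only: sum.delta finite UNIV_I if_True)
  qed
  then show ?thesis by (simp add: lmul_def)
qed

lemma rmul_nth: "rmul v a $ C = (\<Sum>B\<in>UNIV. (cl_sign (sym_diff B C) B * a $ B) *\<^sub>R v $ sym_diff B C)"
proof -
  have "rmul v a $ C = (\<Sum>B\<in>UNIV. (\<Sum>A\<in>UNIV. axis (sym_diff A B) ((cl_sign A B * a $ B) *\<^sub>R v $ A)) $ C)"
    unfolding rmul_def by (subst sum.swap) simp
  moreover have "(\<Sum>A\<in>UNIV. axis (sym_diff A B) ((cl_sign A B * a $ B) *\<^sub>R v $ A)) $ C
      = (cl_sign (sym_diff B C) B * a $ B) *\<^sub>R v $ sym_diff B C" for B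
  proof -
    have "(\<Sum>A\<in>UNIV. axis (sym_diff A B) ((cl_sign A B * a $ B) *\<^sub>R v $ A)) $ C
        = (\<Sum>A\<in>UNIV. if A = sym_diff B C then (cl_sign A B * a $ B) *\<^sub>R v $ A else 0)"
      unfolding sum_component by (intro sum.cong refl) (rule axis_sym_diff_nth)
    then show ?thesis by (simp only: sum.delta finite UNIV_I if_True)
  qed
  ultimately show ?thesis by simp
qed

lemma abs_cl_sign [simp]: "\<bar>cl_sign A B\<bar> = 1"
  by (simp add: cl_sign_def power_abs)

lemma norm_vec_le_sum: "norm (x :: ('a::real_normed_vector, 'i::finite) vec) \<le> (\<Sum>i\<in>UNIV. norm (x $ i))"
  unfolding norm_vec_def by (rule L2_set_le_sum) auto

lemma bounded_bilinear_lmul: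
  "bounded_bilinear (lmul :: 'n::{finite,linorder} clifford \<Rightarrow> ('v::real_normed_vector, 'n) clifford_module \<Rightarrow> _)"
proof
  fix a b :: "'n clifford" and v w :: "('v, 'n) clifford_module" and r :: real
  show "lmul (a + b) v = lmul a v + lmul b v"
    by (simp add: vec_eq_iff lmul_nth algebra_simps sum.distrib)
  show "lmul a (v + w) = lmul a v + lmul a w"
    by (simp add: vec_eq_iff lmul_nth algebra_simps sum.distrib)
  show "lmul (r *\<^sub>R a) v = r *\<^sub>R lmul a v"
    by (simp add: vec_eq_iff lmul_nth scaleR_sum_right mult_ac)
  show "lmul a (r *\<^sub>R v) = r *\<^sub>R lmul a v"
    by (simp add: vec_eq_iff lmul_nth scaleR_sum_right mult_ac)
  show "\<exists>K. \<forall>a (v :: ('v, 'n) clifford_module). norm (lmul a v) \<le> norm a * norm v * K"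
  proof (intro exI allI)
    fix a :: "'n clifford" and v :: "('v, 'n) clifford_module"
    have "norm (lmul a v $ C) \<le> (\<Sum>A::'n set\<in>UNIV. norm a * norm v)" for C
      unfolding lmul_nth
      by (intro order_trans[OF norm_sum] sum_mono)
         (auto simp: abs_mult intro!: mult_mono Finite_Cartesian_Product.norm_nth_le
           Finite_Cartesian_Product.norm_nth_le[of a, unfolded real_norm_def])
    then have "norm (lmul a v) \<le> (\<Sum>C::'n set\<in>UNIV. \<Sum>A::'n set\<in>UNIV. norm a * norm v)"
      by (intro order_trans[OF norm_vec_le_sum] sum_mono)
    then show "norm (lmul a v) \<le> norm a * norm v * (real CARD('n set) * real CARD('n set))"
      by (simp add: mult_ac)
  qed
qed

lemma bounded_bilinear_rmul:
  "bounded_bilinear (rmul :: ('v::real_normed_vector, 'n::{finite,linorder}) clifford_module \<Rightarrow> _)"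
proof
  fix a b :: "'n clifford" and v w :: "('v, 'n) clifford_module" and r :: real
  show "rmul v (a + b) = rmul v a + rmul v b"
    by (simp add: vec_eq_iff rmul_nth algebra_simps sum.distrib)
  show "rmul (v + w) a = rmul v a + rmul w a"
    by (simp add: vec_eq_iff rmul_nth algebra_simps sum.distrib)
  show "rmul v (r *\<^sub>R a) = r *\<^sub>R rmul v a"
    by (simp add: vec_eq_iff rmul_nth scaleR_sum_right mult_ac)
  show "rmul (r *\<^sub>R v) a = r *\<^sub>R rmul v a"
    by (simp add: vec_eq_iff rmul_nth scaleR_sum_right mult_ac)
  show "\<exists>K. \<forall>(v :: ('v, 'n) clifford_module) a. norm (rmul v a) \<le> norm v * norm a * K"
  proof (intro exI allI)
    fix a :: "'n clifford" and v :: "('v, 'n) clifford_module"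
    have "norm (rmul v a $ C) \<le> (\<Sum>A::'n set\<in>UNIV. norm a * norm v)" for C
      unfolding rmul_nth
      by (intro order_trans[OF norm_sum] sum_mono)
         (auto simp: abs_mult intro!: mult_mono Finite_Cartesian_Product.norm_nth_le
           Finite_Cartesian_Product.norm_nth_le[of a, unfolded real_norm_def])
    then have "norm (rmul v a) \<le> (\<Sum>C::'n set\<in>UNIV. \<Sum>A::'n set\<in>UNIV. norm a * norm v)"
      by (intro order_trans[OF norm_vec_le_sum] sum_mono)
    then show "norm (rmul v a) \<le> norm v * norm a * (real CARD('n set) * real CARD('n set))"
      by (simp add: mult_ac)
  qed
qed

interpretation lmul: bounded_bilinear lmul by (rule bounded_bilinear_lmul)
interpretation rmul: bounded_bilinear rmul by (rule bounded_bilinear_rmul)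

lemma cl_sign_empty [simp]: "cl_sign {} B = 1" "cl_sign A {} = 1"
  by (simp_all add: cl_sign_def)

lemma lmul_axis_nth: "lmul (axis A 1) v $ C = cl_sign A (sym_diff A C) *\<^sub>R v $ sym_diff A C"
proof -
  have "lmul (axis A 1) v $ C
      = (\<Sum>B\<in>UNIV. if B = A then cl_sign B (sym_diff B C) *\<^sub>R v $ sym_diff B C else 0)"
    unfolding lmul_nth by (intro sum.cong) (auto simp: axis_def)
  then show ?thesis by (simp only: sum.delta finite UNIV_I if_True)
qed

lemma rmul_axis_nth: "rmul v (axis A 1) $ C = cl_sign (sym_diff A C) A *\<^sub>R v $ sym_diff A C"
proof -
  have "rmul v (axis A 1) $ C
      = (\<Sum>B\<in>UNIV. if B = A then cl_sign (sym_diff B C) B *\<^sub>R v $ sym_diff B C else 0)"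
    unfolding rmul_nth by (intro sum.cong) (auto simp: axis_def)
  then show ?thesis by (simp only: sum.delta finite UNIV_I if_True)
qed

lemma lmul_one [simp]: "lmul cl_one v = v"
  by (simp add: vec_eq_iff cl_one_def lmul_axis_nth)

lemma rmul_one [simp]: "rmul v cl_one = v"
  by (simp add: vec_eq_iff cl_one_def rmul_axis_nth)

lemma lmul_one_right [simp]: "lmul a cl_one = a"
proof -
  have "lmul a cl_one $ C = (\<Sum>A\<in>UNIV. if A = C then a $ A else 0)" for C
    unfolding lmul_nth cl_one_def by (intro sum.cong) (auto simp: axis_def)
  then show ?thesis by (simp add: vec_eq_iff)
qed

section \<open>Generator relations and squares of imaginary units\<close>

lemma minus_one_power_card_toggle:
  "finite X \<Longrightarrow> (- 1 :: real) ^ card (sym_diff X {x}) = - ((- 1) ^ card X)"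
proof (cases "x \<in> X")
  case True
  assume "finite X"
  then have "card X = Suc (card (X - {x}))" using True by (rule card.remove)
  moreover have "sym_diff X {x} = X - {x}" using True by blast
  ultimately show ?thesis by simp
next
  case False
  assume "finite X"
  moreover have "sym_diff X {x} = insert x X" using False by blast
  ultimately show ?thesis using False by simp
qed

lemma cl_sign_singleton:
  "cl_sign {i} B = (- 1) ^ card (B \<inter> {..i})" "cl_sign B {i} = (- 1) ^ card (B \<inter> {i..})"
proof -
  have "{(k, j). k \<in> {i} \<and> j \<in> B \<and> k \<ge> j} = Pair i ` (B \<inter> {..i})" by auto
  then show "cl_sign {i} B = (- 1) ^ card (B \<inter> {..i})"
    by (simp add: cl_sign_def card_image inj_on_def)
  have "{(k, j). k \<in> B \<and> j \<in> {i} \<and> k \<ge> j} = (\<lambda>k. (k, i)) ` (B \<inter> {i..})" by auto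
  then show "cl_sign B {i} = (- 1) ^ card (B \<inter> {i..})"
    by (simp add: cl_sign_def card_image inj_on_def)
qed

text \<open>Toggling \<open>k\<close> changes the counted set exactly if \<open>k\<close> lies on
  the counted side of \<open>i\<close>. These rules yield all relations between generators; the
  calculus multiplies within one slice at a time, so they suffice in place of associativity of the
  whole product.\<close>

lemma cl_sign_toggle:
  fixes B :: "'n::{finite,linorder} set"
  shows "cl_sign {i} (sym_diff {k} B) = (if k \<le> i then - 1 else 1) * cl_sign {i} B"
    and "cl_sign (sym_diff {k} B) {i} = (if i \<le> k then - 1 else 1) * cl_sign B {i}"
proof -
  have "sym_diff {k} B \<inter> X = (if k \<in> X then sym_diff (B \<inter> X) {k} else B \<inter> X)" for X by auto
  then show "cl_sign {i} (sym_diff {k} B) = (if k \<le> i then - 1 else 1) * cl_sign {i} B"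
    and "cl_sign (sym_diff {k} B) {i} = (if i \<le> k then - 1 else 1) * cl_sign B {i}"
    unfolding cl_sign_singleton by (simp_all add: minus_one_power_card_toggle)
qed

lemma cl_sign_square: "cl_sign A B * cl_sign A B = 1"
  by (simp add: cl_sign_def flip: power_mult_distrib)

text \<open>Both orders reach a coordinate by the same two toggles, and for \<open>i < k\<close>
  exactly one of them picks up an additional sign from \<open>cl_sign_toggle\<close>.\<close>

lemma lmul_generators:
  fixes v :: "('v::real_normed_vector, 'n::{finite,linorder}) clifford_module"
  shows "lmul (axis {i} 1) (lmul (axis {i} 1) v) = - v"
    and "i \<noteq> k \<Longrightarrow> lmul (axis {i} 1) (lmul (axis {k} 1) v) = - lmul (axis {k} 1) (lmul (axis {i} 1) v)"
proof -
  show "lmul (axis {i} 1) (lmul (axis {i} 1) v) = - v"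
    by (simp add: vec_eq_iff lmul_axis_nth sym_diff_cancel cl_sign_toggle cl_sign_square)
  have *: "lmul (axis {i} 1) (lmul (axis {k} 1) v) = - lmul (axis {k} 1) (lmul (axis {i} 1) v)"
    if "i < k" for i k
  proof -
    have ik: "i \<le> k" "\<not> k \<le> i" using that by auto
    have "sym_diff {k} (sym_diff {i} C) = sym_diff {i} (sym_diff {k} C)" for C by blast
    then show ?thesis
      by (simp add: vec_eq_iff lmul_axis_nth cl_sign_toggle ik mult_ac)
  qed
  show "lmul (axis {i} 1) (lmul (axis {k} 1) v) = - lmul (axis {k} 1) (lmul (axis {i} 1) v)" if "i \<noteq> k"
    using *[of i k] *[of k i] that by (cases "i < k") auto
qed

lemma rmul_generators:
  fixes v :: "('v::real_normed_vector, 'n::{finite,linorder}) clifford_module"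
  shows "rmul (rmul v (axis {i} 1)) (axis {i} 1) = - v"
    and "i \<noteq> k \<Longrightarrow> rmul (rmul v (axis {k} 1)) (axis {i} 1) = - rmul (rmul v (axis {i} 1)) (axis {k} 1)"
proof -
  show "rmul (rmul v (axis {i} 1)) (axis {i} 1) = - v"
    by (simp add: vec_eq_iff rmul_axis_nth sym_diff_cancel cl_sign_toggle cl_sign_square)
  have *: "rmul (rmul v (axis {k} 1)) (axis {i} 1) = - rmul (rmul v (axis {i} 1)) (axis {k} 1)"
    if "i < k" for i k
  proof -
    have ik: "i \<le> k" "\<not> k \<le> i" using that by auto
    have "sym_diff {k} (sym_diff {i} C) = sym_diff {i} (sym_diff {k} C)" for C by blast
    then show ?thesis
      by (simp add: vec_eq_iff rmul_axis_nth cl_sign_toggle ik mult_ac)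
  qed
  show "rmul (rmul v (axis {k} 1)) (axis {i} 1) = - rmul (rmul v (axis {i} 1)) (axis {k} 1)" if "i \<noteq> k"
    using *[of i k] *[of k i] that by (cases "i < k") auto
qed

text \<open>Adding the double sum to its transpose cancels the terms off the diagonal. Formulated
  for a family of linear maps, so that it serves left and right multiplication alike.\<close>

lemma anticommuting_square:
  fixes E :: "'i::finite \<Rightarrow> 'a::real_vector \<Rightarrow> 'a" and c :: "'i \<Rightarrow> real"
  assumes lin: "\<And>i. linear (E i)"
    and sq: "\<And>i v. E i (E i v) = - v" and anti: "\<And>i k v. i \<noteq> k \<Longrightarrow> E i (E k v) = - E k (E i v)"
  shows "(\<Sum>i\<in>UNIV. c i *\<^sub>R E i (\<Sum>k\<in>UNIV. c k *\<^sub>R E k v)) = - (\<Sum>i\<in>UNIV. (c i)\<^sup>2) *\<^sub>R v"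
proof -
  define S where "S = (\<Sum>i\<in>UNIV. \<Sum>k\<in>UNIV. (c i * c k) *\<^sub>R E i (E k v))"
  have "S = (\<Sum>i\<in>UNIV. \<Sum>k\<in>UNIV. (c k * c i) *\<^sub>R E k (E i v))"
    unfolding S_def by (rule sum.swap)
  then have "S + S = (\<Sum>i\<in>UNIV. \<Sum>k\<in>UNIV. (c i * c k) *\<^sub>R (E i (E k v) + E k (E i v)))"
    unfolding S_def by (simp add: sum.distrib scaleR_add_right mult.commute)
  also have "\<dots> = (\<Sum>i\<in>UNIV. \<Sum>k\<in>UNIV. if i = k then (- 2 * (c i)\<^sup>2) *\<^sub>R v else 0)"
  proof (intro sum.cong refl)
    fix i k
    show "(c i * c k) *\<^sub>R (E i (E k v) + E k (E i v)) = (if i = k then (- 2 * (c i)\<^sup>2) *\<^sub>R v else 0)"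
    proof (cases "i = k")
      case True
      have "E k (E k v) + E k (E k v) = (- 2) *\<^sub>R v" by (simp only: sq scaleR_minus_left scaleR_2) simp
      then show ?thesis using True by (simp add: power2_eq_square mult.commute)
    next
      case False
      then show ?thesis using anti[OF False, of v] by simp
    qed
  qed
  also have "\<dots> = 2 *\<^sub>R (- (\<Sum>i\<in>UNIV. (c i)\<^sup>2) *\<^sub>R v)"
    by (simp add: scaleR_sum_left scaleR_sum_right sum_negf flip: scaleR_scaleR)
  finally have "2 *\<^sub>R S = 2 *\<^sub>R (- (\<Sum>i\<in>UNIV. (c i)\<^sup>2) *\<^sub>R v)" by (simp add: scaleR_2)
  then have "S = - (\<Sum>i\<in>UNIV. (c i)\<^sup>2) *\<^sub>R v"
    by (subst (asm) scaleR_cancel_left) simp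
  moreover have "(\<Sum>i\<in>UNIV. c i *\<^sub>R E i (\<Sum>k\<in>UNIV. c k *\<^sub>R E k v)) = S"
    by (simp add: S_def linear_sum[OF lin] linear_cmul[OF lin] scaleR_sum_right)
  ultimately show ?thesis by simp
qed

lemma unit_sphereD:
  assumes "J \<in> unit_sphere"
  shows "J $ {} = 0" "norm J = 1" "J = (\<Sum>i\<in>UNIV. J $ {i} *\<^sub>R axis {i} 1)"
    "(\<Sum>i\<in>UNIV. (J $ {i})\<^sup>2) = 1"
proof -
  show 0: "J $ {} = 0" and n: "norm J = 1" using assms by (auto simp: unit_sphere_def)
  have z: "J $ A = 0" if "A \<notin> range (\<lambda>i. {i})" for A
  proof -
    have "card A \<noteq> 1" using that by (auto simp: card_1_singleton_iff)
    moreover have "card A \<le> 1" if "J $ A \<noteq> 0"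
      using assms that by (simp add: unit_sphere_def paravectors_def)
    ultimately have "card A = 0" if "J $ A \<noteq> 0" using that by linarith
    then show ?thesis using 0 by (metis card_0_eq finite)
  qed
  show "J = (\<Sum>i\<in>UNIV. J $ {i} *\<^sub>R axis {i} 1)"
  proof (rule vec_eq_iff[THEN iffD2], rule allI)
    fix A
    show "J $ A = (\<Sum>i\<in>UNIV. J $ {i} *\<^sub>R axis {i} 1) $ A"
    proof (cases "A \<in> range (\<lambda>i. {i})")
      case True
      then obtain j where A: "A = {j}" by blast
      have "(\<Sum>i\<in>UNIV. J $ {i} *\<^sub>R axis {i} 1) $ A = (\<Sum>i\<in>UNIV. if i = j then J $ {i} else 0)"
        unfolding sum_component by (intro sum.cong) (auto simp: axis_def A)
      then show ?thesis by (simp add: A)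
    next
      case False
      then have "axis {i} (1::real) $ A = 0" for i by (auto simp: axis_def)
      then show ?thesis using z[OF False] by simp
    qed
  qed
  have "1 = (\<Sum>A\<in>UNIV. (J $ A)\<^sup>2)"
    using n by (simp add: norm_vec_def L2_set_def)
  also have "\<dots> = (\<Sum>A\<in>range (\<lambda>i. {i}). (J $ A)\<^sup>2)"
    by (rule sum.mono_neutral_right) (use z in auto)
  also have "\<dots> = (\<Sum>i\<in>UNIV. (J $ {i})\<^sup>2)" by (subst sum.reindex) (auto simp: inj_on_def)
  finally show "(\<Sum>i\<in>UNIV. (J $ {i})\<^sup>2) = 1" by simp
qed

lemma lmul_unit_sphere_square:
  fixes v :: "('v::real_normed_vector, 'n::{finite,linorder}) clifford_module"
  assumes "J \<in> unit_sphere"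
  shows "lmul J (lmul J v) = - v"
proof -
  have J: "lmul J w = (\<Sum>i\<in>UNIV. J $ {i} *\<^sub>R lmul (axis {i} 1) w)" for w :: "('v, 'n) clifford_module"
    by (subst unit_sphereD(3)[OF assms]) (simp add: lmul.sum_left lmul.scaleR_left)
  show ?thesis
    unfolding J
    by (subst anticommuting_square)
       (use lmul_generators unit_sphereD(4)[OF assms] bounded_linear.linear[OF lmul.bounded_linear_right] in auto)
qed

lemma rmul_unit_sphere_square:
  fixes v :: "('v::real_normed_vector, 'n::{finite,linorder}) clifford_module"
  assumes "J \<in> unit_sphere"
  shows "rmul (rmul v J) J = - v"
proof -
  have J: "rmul w J = (\<Sum>i\<in>UNIV. J $ {i} *\<^sub>R rmul w (axis {i} 1))" for w :: "('v, 'n) clifford_module"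
    by (subst unit_sphereD(3)[OF assms]) (simp add: rmul.sum_right rmul.scaleR_right)
  show ?thesis
    unfolding J
    by (subst anticommuting_square[where E = "\<lambda>i w. rmul w (axis {i} 1)"])
       (use rmul_generators unit_sphereD(4)[OF assms] bounded_linear.linear[OF rmul.bounded_linear_left] in auto)
qed

lemma unit_sphere_nonempty: "axis {i} 1 \<in> unit_sphere"
  by (auto simp: unit_sphere_def paravectors_def) (auto simp: axis_def split: if_splits)

section \<open>Slices as copies of the complex plane\<close>

definition embed :: "'n::{finite,linorder} clifford \<Rightarrow> complex \<Rightarrow> 'n clifford" where
  "embed J z = slice_point J (Re z) (Im z)"

lemma embed_eq: "embed J z = Re z *\<^sub>R cl_one + Im z *\<^sub>R J"
  by (simp add: embed_def slice_point_def)

lemma embed_linear: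
  "embed J (z + w) = embed J z + embed J w" "embed J (z - w) = embed J z - embed J w"
  "embed J (- z) = - embed J z" "embed J (of_real r) = r *\<^sub>R cl_one"
  "embed J (r *\<^sub>R z) = r *\<^sub>R embed J z" "embed J 0 = 0" "embed J 1 = cl_one" "embed J \<i> = J"
  by (simp_all add: embed_eq algebra_simps)

lemma lmul_embed: "lmul (embed J z) v = Re z *\<^sub>R v + Im z *\<^sub>R lmul J v"
  by (simp add: embed_eq lmul.add_left lmul.scaleR_left)

lemma rmul_embed: "rmul v (embed J z) = Re z *\<^sub>R v + Im z *\<^sub>R rmul v J"
  by (simp add: embed_eq rmul.add_right rmul.scaleR_right)

context
  fixes J :: "'n::{finite,linorder} clifford"
  assumes J: "J \<in> unit_sphere"
begin

lemma lmul_embed_mult: "lmul (embed J z) (lmul (embed J w) v) = lmul (embed J (z * w)) v"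
  by (simp add: lmul_embed lmul.add_right lmul.scaleR_right lmul_unit_sphere_square[OF J] algebra_simps)

lemma rmul_embed_mult: "rmul (rmul v (embed J w)) (embed J z) = rmul v (embed J (z * w))"
  by (simp add: rmul_embed rmul.add_left rmul.scaleR_left rmul_unit_sphere_square[OF J] algebra_simps)

lemma embed_mult: "lmul (embed J z) (embed J w) = embed J (z * w)"
  using lmul_embed_mult[of z w cl_one] by simp

lemma cl_power_embed: "cl_power (embed J z) k = embed J (z ^ k)"
  by (induction k) (simp_all add: embed_mult embed_linear)

lemma embed_nth_empty: "embed J z $ {} = Re z"
  using unit_sphereD(1)[OF J] by (simp add: embed_eq cl_one_def axis_def)

lemma norm_embed: "norm (embed J z) = norm z"
proof -
  have "inner cl_one J = J $ {}" by (simp add: cl_one_def inner_axis' )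
  moreover have "inner (cl_one :: 'n clifford) cl_one = 1" by (simp add: cl_one_def inner_axis_axis)
  moreover have "inner J J = 1" using unit_sphereD(2)[OF J] by (simp add: norm_eq_sqrt_inner)
  ultimately have "inner (embed J z) (embed J z) = (Re z)\<^sup>2 + (Im z)\<^sup>2"
    using unit_sphereD(1)[OF J]
    by (simp add: embed_eq inner_add_left inner_add_right inner_commute power2_eq_square)
  then show ?thesis by (simp add: norm_eq_sqrt_inner[of "embed J z"] cmod_def)
qed

lemma cl_cnj_embed: "cl_cnj (embed J z) = embed J (cnj z)"
  using unit_sphereD(1)[OF J] by (auto simp: vec_eq_iff cl_cnj_def embed_eq cl_one_def axis_def)

lemma embed_paravector: "embed J z \<in> paravectors"
  using J by (auto simp: paravectors_def unit_sphere_def embed_eq cl_one_def axis_def split: if_splits)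

lemma slice_cis_embed: "slice_cis J \<phi> = embed J (cis \<phi>)"
  by (simp add: slice_cis_def embed_def)

end

section \<open>Intrinsic functions as complex functions\<close>

lemma bisector_polar:
  assumes z: "z \<in> bisector \<theta>" and th: "0 < \<theta>" "\<theta> < pi / 2"
  obtains \<sigma> \<zeta> where "\<sigma> \<in> {1, -1}" "z = of_real \<sigma> * exp \<zeta>" "\<bar>Im \<zeta>\<bar> < \<theta>"
proof -
  have pos: "\<exists>\<zeta>. w = exp \<zeta> \<and> \<bar>Im \<zeta>\<bar> < \<theta>" if w: "w \<in> bisector \<theta>" "Re w > 0" for w
  proof (intro exI conjI)
    have w0: "w \<noteq> 0" using w(2) by auto
    then show e: "w = exp (Ln w)" by simp
    have "\<bar>Im (Ln w)\<bar> < pi / 2" using Re_Ln_pos_lt[OF w0] w(2) by simp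
    then show "\<bar>Im (Ln w)\<bar> < \<theta>"
      using exp_in_bisector_iff[of 1 "Ln w" \<theta>] w(1) w0 th by simp
  qed
  have "Re z \<noteq> 0"
  proof
    assume "Re z = 0"
    moreover have "0 \<le> \<bar>Im z\<bar> * cos \<theta>" using th cos_gt_zero[of \<theta>] by simp
    ultimately show False using z by (simp add: bisector_def)
  qed
  then consider "Re z > 0" | "Re (- z) > 0" by force
  then show ?thesis
  proof cases
    case 1
    then show ?thesis using pos[OF z] that[of 1] by auto
  next
    case 2
    have "- z \<in> bisector \<theta>" using z by (simp add: bisector_def)
    then obtain \<zeta> where "- z = exp \<zeta>" "\<bar>Im \<zeta>\<bar> < \<theta>" using pos 2 by blast
    then show ?thesis using that[of "-1" \<zeta>] by (metis insert_iff minus_equation_iff mult_minus1 of_real_1 of_real_minus)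
  qed
qed

lemma sector_angles_cis:
  assumes "\<phi> \<in> sector_angles \<theta>"
  obtains \<sigma> \<alpha> where "\<sigma> \<in> {1, -1}" "\<bar>\<alpha>\<bar> < \<theta>" "cis \<phi> = of_real \<sigma> * cis \<alpha>"
proof (cases "\<phi> \<in> {- \<theta><..<\<theta>}")
  case True
  then show ?thesis using that[of 1 \<phi>] by auto
next
  case False
  then have "\<bar>\<phi> - pi\<bar> < \<theta>" using assms by (auto simp: sector_angles_def)
  moreover have "cis \<phi> = of_real (-1) * cis (\<phi> - pi)" by (simp flip: cis_divide)
  ultimately show ?thesis using that[of "-1" "\<phi> - pi"] by simp
qed

lemma exp_Complex_ln: "r > 0 \<Longrightarrow> exp (Complex (ln r) \<alpha>) = r *\<^sub>R cis \<alpha>"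
  by (simp add: exp_eq_polar scaleR_conv_of_real)

lemma double_sector_eq:
  assumes th: "0 < \<theta>" "\<theta> < pi / 2"
  shows "double_sector \<theta> = {embed J z | J z. J \<in> unit_sphere \<and> z \<in> bisector \<theta>}"
proof (intro equalityI subsetI)
  fix s :: "'a clifford" assume "s \<in> double_sector \<theta>"
  then obtain r J \<phi> where s: "s = r *\<^sub>R slice_cis J \<phi>" "0 < r" "J \<in> unit_sphere" "\<phi> \<in> sector_angles \<theta>"
    by (auto simp: double_sector_def)
  obtain \<sigma> \<alpha> where a: "\<sigma> \<in> {1, -1}" "\<bar>\<alpha>\<bar> < \<theta>" "cis \<phi> = of_real \<sigma> * cis \<alpha>"
    using s(4) by (rule sector_angles_cis)
  have "s = embed J (of_real \<sigma> * exp (Complex (ln r) \<alpha>))"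
    using s a by (simp add: slice_cis_embed exp_Complex_ln flip: embed_linear)
  moreover have "of_real \<sigma> * exp (Complex (ln r) \<alpha>) \<in> bisector \<theta>"
    using exp_in_bisector_iff[OF a(1), of "Complex (ln r) \<alpha>" \<theta>] a th by simp
  ultimately show "s \<in> {embed J z | J z. J \<in> unit_sphere \<and> z \<in> bisector \<theta>}" using s(3) by blast
next
  fix s :: "'a clifford" assume "s \<in> {embed J z | J z. J \<in> unit_sphere \<and> z \<in> bisector \<theta>}"
  then obtain J z where s: "s = embed J z" "J \<in> unit_sphere" "z \<in> bisector \<theta>" by blast
  obtain \<sigma> \<zeta> where z: "\<sigma> \<in> {1, -1}" "z = of_real \<sigma> * exp \<zeta>" "\<bar>Im \<zeta>\<bar> < \<theta>"
    using bisector_polar[OF s(3) th] .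
  define \<phi> where "\<phi> = (if \<sigma> = 1 then Im \<zeta> else Im \<zeta> + pi)"
  have "z = exp (Re \<zeta>) *\<^sub>R cis \<phi>"
    using z(1) unfolding z(2) \<phi>_def by (auto simp: exp_eq_polar scaleR_conv_of_real simp flip: cis_mult)
  then have "s = exp (Re \<zeta>) *\<^sub>R slice_cis J \<phi>" using s by (simp add: slice_cis_embed embed_linear)
  moreover have "\<phi> \<in> sector_angles \<theta>" using z by (auto simp: \<phi>_def sector_angles_def)
  ultimately show "s \<in> double_sector \<theta>" unfolding double_sector_def using s(2) by (intro CollectI exI[of _ "exp (Re \<zeta>)"] exI) auto
qed

text \<open>The modulus of the imaginary part is read off without knowing \<open>J\<close>. This
  compares representations of one point in different slices and turns the cone condition into one
  that is closed in the whole algebra.\<close>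

lemma norm_embed_imaginary:
  assumes "J \<in> unit_sphere"
  shows "norm (embed J z - (embed J z $ {}) *\<^sub>R cl_one) = \<bar>Im z\<bar>"
proof -
  have "embed J z - (embed J z $ {}) *\<^sub>R cl_one = Im z *\<^sub>R J"
    using embed_nth_empty[OF assms, of z] by (simp add: embed_eq)
  then show ?thesis using unit_sphereD(2)[OF assms] by simp
qed

lemma embed_in_double_sector_iff:
  assumes th: "0 < \<theta>" "\<theta> < pi / 2" and J: "J \<in> unit_sphere"
  shows "embed J z \<in> double_sector \<theta> \<longleftrightarrow> z \<in> bisector \<theta>"
proof
  assume "embed J z \<in> double_sector \<theta>"
  then obtain I w where w: "embed J z = embed I w" "I \<in> unit_sphere" "w \<in> bisector \<theta>"
    unfolding double_sector_eq[OF th] by blast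
  have "Re z = Re w" using w embed_nth_empty J by metis
  moreover have "\<bar>Im z\<bar> = \<bar>Im w\<bar>" using w norm_embed_imaginary J by metis
  ultimately show "z \<in> bisector \<theta>" using w(3) by (simp add: bisector_def)
qed (use J double_sector_eq[OF th] in blast)

text \<open>This inclusion is what places the points strictly outside the closed bisector in the
  S-resolvent set.\<close>

lemma closure_double_sector_subset:
  assumes th: "0 < \<theta>" "\<theta> < pi / 2"
  shows "closure (double_sector \<theta>) \<subseteq> {s. norm (s - (s $ {}) *\<^sub>R cl_one) * cos \<theta> \<le> \<bar>s $ {}\<bar> * sin \<theta>}"
proof (rule closure_minimal)
  have "norm (embed J z - (embed J z $ {}) *\<^sub>R cl_one) * cos \<theta> \<le> \<bar>embed J z $ {}\<bar> * sin \<theta>"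
    if J: "J \<in> unit_sphere" and z: "z \<in> bisector \<theta>" for J :: "'a clifford" and z
    unfolding norm_embed_imaginary[OF J] unfolding embed_nth_empty[OF J] using z by (simp add: bisector_def)
  then show "double_sector \<theta> \<subseteq> {s :: 'a clifford. norm (s - (s $ {}) *\<^sub>R cl_one) * cos \<theta> \<le> \<bar>s $ {}\<bar> * sin \<theta>}"
    unfolding double_sector_eq[OF th] by blast
  show "closed {s :: 'a clifford. norm (s - (s $ {}) *\<^sub>R cl_one) * cos \<theta> \<le> \<bar>s $ {}\<bar> * sin \<theta>}"
    by (intro closed_Collect_le continuous_intros)
qed

lemma slice_domain_double_sector:
  assumes th: "0 < \<theta>" "\<theta> < pi / 2"
  shows "slice_domain (double_sector \<theta> :: 'n::{finite,linorder} clifford set) = {(x, y). Complex x y \<in> bisector \<theta>}"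
proof -
  have "slice_point J x y \<in> double_sector \<theta> \<longleftrightarrow> Complex x y \<in> bisector \<theta>" if "J \<in> unit_sphere" for J :: "'n clifford" and x y
    using embed_in_double_sector_iff[OF th that, of "Complex x y"] by (simp add: embed_def)
  then show ?thesis unfolding slice_domain_def using unit_sphere_nonempty by blast
qed

text \<open>An intrinsic function is encoded by one complex function that commutes with conjugation.\<close>

definition represents :: "real \<Rightarrow> (complex \<Rightarrow> complex) \<Rightarrow> ('n::{finite,linorder} clifford \<Rightarrow> 'n clifford) \<Rightarrow> bool" where
  "represents \<theta> h F \<longleftrightarrow> (\<forall>z\<in>bisector \<theta>. h (cnj z) = cnj (h z)) \<and>
     (\<forall>J\<in>unit_sphere. \<forall>z\<in>bisector \<theta>. F (embed J z) = embed J (h z))"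

lemma cnj_bisector [simp]: "cnj z \<in> bisector \<theta> \<longleftrightarrow> z \<in> bisector \<theta>"
  by (simp add: bisector_def)

text \<open>Real components combine to \<open>h = g0 + i g1\<close>. The differential equations of
  the components are the Cauchy-Riemann equations of \<open>h\<close>, and their parities say that
  \<open>h\<close> commutes with conjugation.\<close>

lemma intrinsic_represents:
  fixes g :: "'n::{finite,linorder} clifford \<Rightarrow> 'n clifford"
  assumes th: "0 < \<theta>" "\<theta> < pi / 2" and g: "g \<in> intrinsic (double_sector \<theta>)"
  obtains h where "h holomorphic_on bisector \<theta>" "represents \<theta> h g"
proof -
  obtain g0 g1 where c: "slice_components (double_sector \<theta>) g g0 g1"
    and re: "\<And>z. z \<in> slice_domain (double_sector \<theta> :: 'n clifford set) \<Longrightarrow>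
      g0 z \<in> range (\<lambda>r. r *\<^sub>R cl_one) \<and> g1 z \<in> range (\<lambda>r. r *\<^sub>R cl_one)"
    using g unfolding intrinsic_def by blast
  note sd = slice_domain_double_sector[OF th, where 'n = 'n]
  have e: "r *\<^sub>R cl_one = ((r *\<^sub>R cl_one) $ {}) *\<^sub>R cl_one" for r by (simp add: cl_one_def axis_def)
  define h where "h z = Complex (g0 (Re z, Im z) $ {}) (g1 (Re z, Im z) $ {})" for z
  have g01: "g0 (Re z, Im z) = Re (h z) *\<^sub>R cl_one" "g1 (Re z, Im z) = Im (h z) *\<^sub>R cl_one" if "z \<in> bisector \<theta>" for z
  proof -
    have "(Re z, Im z) \<in> slice_domain (double_sector \<theta> :: 'n clifford set)" using that by (simp add: sd)
    then show "g0 (Re z, Im z) = Re (h z) *\<^sub>R cl_one" "g1 (Re z, Im z) = Im (h z) *\<^sub>R cl_one"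
      using re e unfolding h_def by (metis (no_types, lifting) complex.sel rangeE)+
  qed
  have 1: "g (embed J z) = embed J (h z)" if "J \<in> unit_sphere" "z \<in> bisector \<theta>" for J z
  proof -
    have "g (slice_point J (Re z) (Im z)) = g0 (Re z, Im z) + lmul J (g1 (Re z, Im z))"
      using c that unfolding slice_components_def sd by fastforce
    then show ?thesis by (simp add: g01[OF that(2)] lmul.scaleR_right embed_def[of J z] embed_eq[of J "h z"])
  qed
  have 2: "h (cnj z) = cnj (h z)" if "z \<in> bisector \<theta>" for z
  proof -
    have "g0 (Re z, - Im z) = g0 (Re z, Im z) \<and> g1 (Re z, - Im z) = - g1 (Re z, Im z)"
      using c that unfolding slice_components_def sd by fastforce
    then show ?thesis by (simp add: h_def complex_eq_iff)
  qed
  obtain D0 D1 :: "real \<times> real \<Rightarrow> (real \<times> real) \<Rightarrow>\<^sub>L 'n clifford" where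
    D: "\<And>z. z \<in> slice_domain (double_sector \<theta> :: 'n clifford set) \<Longrightarrow>
           (g0 has_derivative blinfun_apply (D0 z)) (at z) \<and>
           (g1 has_derivative blinfun_apply (D1 z)) (at z) \<and>
           blinfun_apply (D0 z) (1, 0) = blinfun_apply (D1 z) (0, 1) \<and>
           blinfun_apply (D0 z) (0, 1) = - blinfun_apply (D1 z) (1, 0)"
    using c unfolding slice_components_def by blast
  have "h holomorphic_on bisector \<theta>"
    unfolding holomorphic_on_def
  proof
    fix z assume z: "z \<in> bisector \<theta>"
    let ?p = "(Re z, Im z)"
    have sdz: "?p \<in> slice_domain (double_sector \<theta> :: 'n clifford set)" using z by (simp add: sd)
    define p where "p = blinfun_apply (D0 ?p) (1, 0) $ {}"
    define q where "q = blinfun_apply (D1 ?p) (1, 0) $ {}"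
    have lin: "blinfun_apply B (x, y) = x *\<^sub>R blinfun_apply B (1, 0) + y *\<^sub>R blinfun_apply B (0, 1)"
      for B :: "(real \<times> real) \<Rightarrow>\<^sub>L 'n clifford" and x y
      by (simp flip: blinfun.scaleR_right blinfun.add_right)
    have dRI: "((\<lambda>z. (Re z, Im z)) has_derivative (\<lambda>k. (Re k, Im k))) (at z)"
      by (auto intro!: derivative_eq_intros)
    have d0: "((\<lambda>z. g0 (Re z, Im z)) has_derivative (\<lambda>k. blinfun_apply (D0 ?p) (Re k, Im k))) (at z)"
      using has_derivative_compose[OF dRI] D[OF sdz] by blast
    have d1: "((\<lambda>z. g1 (Re z, Im z)) has_derivative (\<lambda>k. blinfun_apply (D1 ?p) (Re k, Im k))) (at z)"
      using has_derivative_compose[OF dRI] D[OF sdz] by blast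
    have nth: "((\<lambda>z. f z $ {}) has_derivative (\<lambda>k. f' k $ {})) (at z)"
      if "(f has_derivative f') (at z)" for f f' :: "complex \<Rightarrow> 'n clifford"
      using bounded_linear.has_derivative[OF bounded_linear_vec_nth that] .
    have "((\<lambda>z. of_real (g0 (Re z, Im z) $ {}) + \<i> * of_real (g1 (Re z, Im z) $ {})) has_derivative
        (\<lambda>k. of_real (blinfun_apply (D0 ?p) (Re k, Im k) $ {}) + \<i> * of_real (blinfun_apply (D1 ?p) (Re k, Im k) $ {}))) (at z)"
      by (intro has_derivative_add has_derivative_mult_right has_derivative_of_real nth[OF d0] nth[OF d1])
    moreover have "(\<lambda>z. of_real (g0 (Re z, Im z) $ {}) + \<i> * of_real (g1 (Re z, Im z) $ {})) = h"
      by (simp add: h_def fun_eq_iff complex_eq_iff)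
    moreover have "(\<lambda>k. of_real (blinfun_apply (D0 ?p) (Re k, Im k) $ {}) + \<i> * of_real (blinfun_apply (D1 ?p) (Re k, Im k) $ {}))
        = (*) (Complex p q)"
    proof
      fix k
      show "of_real (blinfun_apply (D0 ?p) (Re k, Im k) $ {}) + \<i> * of_real (blinfun_apply (D1 ?p) (Re k, Im k) $ {}) = Complex p q * k"
        using D[OF sdz] unfolding lin[of "D0 ?p" "Re k"] lin[of "D1 ?p" "Re k"]
        by (simp add: complex_eq_iff p_def q_def)
    qed
    ultimately have "(h has_field_derivative Complex p q) (at z)"
      by (simp add: has_field_derivative_def)
    then show "h field_differentiable at z within bisector \<theta>"
      using field_differentiable_def field_differentiable_at_within by blast
  qed
  then show ?thesis using that 1 2 by (auto simp: represents_def)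
qed

text \<open>The derivatives of the components are the real and imaginary parts of multiplication by
  \<open>deriv h\<close>, expressed by the coordinate differentials \<open>X\<close> and
  \<open>Y\<close>; they are continuous because \<open>deriv h\<close> is holomorphic.\<close>

lemma represents_slice_components:
  fixes F :: "'n::{finite,linorder} clifford \<Rightarrow> 'n clifford"
  assumes th: "0 < \<theta>" "\<theta> < pi / 2" and hol: "h holomorphic_on bisector \<theta>" and rep: "represents \<theta> h F"
  shows "slice_components (double_sector \<theta>) F
    (\<lambda>(x, y). Re (h (Complex x y)) *\<^sub>R cl_one) (\<lambda>(x, y). Im (h (Complex x y)) *\<^sub>R cl_one)"
proof -
  note sd = slice_domain_double_sector[OF th, where 'n = 'n]
  define X :: "(real \<times> real) \<Rightarrow>\<^sub>L 'n clifford" where "X = Blinfun (\<lambda>k. fst k *\<^sub>R cl_one)"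
  define Y :: "(real \<times> real) \<Rightarrow>\<^sub>L 'n clifford" where "Y = Blinfun (\<lambda>k. snd k *\<^sub>R cl_one)"
  have X: "blinfun_apply X k = fst k *\<^sub>R cl_one" for k
    unfolding X_def by (subst bounded_linear_Blinfun_apply) (auto intro!: bounded_linear_intros)
  have Y: "blinfun_apply Y k = snd k *\<^sub>R cl_one" for k
    unfolding Y_def by (subst bounded_linear_Blinfun_apply) (auto intro!: bounded_linear_intros)
  define H where "H p = deriv h (Complex (fst p) (snd p))" for p :: "real \<times> real"
  define D0 where "D0 p = Re (H p) *\<^sub>R X - Im (H p) *\<^sub>R Y" for p
  define D1 where "D1 p = Im (H p) *\<^sub>R X + Re (H p) *\<^sub>R Y" for p
  have cH: "continuous_on (slice_domain (double_sector \<theta> :: 'n clifford set)) H"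
    unfolding H_def
  proof (rule continuous_on_compose2[of "bisector \<theta>" "deriv h"])
    show "continuous_on (bisector \<theta>) (deriv h)"
      using hol open_bisector holomorphic_deriv holomorphic_on_imp_continuous_on by blast
  qed (auto simp: sd Complex_eq intro!: continuous_intros)
  have der: "((\<lambda>(x, y). Re (h (Complex x y)) *\<^sub>R cl_one) has_derivative blinfun_apply (D0 p)) (at p)"
    "((\<lambda>(x, y). Im (h (Complex x y)) *\<^sub>R cl_one) has_derivative blinfun_apply (D1 p)) (at p)"
    if p: "p \<in> slice_domain (double_sector \<theta> :: 'n clifford set)" for p
  proof -
    have "(h has_field_derivative H p) (at (Complex (fst p) (snd p)))"
      unfolding H_def using p sd by (intro holomorphic_derivI[OF hol open_bisector]) auto
    then have dh: "(h has_derivative (*) (H p)) (at (Complex (fst p) (snd p)))"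
      by (rule has_field_derivative_imp_has_derivative)
    have dC: "((\<lambda>p. Complex (fst p) (snd p)) has_derivative (\<lambda>k. Complex (fst k) (snd k))) (at p)"
      unfolding Complex_eq by (auto intro!: derivative_eq_intros)
    note d = has_derivative_compose[OF dC dh]
    show "((\<lambda>(x, y). Re (h (Complex x y)) *\<^sub>R cl_one) has_derivative blinfun_apply (D0 p)) (at p)"
      unfolding split_beta
      by (rule has_derivative_eq_rhs[OF has_derivative_scaleR_left[OF has_derivative_Re[OF d]]])
         (simp add: fun_eq_iff D0_def blinfun.diff_left blinfun.scaleR_left X Y scaleR_diff_left)
    show "((\<lambda>(x, y). Im (h (Complex x y)) *\<^sub>R cl_one) has_derivative blinfun_apply (D1 p)) (at p)"
      unfolding split_beta
      by (rule has_derivative_eq_rhs[OF has_derivative_scaleR_left[OF has_derivative_Im[OF d]]])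
         (simp add: fun_eq_iff D1_def blinfun.add_left blinfun.scaleR_left X Y scaleR_add_left add.commute)
  qed
  show ?thesis
    unfolding slice_components_def
  proof (intro conjI, goal_cases)
    case 1
    show ?case
    proof (clarsimp simp: sd)
      fix x y J assume "Complex x y \<in> bisector \<theta>" "J \<in> (unit_sphere :: 'n clifford set)"
      then have "F (embed J (Complex x y)) = embed J (h (Complex x y))" using rep by (simp add: represents_def)
      then show "F (slice_point J x y) = Re (h (Complex x y)) *\<^sub>R cl_one + lmul J (Im (h (Complex x y)) *\<^sub>R cl_one)"
        by (simp add: slice_point_def embed_eq lmul.scaleR_right)
    qed
  next
    case 2
    have "h (Complex x (- y)) = cnj (h (Complex x y))" if "Complex x y \<in> bisector \<theta>" for x y
    proof -
      have "cnj (Complex x y) = Complex x (- y)" by (simp add: complex_eq_iff)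
      then show ?thesis using rep that unfolding represents_def by metis
    qed
    then show ?case by (auto simp: sd)
  next
    case 3
    show ?case
    proof (rule exI[of _ D0], rule exI[of _ D1], intro conjI)
      show "continuous_on (slice_domain (double_sector \<theta> :: 'n clifford set)) D0"
        unfolding D0_def by (intro continuous_intros cH)
      show "continuous_on (slice_domain (double_sector \<theta> :: 'n clifford set)) D1"
        unfolding D1_def by (intro continuous_intros cH)
      show "\<forall>z\<in>slice_domain (double_sector \<theta> :: 'n clifford set).
        ((\<lambda>(x, y). Re (h (Complex x y)) *\<^sub>R cl_one) has_derivative blinfun_apply (D0 z)) (at z) \<and>
        ((\<lambda>(x, y). Im (h (Complex x y)) *\<^sub>R cl_one) has_derivative blinfun_apply (D1 z)) (at z) \<and>
        blinfun_apply (D0 z) (1, 0) = blinfun_apply (D1 z) (0, 1) \<and>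
        blinfun_apply (D0 z) (0, 1) = - blinfun_apply (D1 z) (1, 0)"
        using der by (auto simp: D0_def D1_def blinfun.add_left blinfun.diff_left blinfun.scaleR_left X Y)
    qed
  qed
qed

text \<open>On bounded intervals this is the ordinary substitution; monotone convergence passes to
  the line, the integral of \<open>k\<close> over the half line being the uniform bound.\<close>

lemma integrable_exp_substitution_nonneg:
  fixes k :: "real \<Rightarrow> real"
  assumes cont: "continuous_on {0<..} k" and pos: "\<And>t. t > 0 \<Longrightarrow> 0 \<le> k t"
    and int: "k integrable_on {0<..}"
  shows "(\<lambda>u. exp u * k (exp u)) integrable_on UNIV"
proof -
  let ?H = "\<lambda>u. exp u * k (exp u)"
  have sub: "(?H has_integral integral {exp (- N)..exp N} k) {-N..N}" if "N \<ge> 0" for N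
  proof -
    have "((\<lambda>u. exp u *\<^sub>R k (exp u)) has_integral integral {exp (- N)..exp N} k) {-N..N}"
    proof (rule has_integral_substitution[where c = "exp (-N)" and d = "exp N"])
      have "{exp (- N)..exp N} \<subseteq> {0<..}" by (auto intro: less_le_trans[OF exp_gt_zero])
      then show "continuous_on {exp (- N)..exp N} k" using cont continuous_on_subset by blast
    qed (use that in \<open>auto intro!: derivative_eq_intros\<close>)
    then show ?thesis by simp
  qed
  have fi: "((\<lambda>u. if u \<in> {-real n..real n} then ?H u else 0) has_integral integral {exp (- real n)..exp (real n)} k) UNIV" for n
    using sub[of "real n"] has_integral_restrict_UNIV by fastforce
  have "?H integrable_on UNIV \<and> (\<lambda>n. integral UNIV (\<lambda>u. if u \<in> {-real n..real n} then ?H u else 0)) \<longlonglongrightarrow> integral UNIV ?H"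
  proof (rule monotone_convergence_increasing)
    show "(\<lambda>u. if u \<in> {-real n..real n} then ?H u else 0) integrable_on UNIV" for n using fi by blast
    show "(if u \<in> {-real n..real n} then ?H u else 0) \<le> (if u \<in> {-real (Suc n)..real (Suc n)} then ?H u else 0)" for n u
      using pos[of "exp u"] by auto
    show "(\<lambda>n. if u \<in> {-real n..real n} then ?H u else 0) \<longlonglongrightarrow> ?H u" for u
    proof (rule tendsto_eventually)
      have "\<forall>\<^sub>F n in sequentially. \<bar>u\<bar> \<le> real n"
        using eventually_ge_at_top[of "nat \<lceil>\<bar>u\<bar>\<rceil>"] by eventually_elim linarith
      then show "\<forall>\<^sub>F n in sequentially. (if u \<in> {-real n..real n} then ?H u else 0) = ?H u"
        by eventually_elim auto
    qed
    have "\<bar>integral UNIV (\<lambda>u. if u \<in> {-real n..real n} then ?H u else 0)\<bar> \<le> integral {0<..} k" for n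
    proof -
      have s: "{exp (- real n)..exp (real n)} \<subseteq> {0<..}" by (auto intro: less_le_trans[OF exp_gt_zero])
      have i: "k integrable_on {exp (- real n)..exp (real n)}"
        using cont continuous_on_subset[OF _ s] integrable_continuous_real by blast
      have "0 \<le> integral {exp (- real n)..exp (real n)} k"
        using s pos by (intro integral_nonneg[OF i]) (auto simp: subset_iff)
      moreover have "integral {exp (- real n)..exp (real n)} k \<le> integral {0<..} k"
        by (rule integral_subset_le[OF s i int]) (use pos in auto)
      ultimately show ?thesis using fi[of n] by (simp add: integral_unique)
    qed
    then show "bounded (range (\<lambda>n. integral UNIV (\<lambda>u. if u \<in> {-real n..real n} then ?H u else 0)))"
      by (auto simp: bounded_iff)
  qed
  then show ?thesis by simp
qed

text \<open>Passage between the Lebesgue integral for \<open>dt / t\<close> in the definition of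
  \<open>SH_L0\<close> and the gauge integral in \<open>u = ln t\<close>; for nonnegative continuous
  integrands finiteness and integrability are equivalent.\<close>

lemma ray_integral_iff:
  assumes th: "0 < \<theta>" "\<theta> < pi / 2" and hol: "h holomorphic_on bisector \<theta>"
    and s: "\<sigma> \<in> {1, -1}" and al: "\<bar>\<alpha>\<bar> < \<theta>"
  shows "(\<integral>\<^sup>+t\<in>{0<..}. ennreal (norm (h (t *\<^sub>R (of_real \<sigma> * cis \<alpha>))) / t) \<partial>lborel) < \<infinity> \<longleftrightarrow>
    (\<lambda>u. norm (h (of_real \<sigma> * exp (Complex u \<alpha>)))) integrable_on UNIV"
proof -
  define k where "k t = norm (h (t *\<^sub>R (of_real \<sigma> * cis \<alpha>))) / t" for t
  have pt: "t *\<^sub>R (of_real \<sigma> * cis \<alpha>) = of_real \<sigma> * exp (Complex (ln t) \<alpha>)" if "t > 0" for t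
    using that by (simp add: exp_Complex_ln)
  have mem: "t *\<^sub>R (of_real \<sigma> * cis \<alpha>) \<in> bisector \<theta>" if "t > 0" for t
    unfolding pt[OF that] using exp_in_bisector_iff[OF s, of "Complex (ln t) \<alpha>" \<theta>] th al by simp
  have ck: "continuous_on {0<..} k"
    unfolding k_def
    by (intro continuous_intros continuous_on_compose2[OF holomorphic_on_imp_continuous_on[OF hol]])
       (use mem in auto)
  have kpos: "0 \<le> k t" if "t > 0" for t using that by (simp add: k_def)
  have kexp: "exp u * k (exp u) = norm (h (of_real \<sigma> * exp (Complex u \<alpha>)))" for u
    using pt[of "exp u"] by (simp add: k_def)
  have nn: "(\<integral>\<^sup>+t\<in>{0<..}. ennreal (k t) \<partial>lborel) = (\<integral>\<^sup>+t. ennreal (indicator {0<..} t * k t) \<partial>lborel)"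
    by (intro nn_integral_cong) (auto simp: indicator_def)
  show ?thesis
    unfolding k_def[symmetric] kexp[symmetric]
  proof
    assume "(\<integral>\<^sup>+t\<in>{0<..}. ennreal (k t) \<partial>lborel) < \<infinity>"
    then have "(\<lambda>t. indicator {0<..} t * k t) integrable_on UNIV"
      unfolding nn using borel_measurable_continuous_on_indicator[OF _ ck] kpos
      by (intro nn_integral_integrable_on) (auto simp: indicator_def)
    then have "(\<lambda>t. if t \<in> {0<..} then k t else 0) integrable_on UNIV"
      by (rule integrable_eq) (auto simp: indicator_def)
    then have "k integrable_on {0<..}" using integrable_restrict_UNIV by blast
    then show "(\<lambda>u. exp u * k (exp u)) integrable_on UNIV"
      using integrable_exp_substitution_nonneg[OF ck kpos] by blast
  next
    assume int: "(\<lambda>u. exp u * k (exp u)) integrable_on UNIV"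
    have "(k has_integral integral UNIV (\<lambda>u. exp u *\<^sub>R k (exp u))) {0<..}"
    proof (rule has_integral_Ioi_exp_substitution[OF _ _ int])
      show "continuous_on UNIV (\<lambda>u. exp u *\<^sub>R k (exp u))"
        by (intro continuous_intros continuous_on_compose2[OF ck]) auto
    qed (use kpos in \<open>simp add: abs_mult\<close>)
    from nn_integral_has_integral_lebesgue[OF _ this] kpos show "(\<integral>\<^sup>+t\<in>{0<..}. ennreal (k t) \<partial>lborel) < \<infinity>"
      unfolding nn by simp
  qed
qed

lemma ray_nn_integral_eq:
  fixes F :: "'n::{finite,linorder} clifford \<Rightarrow> 'n clifford"
  assumes th: "0 < \<theta>" "\<theta> < pi / 2" and s: "\<sigma> \<in> {1, -1}" and al: "\<bar>\<alpha>\<bar> < \<theta>"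
    and rep: "represents \<theta> h F" and J: "J \<in> unit_sphere" and c: "cis \<phi> = of_real \<sigma> * cis \<alpha>"
  shows "(\<integral>\<^sup>+t\<in>{0<..}. ennreal (norm (F (t *\<^sub>R slice_cis J \<phi>)) / t) \<partial>lborel)
    = (\<integral>\<^sup>+t\<in>{0<..}. ennreal (norm (h (t *\<^sub>R (of_real \<sigma> * cis \<alpha>))) / t) \<partial>lborel)"
proof (intro nn_integral_cong)
  fix t :: real
  have "t *\<^sub>R (of_real \<sigma> * cis \<alpha>) \<in> bisector \<theta>" if "t > 0"
    using that exp_in_bisector_iff[OF s, of "Complex (ln t) \<alpha>" \<theta>] th al by (simp add: exp_Complex_ln)
  then have "norm (F (t *\<^sub>R slice_cis J \<phi>)) = norm (h (t *\<^sub>R (of_real \<sigma> * cis \<alpha>)))" if "t > 0"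
    using that rep J by (simp add: represents_def norm_embed slice_cis_embed c flip: embed_linear)
  then show "ennreal (norm (F (t *\<^sub>R slice_cis J \<phi>)) / t) * indicator {0<..} t
      = ennreal (norm (h (t *\<^sub>R (of_real \<sigma> * cis \<alpha>))) / t) * indicator {0<..} t"
    by (auto simp: indicator_def)
qed

lemma SH_L0_bisector_fun:
  fixes g :: "'n::{finite,linorder} clifford \<Rightarrow> 'n clifford"
  assumes th: "0 < \<theta>" "\<theta> < pi / 2" and hol: "h holomorphic_on bisector \<theta>" and rep: "represents \<theta> h g"
    and g: "g \<in> SH_L0 \<theta>"
  shows "bisector_fun \<theta> h"
  unfolding bisector_fun_def
proof (intro conjI ballI allI impI hol)
  obtain J :: "'n clifford" where J: "J \<in> unit_sphere" using unit_sphere_nonempty by blast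
  obtain B where B: "\<And>s. s \<in> double_sector \<theta> \<Longrightarrow> norm (g s) \<le> B"
    using g by (auto simp: SH_L0_def bounded_iff)
  have gh: "norm (g (embed J z)) = norm (h z)" if "z \<in> bisector \<theta>" for z
    using rep J that by (simp add: represents_def norm_embed)
  show "\<exists>B. \<forall>z\<in>bisector \<theta>. norm (h z) \<le> B"
    using B gh embed_in_double_sector_iff[OF th J] by metis
  fix \<sigma> \<alpha> :: real assume s: "\<sigma> \<in> {1, -1}" and al: "\<bar>\<alpha>\<bar> < \<theta>"
  define \<phi> where "\<phi> = (if \<sigma> = 1 then \<alpha> else \<alpha> + pi)"
  have c: "cis \<phi> = of_real \<sigma> * cis \<alpha>" using s by (auto simp: \<phi>_def simp flip: cis_mult)
  have "\<phi> \<in> sector_angles \<theta>" using al by (auto simp: \<phi>_def sector_angles_def)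
  then have "(\<integral>\<^sup>+t\<in>{0<..}. ennreal (norm (g (t *\<^sub>R slice_cis J \<phi>)) / t) \<partial>lborel) < \<infinity>"
    using g J by (simp add: SH_L0_def)
  then show "(\<lambda>u. norm (h (of_real \<sigma> * exp (Complex u \<alpha>)))) integrable_on UNIV"
    using ray_integral_iff[OF th hol s al] ray_nn_integral_eq[OF th s al rep J c] by simp
qed

text \<open>Openness and axial symmetry of the double sector are hypotheses here; membership of
  \<open>g\<close> in \<open>intrinsic\<close> supplies them later.\<close>

lemma represents_SH_L0:
  fixes F :: "'n::{finite,linorder} clifford \<Rightarrow> 'n clifford"
  assumes th: "0 < \<theta>" "\<theta> < pi / 2" and h: "bisector_fun \<theta> h" and rep: "represents \<theta> h F"
    and dom: "openin (top_of_set paravectors) (double_sector \<theta> :: 'n clifford set)"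
      "axially_symmetric (double_sector \<theta> :: 'n clifford set)"
  shows "F \<in> SH_L0 \<theta>"
proof -
  have hol: "h holomorphic_on bisector \<theta>" using h by (simp add: bisector_fun_def)
  have Fh: "norm (F (embed J z)) = norm (h z)" if "z \<in> bisector \<theta>" "J \<in> unit_sphere" for z J
    using rep that by (simp add: represents_def norm_embed)
  have "F \<in> SH_L (double_sector \<theta>)"
    unfolding SH_L_def using dom represents_slice_components[OF th hol rep] by blast
  moreover have "bounded (F ` double_sector \<theta>)"
  proof -
    obtain B where "\<And>z. z \<in> bisector \<theta> \<Longrightarrow> norm (h z) \<le> B" using h by (auto simp: bisector_fun_def)
    then show ?thesis unfolding double_sector_eq[OF th] bounded_iff using Fh by force
  qed
  moreover have "(\<integral>\<^sup>+t\<in>{0<..}. ennreal (norm (F (t *\<^sub>R slice_cis J \<phi>)) / t) \<partial>lborel) < \<infinity>"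
    if J: "J \<in> unit_sphere" and ph: "\<phi> \<in> sector_angles \<theta>" for J \<phi>
  proof -
    obtain \<sigma> \<alpha> where a: "\<sigma> \<in> {1, -1}" "\<bar>\<alpha>\<bar> < \<theta>" "cis \<phi> = of_real \<sigma> * cis \<alpha>"
      using ph by (rule sector_angles_cis)
    have "(\<lambda>u. norm (h (of_real \<sigma> * exp (Complex u \<alpha>)))) integrable_on UNIV"
      using h a unfolding bisector_fun_def by blast
    then show ?thesis
      using ray_integral_iff[OF th hol a(1,2)] ray_nn_integral_eq[OF th a(1,2) rep J a(3)] by simp
  qed
  ultimately show ?thesis by (simp add: SH_L0_def)
qed

section \<open>The resolvent of a bisectorial operator\<close>

lemma has_integral_reflect_UNIV:
  fixes f :: "real \<Rightarrow> 'a::banach"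
  assumes "(f has_integral i) UNIV"
  shows "((\<lambda>x. f (- x)) has_integral i) UNIV"
  unfolding has_integral_alt'
proof (simp only: UNIV_I if_True, intro conjI allI impI)
  fix a b :: real
  show "(\<lambda>x. f (- x)) integrable_on cbox a b"
    using integrable_reflect[of f "-a" "-b"] assms
    unfolding has_integral_alt' by (simp del: integrable_reflect)
next
  fix e :: real assume "e > 0"
  then obtain B where B: "B > 0" "\<And>a b. ball 0 B \<subseteq> cbox a b \<Longrightarrow> norm (integral (cbox a b) f - i) < e"
    using assms unfolding has_integral_alt' by auto
  show "\<exists>B>0. \<forall>a b. ball 0 B \<subseteq> cbox a b \<longrightarrow> norm (integral (cbox a b) (\<lambda>x. f (- x)) - i) < e"
  proof (intro exI conjI allI impI)
    fix a b :: real assume sub: "ball 0 B \<subseteq> cbox a b"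
    have "ball 0 B \<subseteq> cbox (- b) (- a)"
    proof
      fix x :: real assume "x \<in> ball 0 B"
      then have "- x \<in> cbox a b" using sub by (auto simp: subset_iff dist_real_def)
      then show "x \<in> cbox (- b) (- a)" by auto
    qed
    then show "norm (integral (cbox a b) (\<lambda>x. f (- x)) - i) < e"
      using B(2)[of "-b" "-a"] integral_reflect[of "-a" "-b" f] by (simp del: integral_reflect)
  qed (rule B(1))
qed

lemma has_integral_two_sided:
  fixes k :: "real \<Rightarrow> 'a::banach"
  assumes "(k has_integral a) {0<..}" and "((\<lambda>t. k (- t)) has_integral b) {0<..}"
  shows "(k has_integral (a + b)) UNIV"
proof -
  have "((\<lambda>t. if t \<in> {0<..} then k t else 0) has_integral a) UNIV"
    using assms(1) by (simp only: has_integral_restrict_UNIV)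
  moreover have "((\<lambda>t. if - t \<in> {0<..} then k (- (- t)) else 0) has_integral b) UNIV"
    using has_integral_reflect_UNIV[of "\<lambda>t. if t \<in> {0<..} then k (- t) else 0"] assms(2)
    by (simp only: has_integral_restrict_UNIV)
  ultimately have "((\<lambda>t. (if t \<in> {0<..} then k t else 0) + (if - t \<in> {0<..} then k (- (- t)) else 0)) has_integral (a + b)) UNIV"
    by (rule has_integral_add)
  then show ?thesis
    by (rule has_integral_spike_finite[of "{0}", rotated 2]) auto
qed

text \<open>The first claim is the monotonicity of the tangent, multiplied out to
  \<open>0 < sin (\<phi> - \<omega>)\<close>. The second follows by squaring the defining
  inequality.\<close>

lemma not_in_bisectorD:
  assumes z: "z \<noteq> 0" "z \<notin> bisector \<phi>" and ph: "0 < \<omega>" "\<omega> < \<phi>" "\<phi> < pi / 2"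
  shows "\<bar>Re z\<bar> * sin \<omega> < \<bar>Im z\<bar> * cos \<omega>" and "sin \<phi> * norm z \<le> \<bar>Im z\<bar>"
proof -
  have c: "0 < cos \<phi>" "0 < cos \<omega>" "0 < sin \<phi>" "0 < sin (\<phi> - \<omega>)"
    using ph by (auto intro!: cos_gt_zero sin_gt_zero)
  have le: "\<bar>Re z\<bar> * sin \<phi> \<le> \<bar>Im z\<bar> * cos \<phi>" using z by (simp add: bisector_def)
  show "\<bar>Re z\<bar> * sin \<omega> < \<bar>Im z\<bar> * cos \<omega>"
  proof (cases "Re z = 0")
    case True
    then have "Im z \<noteq> 0" using z(1) by (auto simp: complex_eq_iff)
    then show ?thesis using True c by simp
  next
    case False
    have "\<bar>Re z\<bar> * sin \<omega> * cos \<phi> < \<bar>Re z\<bar> * sin \<phi> * cos \<omega>"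
      using False c(4) by (simp add: sin_diff mult_ac)
    also have "\<dots> \<le> \<bar>Im z\<bar> * cos \<phi> * cos \<omega>" using le c by (intro mult_right_mono) auto
    finally have "(\<bar>Re z\<bar> * sin \<omega>) * cos \<phi> < (\<bar>Im z\<bar> * cos \<omega>) * cos \<phi>" by (simp add: mult_ac)
    then show ?thesis using c by simp
  qed
  have "(\<bar>Re z\<bar> * sin \<phi>)\<^sup>2 \<le> (\<bar>Im z\<bar> * cos \<phi>)\<^sup>2" using le c by (intro power_mono) auto
  then have "(Re z)\<^sup>2 * (sin \<phi>)\<^sup>2 \<le> (Im z)\<^sup>2 * (1 - (sin \<phi>)\<^sup>2)"
    by (simp add: power_mult_distrib cos_squared_eq)
  then have "(sin \<phi> * norm z)\<^sup>2 \<le> \<bar>Im z\<bar>\<^sup>2"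
    by (simp add: power_mult_distrib cmod_power2 algebra_simps)
  then show "sin \<phi> * norm z \<le> \<bar>Im z\<bar>" by (rule power2_le_imp_le) simp
qed

lemma op_power_2: "op_power T 2 v = (case T v of None \<Rightarrow> None | Some w \<Rightarrow> T w)"
  by (simp add: numeral_2_eq_2 map_comp_def)

lemma Q_op_eq_Some_iff:
  "Q_op s T v = Some w \<longleftrightarrow> v \<in> dom T \<and> the (T v) \<in> dom T \<and>
     w = the (T (the (T v))) - (2 * s $ {}) *\<^sub>R the (T v) + (norm s)\<^sup>2 *\<^sub>R v"
  by (auto simp: Q_op_def op_power_2 dom_def split: option.splits)

lemma closed_opsD:
  assumes "T \<in> closed_ops"
  shows "0 \<in> dom T" "v \<in> dom T \<Longrightarrow> w \<in> dom T \<Longrightarrow> v + w \<in> dom T" "v \<in> dom T \<Longrightarrow> r *\<^sub>R v \<in> dom T"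
    "v \<in> dom T \<Longrightarrow> rmul v a \<in> dom T"
    "v \<in> dom T \<Longrightarrow> w \<in> dom T \<Longrightarrow> the (T (v + w)) = the (T v) + the (T w)"
    "v \<in> dom T \<Longrightarrow> the (T (rmul v a)) = rmul (the (T v)) a"
    "v \<in> dom T \<Longrightarrow> the (T (r *\<^sub>R v)) = r *\<^sub>R the (T v)"
    "v \<in> dom T \<Longrightarrow> w \<in> dom T \<Longrightarrow> v - w \<in> dom T"
    "v \<in> dom T \<Longrightarrow> w \<in> dom T \<Longrightarrow> the (T (v - w)) = the (T v) - the (T w)"
proof -
  have sub: "subspace (dom T)" using assms by (simp add: closed_ops_def)
  show d: "0 \<in> dom T" "v \<in> dom T \<Longrightarrow> w \<in> dom T \<Longrightarrow> v + w \<in> dom T" "v \<in> dom T \<Longrightarrow> r *\<^sub>R v \<in> dom T"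
    "v \<in> dom T \<Longrightarrow> w \<in> dom T \<Longrightarrow> v - w \<in> dom T" for v w r
    using sub by (auto simp: subspace_0 subspace_add subspace_mul subspace_diff)
  show "v \<in> dom T \<Longrightarrow> rmul v a \<in> dom T"
    and add: "\<And>v w. v \<in> dom T \<Longrightarrow> w \<in> dom T \<Longrightarrow> the (T (v + w)) = the (T v) + the (T w)"
    and mul: "\<And>v a. v \<in> dom T \<Longrightarrow> the (T (rmul v a)) = rmul (the (T v)) a"
    using assms by (auto simp: closed_ops_def)
  \<comment> \<open>Real homogeneity is right linearity for the Clifford number
    \<open>r *\<^sub>R cl_one\<close>.\<close>
  have sc: "the (T (r *\<^sub>R v)) = r *\<^sub>R the (T v)" if "v \<in> dom T" for v r
    using mul[OF that, of "r *\<^sub>R cl_one"] by (simp add: rmul.scaleR_right)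
  then show "v \<in> dom T \<Longrightarrow> the (T (r *\<^sub>R v)) = r *\<^sub>R the (T v)" .
  show "v \<in> dom T \<Longrightarrow> w \<in> dom T \<Longrightarrow> the (T (v - w)) = the (T v) - the (T w)"
    using add[of v "(-1) *\<^sub>R w"] d(3)[of w "-1"] sc[of w "-1"] by simp
qed

section \<open>Complex scalars and resolvents as bounded operators\<close>

type_synonym ('v, 'n) module_op = "('v, 'n) clifford_module \<Rightarrow>\<^sub>L ('v, 'n) clifford_module"

text \<open>Real and imaginary part are separated to make linearity in \<open>z\<close> visible;
  \<open>rscale_apply\<close> identifies the operator with right multiplication by
  \<open>embed J z\<close>.\<close>

definition rscale :: "'n::{finite,linorder} clifford \<Rightarrow> complex \<Rightarrow> ('v::real_normed_vector, 'n) module_op" where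
  "rscale J z = Re z *\<^sub>R id_blinfun + Im z *\<^sub>R Blinfun (\<lambda>v. rmul v J)"

definition lscale :: "'n::{finite,linorder} clifford \<Rightarrow> complex \<Rightarrow> ('v::real_normed_vector, 'n) module_op" where
  "lscale J z = Re z *\<^sub>R id_blinfun + Im z *\<^sub>R Blinfun (lmul J)"

lemma rscale_apply: "blinfun_apply (rscale J z) v = rmul v (embed J z)"
  by (simp add: rscale_def rmul_embed blinfun.add_left blinfun.scaleR_left
      bounded_linear_Blinfun_apply rmul.bounded_linear_left)

lemma lscale_apply: "blinfun_apply (lscale J z) v = lmul (embed J z) v"
  by (simp add: lscale_def lmul_embed blinfun.add_left blinfun.scaleR_left
      bounded_linear_Blinfun_apply lmul.bounded_linear_right)

lemma bounded_linear_rscale: "bounded_linear (rscale J)"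
  unfolding rscale_def
  by (intro bounded_linear_add bounded_linear_compose[OF bounded_linear_scaleR_left]
      bounded_linear_Re bounded_linear_Im)

lemma bounded_linear_lscale: "bounded_linear (lscale J)"
  unfolding lscale_def
  by (intro bounded_linear_add bounded_linear_compose[OF bounded_linear_scaleR_left]
      bounded_linear_Re bounded_linear_Im)

definition Qinv :: "(('v::banach, 'n::{finite,linorder}) clifford_module \<rightharpoonup> ('v, 'n) clifford_module) \<Rightarrow>
    'n clifford \<Rightarrow> complex \<Rightarrow> ('v, 'n) module_op" where
  "Qinv T J z = Q_inv (embed J z) T"

text \<open>\<open>Blinfun\<close> gives the intended operator only where the composition is
  bounded, which \<open>TQinv_apply\<close> establishes off the closed bisector.\<close>

definition TQinv :: "(('v::banach, 'n::{finite,linorder}) clifford_module \<rightharpoonup> ('v, 'n) clifford_module) \<Rightarrow>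
    'n clifford \<Rightarrow> complex \<Rightarrow> ('v, 'n) module_op" where
  "TQinv T J z = Blinfun (\<lambda>v. the (T (blinfun_apply (Qinv T J z) v)))"

text \<open>\<open>(z - T)\<inverse>\<close> for the complex structure on the module given by right multiplication with \<open>J\<close>.\<close>

definition cresolvent :: "(('v::banach, 'n::{finite,linorder}) clifford_module \<rightharpoonup> ('v, 'n) clifford_module) \<Rightarrow>
    'n clifford \<Rightarrow> complex \<Rightarrow> ('v, 'n) module_op" where
  "cresolvent T J z = (rscale J (cnj z) o\<^sub>L Qinv T J z) - TQinv T J z"

lemma exp_Complex: "exp (Complex u \<alpha>) = exp u *\<^sub>R cis \<alpha>"
  by (simp add: exp_eq_polar scaleR_conv_of_real)

text \<open>For \<open>t > 0\<close> the path runs outward on the ray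
  \<open>\<epsilon> = -1\<close>. The case \<open>t < 0\<close>, inward on the ray
  \<open>\<epsilon> = 1\<close>, is \<open>sector_path_neg\<close>; the direction explains the minus
  sign of the derivative there.\<close>

lemma sector_path_pos:
  assumes I: "I \<in> unit_sphere"
  shows "sector_path \<sigma> \<phi> I (exp u) = embed I (ray_point \<phi> \<sigma> (- 1) u)"
    "vector_derivative (sector_path \<sigma> \<phi> I) (at (exp u)) = embed I (of_real \<sigma> * cis (- \<phi>))"
proof -
  show "sector_path \<sigma> \<phi> I (exp u) = embed I (ray_point \<phi> \<sigma> (- 1) u)"
    by (simp add: sector_path_def ray_point_def exp_Complex slice_cis_embed[OF I] flip: embed_linear)
       (simp add: scaleR_conv_of_real mult_ac)
  have "((\<lambda>t. t *\<^sub>R (\<sigma> *\<^sub>R slice_cis I (- \<phi>))) has_vector_derivative \<sigma> *\<^sub>R slice_cis I (- \<phi>)) (at (exp u))"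
    by (auto intro!: derivative_eq_intros)
  then have "(sector_path \<sigma> \<phi> I has_vector_derivative \<sigma> *\<^sub>R slice_cis I (- \<phi>)) (at (exp u))"
    by (rule has_vector_derivative_transform_within_open[where S = "{0<..}"])
       (auto simp: sector_path_def mult.commute)
  moreover have "\<sigma> *\<^sub>R slice_cis I (- \<phi>) = embed I (of_real \<sigma> * cis (- \<phi>))"
    using embed_linear(5)[of I \<sigma> "cis (- \<phi>)"] by (simp add: slice_cis_embed[OF I] scaleR_conv_of_real)
  ultimately show "vector_derivative (sector_path \<sigma> \<phi> I) (at (exp u)) = embed I (of_real \<sigma> * cis (- \<phi>))"
    by (simp add: vector_derivative_at)
qed

lemma sector_path_neg:
  assumes I: "I \<in> unit_sphere"
  shows "sector_path \<sigma> \<phi> I (- exp u) = embed I (ray_point \<phi> \<sigma> 1 u)"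
    "vector_derivative (sector_path \<sigma> \<phi> I) (at (- exp u)) = embed I (- of_real \<sigma> * cis \<phi>)"
proof -
  show "sector_path \<sigma> \<phi> I (- exp u) = embed I (ray_point \<phi> \<sigma> 1 u)"
    by (simp add: sector_path_def ray_point_def exp_Complex slice_cis_embed[OF I] flip: embed_linear)
       (simp add: scaleR_conv_of_real mult_ac)
  have "((\<lambda>t. t *\<^sub>R (- \<sigma> *\<^sub>R slice_cis I \<phi>)) has_vector_derivative - \<sigma> *\<^sub>R slice_cis I \<phi>) (at (- exp u))"
    by (auto intro!: derivative_eq_intros)
  then have "(sector_path \<sigma> \<phi> I has_vector_derivative - \<sigma> *\<^sub>R slice_cis I \<phi>) (at (- exp u))"
    by (rule has_vector_derivative_transform_within_open[where S = "{..<0}"])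
       (auto simp: sector_path_def mult.commute)
  moreover have "- \<sigma> *\<^sub>R slice_cis I \<phi> = embed I (- of_real \<sigma> * cis \<phi>)"
    using embed_linear(5)[of I "- \<sigma>" "cis \<phi>"] by (simp add: slice_cis_embed[OF I] scaleR_conv_of_real)
  ultimately show "vector_derivative (sector_path \<sigma> \<phi> I) (at (- exp u)) = embed I (- of_real \<sigma> * cis \<phi>)"
    by (simp add: vector_derivative_at)
qed

context
  fixes T :: "('v::banach, 'n::{finite,linorder}) clifford_module \<rightharpoonup> ('v, 'n) clifford_module"
    and \<omega> :: real
  assumes om: "0 < \<omega>" "\<omega> < pi / 2" and T: "bisectorial \<omega> T"
begin

lemma T_closed: "T \<in> closed_ops"
  using T by (simp add: bisectorial_def)

lemmas TD = closed_opsD[OF T_closed]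

abbreviation opT where "opT v \<equiv> the (T v)"

abbreviation outside where "outside z \<equiv> \<bar>Re z\<bar> * sin \<omega> < \<bar>Im z\<bar> * cos \<omega>"

text \<open>\<open>Q_op s T\<close> depends on \<open>s\<close> only through its scalar part and its
  norm.\<close>

lemma Qinv_independent:
  assumes "J \<in> unit_sphere" "I \<in> unit_sphere"
  shows "Qinv T J z = Qinv T I z" "Qinv T J (cnj z) = Qinv T J z"
proof -
  have "Q_op (embed J z) T = Q_op (embed I z) T" "Q_op (embed J (cnj z)) T = Q_op (embed J z) T"
    by (simp_all add: Q_op_def fun_eq_iff embed_nth_empty[OF assms(1)] embed_nth_empty[OF assms(2)]
        norm_embed[OF assms(1)] norm_embed[OF assms(2)])
  then show "Qinv T J z = Qinv T I z" "Qinv T J (cnj z) = Qinv T J z" by (simp_all add: Qinv_def Q_inv_def)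
qed

lemma TQinv_independent:
  assumes "J \<in> unit_sphere" "I \<in> unit_sphere"
  shows "TQinv T J z = TQinv T I z" "TQinv T J (cnj z) = TQinv T J z"
  unfolding TQinv_def using Qinv_independent[OF assms] by simp_all

context
  fixes J :: "'n clifford"
  assumes J: "J \<in> unit_sphere"
begin

abbreviation "opQ z v \<equiv> blinfun_apply (Qinv T J z) v"

lemma Qinv_inverse:
  assumes z: "outside z"
  shows "is_inverse_op (Q_op (embed J z) T) (Qinv T J z)" and "Qinv T J z \<in> bounded_ops"
proof -
  have "embed J z \<notin> closure (double_sector \<omega>)"
  proof
    assume "embed J z \<in> closure (double_sector \<omega>)"
    then have "norm (embed J z - (embed J z $ {}) *\<^sub>R cl_one) * cos \<omega> \<le> \<bar>embed J z $ {}\<bar> * sin \<omega>"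
      using closure_double_sector_subset[OF om] by blast
    then show False using z unfolding norm_embed_imaginary[OF J] unfolding embed_nth_empty[OF J] by simp
  qed
  then have "embed J z \<in> S_resolvent_set T"
    using T embed_paravector[OF J] unfolding bisectorial_def S_spectrum_def by blast
  then obtain B where B: "B \<in> bounded_ops" "is_inverse_op (Q_op (embed J z) T) B"
    unfolding S_resolvent_set_def by blast
  have "B' = B" if "is_inverse_op (Q_op (embed J z) T) B'" for B'
    using that B(2) unfolding is_inverse_op_def by (intro blinfun_eqI) metis
  then have "Qinv T J z = B" unfolding Qinv_def Q_inv_def using B(2) by (intro the_equality)
  then show "is_inverse_op (Q_op (embed J z) T) (Qinv T J z)" and "Qinv T J z \<in> bounded_ops" using B by auto
qed

lemma Q_facts:
  assumes z: "outside z"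
  shows "opQ z v \<in> dom T" "opT (opQ z v) \<in> dom T"
    "opT (opT (opQ z v)) - (2 * Re z) *\<^sub>R opT (opQ z v) + (norm z)\<^sup>2 *\<^sub>R opQ z v = v"
    "v \<in> dom T \<Longrightarrow> opT v \<in> dom T \<Longrightarrow> opQ z (opT (opT v) - (2 * Re z) *\<^sub>R opT v + (norm z)\<^sup>2 *\<^sub>R v) = v"
    "opQ z (rmul v a) = rmul (opQ z v) a"
proof -
  have inv: "Q_op (embed J z) T v = Some w \<longleftrightarrow> v = opQ z w" for v w
    using Qinv_inverse(1)[OF z] unfolding is_inverse_op_def by blast
  have "Q_op (embed J z) T (opQ z v) = Some v" by (simp add: inv)
  then show "opQ z v \<in> dom T" "opT (opQ z v) \<in> dom T"
    "opT (opT (opQ z v)) - (2 * Re z) *\<^sub>R opT (opQ z v) + (norm z)\<^sup>2 *\<^sub>R opQ z v = v"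
    unfolding Q_op_eq_Some_iff by (simp_all add: embed_nth_empty[OF J] norm_embed[OF J])
  show "opQ z (opT (opT v) - (2 * Re z) *\<^sub>R opT v + (norm z)\<^sup>2 *\<^sub>R v) = v" if "v \<in> dom T" "opT v \<in> dom T"
    using that inv[of v "opT (opT v) - (2 * Re z) *\<^sub>R opT v + (norm z)\<^sup>2 *\<^sub>R v"] unfolding Q_op_eq_Some_iff by (simp add: embed_nth_empty[OF J] norm_embed[OF J])
  show "opQ z (rmul v a) = rmul (opQ z v) a"
    using Qinv_inverse(2)[OF z] by (simp add: bounded_ops_def)
qed

lemma SL_resolvent_embed:
  "SL_resolvent (embed J z) T v = opQ z (lmul (embed J (cnj z)) v) - opT (opQ z v)"
  by (simp add: SL_resolvent_def Qinv_def cl_cnj_embed[OF J])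

lemma SL_bound:
  assumes "\<omega> < \<phi>" "\<phi> < pi / 2"
  obtains C where "C \<ge> 0" "\<And>z v. z \<noteq> 0 \<Longrightarrow> z \<notin> bisector \<phi> \<Longrightarrow>
    norm (SL_resolvent (embed J z) T v) \<le> C / norm z * norm v"
proof -
  obtain C where C: "C \<ge> 0" "\<And>s v. s \<in> paravectors - (double_sector \<phi> \<union> {0}) \<Longrightarrow>
      norm (SL_resolvent s T v) \<le> C / norm s * norm v"
    using T assms unfolding bisectorial_def by force
  have "norm (SL_resolvent (embed J z) T v) \<le> C / norm z * norm v" if "z \<noteq> 0" "z \<notin> bisector \<phi>" for z v
  proof -
    have "embed J z \<noteq> 0" using norm_embed[OF J, of z] that by auto
    then show ?thesis
      using C(2)[of "embed J z" v] that assms om embed_paravector[OF J] norm_embed[OF J]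
        embed_in_double_sector_iff[OF _ _ J] by simp
  qed
  with C(1) show ?thesis by (rule that)
qed

text \<open>Boundedness holds because \<open>T Q\<^sub>z[T]\<inverse>\<close> is the difference of
  the operator \<open>Q\<^sub>z[T]\<inverse> cnj z\<close> and the left S-resolvent, both of which
  are bounded.\<close>

lemma TQinv_apply:
  assumes z: "outside z"
  shows "blinfun_apply (TQinv T J z) v = opT (opQ z v)"
proof -
  obtain \<phi> where ph: "\<omega> < \<phi>" "\<phi> < pi / 2" "\<bar>Re z\<bar> * sin \<phi> < \<bar>Im z\<bar> * cos \<phi>"
    by (rule outside_bisector_margin[OF om(2) z])
  then have z': "z \<noteq> 0" "z \<notin> bisector \<phi>" by (auto simp: bisector_def)
  obtain C where C: "\<And>v. norm (SL_resolvent (embed J z) T v) \<le> C / norm z * norm v"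
    using SL_bound[OF ph(1,2)] z' by metis
  have "bounded_linear (\<lambda>v. opT (opQ z v))"
  proof (rule bounded_linear_intro)
    fix v w and r :: real
    show "opT (opQ z (v + w)) = opT (opQ z v) + opT (opQ z w)" "opT (opQ z (r *\<^sub>R v)) = r *\<^sub>R opT (opQ z v)"
      using Q_facts(1)[OF z] by (simp_all add: blinfun.add_right blinfun.scaleR_right TD)
    have "opT (opQ z v) = opQ z (lmul (embed J (cnj z)) v) - SL_resolvent (embed J z) T v"
      by (simp add: SL_resolvent_embed)
    also have "norm \<dots> \<le> norm (blinfun_apply (Qinv T J z o\<^sub>L lscale J (cnj z)) v) + norm (SL_resolvent (embed J z) T v)"
      using norm_triangle_ineq4 by (simp add: lscale_apply)
    also have "\<dots> \<le> norm (Qinv T J z o\<^sub>L lscale J (cnj z)) * norm v + C / norm z * norm v"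
      by (intro add_mono norm_blinfun C)
    finally show "norm (opT (opQ z v)) \<le> norm v * (norm (Qinv T J z o\<^sub>L lscale J (cnj z)) + C / norm z)"
      by (simp add: algebra_simps)
  qed
  then show ?thesis by (simp add: TQinv_def bounded_linear_Blinfun_apply)
qed

text \<open>
  The difference of \<open>S\<^sub>L\<inverse>\<close> at the conjugate of \<open>s\<close> and at \<open>s\<close> is \<open>Q\<^sub>s[T]\<inverse> (s - cnj s)\<close>, and off the bisector the
  imaginary part of \<open>s\<close> is comparable to \<open>\<bar>s\<bar>\<close>.
\<close>

lemma Qinv_TQinv_bound:
  assumes ph: "\<omega> < \<phi>" "\<phi> < pi / 2"
  obtains M where "M \<ge> 0" "\<And>z. z \<noteq> 0 \<Longrightarrow> z \<notin> bisector \<phi> \<Longrightarrow> norm (Qinv T J z) \<le> M / (norm z)\<^sup>2"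
    "\<And>z. z \<noteq> 0 \<Longrightarrow> z \<notin> bisector \<phi> \<Longrightarrow> norm (TQinv T J z) \<le> M / norm z"
proof -
  obtain C where C: "C \<ge> 0" "\<And>z v. z \<noteq> 0 \<Longrightarrow> z \<notin> bisector \<phi> \<Longrightarrow>
    norm (SL_resolvent (embed J z) T v) \<le> C / norm z * norm v"
    using SL_bound[OF ph] by metis
  obtain K where K: "K > 0" "\<And>a (v :: ('v, 'n) clifford_module). norm (lmul a v) \<le> norm a * norm v * K"
    using lmul.pos_bounded by metis
  have sp: "0 < sin \<phi>" using ph om by (intro sin_gt_zero) auto
  define M1 where "M1 = C * K / sin \<phi>"
  have M1: "0 \<le> M1" using C K sp by (simp add: M1_def)
  have nQ: "norm (opQ z v) \<le> M1 / (norm z)\<^sup>2 * norm v" if z: "z \<noteq> 0" "z \<notin> bisector \<phi>" for z v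
  proof -
    \<comment> \<open>The solution of \<open>J u = v\<close>, so that \<open>z - cnj z\<close>
      applied to \<open>u\<close> from the left is \<open>2 * Im z\<close> times
      \<open>v\<close>.\<close>
    define u where "u = - lmul J v"
    have u: "lmul J u = v" by (simp add: u_def lmul.minus_right lmul_unit_sphere_square[OF J])
    have nu: "norm u \<le> norm v * K" using K(2)[of J v] unit_sphereD(2)[OF J] by (simp add: u_def)
    have cz: "cnj z \<noteq> 0" "cnj z \<notin> bisector \<phi>" using z by auto
    have "SL_resolvent (embed J (cnj z)) T u - SL_resolvent (embed J z) T u
        = opQ z (lmul (embed J z) u - lmul (embed J (cnj z)) u)"
      using Qinv_independent(2)[OF J J, of z] by (simp add: SL_resolvent_embed blinfun.diff_right)
    also have "lmul (embed J z) u - lmul (embed J (cnj z)) u = (2 * Im z) *\<^sub>R v"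
      by (simp add: lmul_embed u scaleR_add_left[symmetric])
    finally have "(2 * Im z) *\<^sub>R opQ z v = SL_resolvent (embed J (cnj z)) T u - SL_resolvent (embed J z) T u"
      by (simp add: blinfun.scaleR_right)
    then have "2 * \<bar>Im z\<bar> * norm (opQ z v) = norm (SL_resolvent (embed J (cnj z)) T u - SL_resolvent (embed J z) T u)"
      by (metis abs_mult abs_numeral norm_scaleR)
    also have "\<dots> \<le> C / norm z * norm u + C / norm z * norm u"
      using C(2)[OF cz, of u] C(2)[OF z, of u] by (intro order_trans[OF norm_triangle_ineq4] add_mono) auto
    finally have "\<bar>Im z\<bar> * norm (opQ z v) \<le> C / norm z * norm u" by simp
    also have "\<dots> \<le> C / norm z * (norm v * K)" using nu C by (intro mult_left_mono) auto
    finally have *: "\<bar>Im z\<bar> * norm (opQ z v) \<le> C / norm z * (norm v * K)" .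
    have "sin \<phi> * norm z * norm (opQ z v) \<le> \<bar>Im z\<bar> * norm (opQ z v)"
      using not_in_bisectorD(2)[OF z om(1) ph] by (intro mult_right_mono) auto
    with * have "sin \<phi> * norm z * norm (opQ z v) \<le> C / norm z * (norm v * K)" by linarith
    then have "norm (opQ z v) \<le> C / norm z * (norm v * K) / (sin \<phi> * norm z)"
      using sp z by (simp add: pos_le_divide_eq mult_ac)
    also have "\<dots> = M1 / (norm z)\<^sup>2 * norm v" by (simp add: M1_def power2_eq_square mult_ac)
    finally show ?thesis .
  qed
  define M where "M = M1 + (M1 * K + C)"
  have M: "0 \<le> M" "M1 \<le> M" "M1 * K + C \<le> M" using M1 K C by (auto simp: M_def)
  show ?thesis
  proof (rule that[OF M(1)])
    fix z assume z: "z \<noteq> 0" "z \<notin> bisector \<phi>"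
    have oz: "outside z" by (rule not_in_bisectorD(1)[OF z om(1) ph])
    have le: "M1 / (norm z)\<^sup>2 \<le> M / (norm z)\<^sup>2" "(M1 * K + C) / norm z \<le> M / norm z"
      using M by (auto intro: divide_right_mono)
    show "norm (Qinv T J z) \<le> M / (norm z)\<^sup>2"
    proof (rule norm_blinfun_bound)
      fix v show "norm (opQ z v) \<le> M / (norm z)\<^sup>2 * norm v"
        using nQ[OF z, of v] mult_right_mono[OF le(1) norm_ge_zero[of v]] by linarith
    qed (use M in auto)
    show "norm (TQinv T J z) \<le> M / norm z"
    proof (rule norm_blinfun_bound)
      fix v
      have "blinfun_apply (TQinv T J z) v = opQ z (lmul (embed J (cnj z)) v) - SL_resolvent (embed J z) T v"
        by (simp add: TQinv_apply[OF oz] SL_resolvent_embed)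
      also have "norm \<dots> \<le> M1 / (norm z)\<^sup>2 * (norm z * norm v * K) + C / norm z * norm v"
      proof (intro order_trans[OF norm_triangle_ineq4] add_mono C(2) z order_trans[OF nQ] mult_left_mono)
        show "norm (lmul (embed J (cnj z)) v) \<le> norm z * norm v * K"
          using K(2)[of "embed J (cnj z)" v] by (simp add: norm_embed[OF J])
      qed (use M1 in auto)
      also have "\<dots> = (M1 * K + C) / norm z * norm v"
        using z by (simp add: field_simps power2_eq_square)
      also have "\<dots> \<le> M / norm z * norm v" using le by (intro mult_right_mono) auto
      finally show "norm (blinfun_apply (TQinv T J z) v) \<le> M / norm z * norm v" .
    qed (use M in auto)
  qed
qed

lemma cresolvent_apply:
  assumes "outside z"
  shows "blinfun_apply (cresolvent T J z) v = rmul (opQ z v) (embed J (cnj z)) - opT (opQ z v)"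
  by (simp add: cresolvent_def blinfun.diff_left rscale_apply TQinv_apply[OF assms])

text \<open>Limited to the slice of \<open>J\<close>: \<open>rscale J\<close> need not commute with
  right multiplication by other Clifford numbers.\<close>

lemma cresolvent_commute:
  assumes "outside z"
  shows "blinfun_apply (cresolvent T J z) (rmul v (embed J a)) = rmul (blinfun_apply (cresolvent T J z) v) (embed J a)"
  using Q_facts(1)[OF assms]
  by (simp add: cresolvent_apply[OF assms] Q_facts(5)[OF assms] TD rmul.diff_left rmul_embed_mult[OF J] mult.commute)

text \<open>Scalars acting from the right commute with \<open>T\<close>, so
  \<open>Q\<^sub>z[T] = (z - T) (cnj z - T)\<close>, and \<open>cresolvent\<close> is
  \<open>(cnj z - T) Q\<^sub>z[T]\<inverse>\<close>.\<close>

lemma cresolvent_right_inverse: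
  assumes z: "outside z"
  shows "blinfun_apply (cresolvent T J z) v \<in> dom T"
    "rmul (blinfun_apply (cresolvent T J z) v) (embed J z) - opT (blinfun_apply (cresolvent T J z) v) = v"
proof -
  note q = Q_facts(1-3)[OF z, of v]
  show "blinfun_apply (cresolvent T J z) v \<in> dom T" using q by (simp add: cresolvent_apply[OF z] TD)
  have r: "rmul (rmul (opQ z v) (embed J (cnj z))) (embed J z) = (norm z)\<^sup>2 *\<^sub>R opQ z v"
    using rmul_embed_mult[OF J, of "opQ z v" "cnj z" z]
    by (simp add: complex_norm_square[symmetric] embed_linear rmul.scaleR_right flip: of_real_power)
  have s: "rmul (opT (opQ z v)) (embed J z) + rmul (opT (opQ z v)) (embed J (cnj z)) = (2 * Re z) *\<^sub>R opT (opQ z v)"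
    by (simp add: rmul_embed scaleR_add_left[symmetric])
  have "rmul (blinfun_apply (cresolvent T J z) v) (embed J z) - opT (blinfun_apply (cresolvent T J z) v)
     = (norm z)\<^sup>2 *\<^sub>R opQ z v - (rmul (opT (opQ z v)) (embed J z) + rmul (opT (opQ z v)) (embed J (cnj z))) + opT (opT (opQ z v))"
    using q by (simp add: cresolvent_apply[OF z] TD rmul.diff_left r)
  also have "\<dots> = v" unfolding s using q(3) by (simp add: algebra_simps)
  finally show "rmul (blinfun_apply (cresolvent T J z) v) (embed J z) - opT (blinfun_apply (cresolvent T J z) v) = v" .
qed

text \<open>An eigenvector satisfies \<open>Q\<^sub>z[T] v = v (z\<^sup>2 - 2 (Re z) z +
  \<bar>z\<bar>\<^sup>2) = 0\<close>, because \<open>z\<close> is a root of this real polynomial,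
  and \<open>Q\<^sub>z[T]\<close> is injective.\<close>

lemma z_minus_T_injective:
  assumes z: "outside z" and v: "v \<in> dom T" "rmul v (embed J z) - opT v = 0"
  shows "v = 0"
proof -
  have tv: "opT v = rmul v (embed J z)" using v by simp
  then have tvd: "opT v \<in> dom T" using TD(4)[OF v(1)] by simp
  have ttv: "opT (opT v) = rmul v (embed J (z * z))"
    using TD(6)[OF v(1), of "embed J z"] tv by (simp add: rmul_embed_mult[OF J])
  have "opT (opT v) - (2 * Re z) *\<^sub>R opT v + (norm z)\<^sup>2 *\<^sub>R v
      = rmul v (embed J (z * z - (2 * Re z) *\<^sub>R z + of_real ((norm z)\<^sup>2)))"
    unfolding ttv unfolding tv
    by (simp only: embed_linear rmul.add_right rmul.diff_right rmul.scaleR_right rmul_one)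
  also have "z * z - (2 * Re z) *\<^sub>R z + of_real ((norm z)\<^sup>2) = 0"
    by (simp add: complex_eq_iff cmod_power2) (simp add: power2_eq_square algebra_simps)
  finally have "opT (opT v) - (2 * Re z) *\<^sub>R opT v + (norm z)\<^sup>2 *\<^sub>R v = 0"
    by (simp add: embed_linear rmul.zero_right)
  then show ?thesis using Q_facts(4)[OF z v(1) tvd] by (simp add: blinfun.zero_right)
qed

lemma cresolvent_left_inverse:
  assumes z: "outside z" and v: "v \<in> dom T"
  shows "blinfun_apply (cresolvent T J z) (rmul v (embed J z) - opT v) = v"
proof -
  let ?u = "blinfun_apply (cresolvent T J z) (rmul v (embed J z) - opT v)"
  note r = cresolvent_right_inverse[OF z, of "rmul v (embed J z) - opT v"]
  have "?u - v = 0"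
  proof (rule z_minus_T_injective[OF z])
    show "?u - v \<in> dom T" using r(1) v by (simp add: TD)
    show "rmul (?u - v) (embed J z) - opT (?u - v) = 0"
      using r v by (simp add: TD rmul.diff_left algebra_simps)
  qed
  then show ?thesis by simp
qed

lemma cresolvent_resolvent:
  assumes z: "outside z" and w: "outside w"
  shows "cresolvent T J z - cresolvent T J w = rscale J (w - z) o\<^sub>L (cresolvent T J z o\<^sub>L cresolvent T J w)"
proof (rule blinfun_eqI)
  fix v
  define y where "y = blinfun_apply (cresolvent T J w) v"
  have y: "y \<in> dom T" "rmul y (embed J w) - opT y = v"
    using cresolvent_right_inverse[OF w] by (simp_all add: y_def)
  have "rmul y (embed J z) - opT y = v - rmul y (embed J (w - z))"
    using y(2) by (simp add: embed_linear rmul.diff_right algebra_simps)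
  then have "blinfun_apply (cresolvent T J z) (v - rmul y (embed J (w - z))) = y"
    using cresolvent_left_inverse[OF z y(1)] by simp
  then have "blinfun_apply (cresolvent T J z) v - rmul (blinfun_apply (cresolvent T J z) y) (embed J (w - z)) = y"
    by (simp add: blinfun.diff_right cresolvent_commute[OF z])
  then show "blinfun_apply (cresolvent T J z - cresolvent T J w) v = blinfun_apply (rscale J (w - z) o\<^sub>L (cresolvent T J z o\<^sub>L cresolvent T J w)) v"
    by (simp add: blinfun.diff_left rscale_apply y_def algebra_simps)
qed

lemma bisectorial_resolvent_cresolvent:
  "bisectorial_resolvent (\<lambda>z X. rscale J z o\<^sub>L X) (o\<^sub>L) (cresolvent T J) \<omega>"
proof (rule bisectorial_resolvent.intro)
  show "bounded_bilinear (\<lambda>z (X :: ('v, 'n) module_op). rscale J z o\<^sub>L X)"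
    by (rule bounded_bilinear.comp1[OF bounded_bilinear_blinfun_compose bounded_linear_rscale])
  show "bounded_bilinear ((o\<^sub>L) :: ('v, 'n) module_op \<Rightarrow> _)"
    by (rule bounded_bilinear_blinfun_compose)
  show "rscale J (z * w) o\<^sub>L X = rscale J z o\<^sub>L (rscale J w o\<^sub>L X)"
    for z w and X :: "('v, 'n) module_op"
    by (rule blinfun_eqI) (simp add: rscale_apply rmul_embed_mult[OF J])
  show "rscale J 1 o\<^sub>L X = X" for X :: "('v, 'n) module_op"
    by (rule blinfun_eqI) (simp add: rscale_apply embed_linear)
  show "cresolvent T J z - cresolvent T J w = rscale J (w - z) o\<^sub>L (cresolvent T J z o\<^sub>L cresolvent T J w)" if "outside z" "outside w" for z w
    by (rule cresolvent_resolvent[OF that])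
  show "rscale J a o\<^sub>L cresolvent T J z o\<^sub>L (rscale J b o\<^sub>L cresolvent T J w) = rscale J (a * b) o\<^sub>L (cresolvent T J z o\<^sub>L cresolvent T J w)"
    if "outside z" "outside w" for z w a b
    by (rule blinfun_eqI) (simp add: rscale_apply cresolvent_commute[OF that(1)] rmul_embed_mult[OF J])
  fix \<phi> assume ph: "\<omega> < \<phi>" "\<phi> < pi / 2"
  obtain M where M: "M \<ge> 0" "\<And>z. z \<noteq> 0 \<Longrightarrow> z \<notin> bisector \<phi> \<Longrightarrow> norm (Qinv T J z) \<le> M / (norm z)\<^sup>2"
    "\<And>z. z \<noteq> 0 \<Longrightarrow> z \<notin> bisector \<phi> \<Longrightarrow> norm (TQinv T J z) \<le> M / norm z"
    using Qinv_TQinv_bound[OF ph] by metis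
  obtain K where K: "K > 0" "\<And>z. norm (rscale J z :: ('v, 'n) module_op) \<le> norm z * K"
    using bounded_linear.pos_bounded[OF bounded_linear_rscale] by metis
  have "norm (cresolvent T J z) \<le> (K * M + M) / norm z" if z: "z \<noteq> 0" "z \<notin> bisector \<phi>" for z
  proof -
    have "norm (cresolvent T J z) \<le> norm (rscale J (cnj z) :: ('v, 'n) module_op) * norm (Qinv T J z) + norm (TQinv T J z)"
      unfolding cresolvent_def by (intro order_trans[OF norm_triangle_ineq4] add_mono norm_blinfun_compose order_refl)
    also have "\<dots> \<le> (norm z * K) * (M / (norm z)\<^sup>2) + M / norm z"
      using K(2)[of "cnj z"] K(1) M(2,3)[OF z] by (intro add_mono mult_mono) auto
    also have "\<dots> = (K * M + M) / norm z" using z by (simp add: field_simps power2_eq_square)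
    finally show ?thesis .
  qed
  then show "\<exists>M. \<forall>z. z \<noteq> 0 \<longrightarrow> z \<notin> bisector \<phi> \<longrightarrow> norm (cresolvent T J z) \<le> M / norm z" by blast
qed (rule om)+

interpretation R: bisectorial_resolvent "\<lambda>z X. rscale J z o\<^sub>L X" "(o\<^sub>L)" "cresolvent T J" \<omega>
  by (rule bisectorial_resolvent_cresolvent)

text \<open>The integrand of the calculus with coefficient \<open>c\<close>. Since
  \<open>Qinv\<close> and \<open>TQinv\<close> do not depend on the unit, \<open>I\<close> enters
  through the left scalars only.\<close>

definition calc_op :: "'n clifford \<Rightarrow> complex \<Rightarrow> complex \<Rightarrow> ('v, 'n) module_op" where
  "calc_op I z c = (Qinv T J z o\<^sub>L lscale I (cnj z * c)) - (TQinv T J z o\<^sub>L lscale I c)"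

lemma SL_resolvent_calc_op:
  assumes I: "I \<in> unit_sphere" and z: "outside z"
  shows "Blinfun (\<lambda>v. SL_resolvent (embed I z) T (lmul (embed I c) v)) = calc_op I z c"
proof -
  have "SL_resolvent (embed I z) T (lmul (embed I c) v) = blinfun_apply (calc_op I z c) v" for v
    using Qinv_independent[OF I J, of z]
    by (simp add: calc_op_def SL_resolvent_def blinfun.diff_left lscale_apply TQinv_apply[OF z]
        lmul_embed_mult[OF I] cl_cnj_embed[OF I] Qinv_def)
  then show ?thesis by (simp add: blinfun_apply_inverse)
qed

lemma calc_op_scaleR: "calc_op I z (r *\<^sub>R c) = r *\<^sub>R calc_op I z c"
  by (rule blinfun_eqI)
     (simp add: calc_op_def blinfun.diff_left blinfun.scaleR_left lscale_apply embed_linear lmul.scaleR_left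
       blinfun.scaleR_right scaleR_diff_right)

text \<open>
  At two conjugate points only real scalars survive on both sides, so that left multiplication with
  the imaginary unit \<open>I\<close> may be exchanged for right multiplication with \<open>J\<close>.
\<close>

lemma calc_op_pair:
  assumes z: "outside z"
  shows "calc_op I z c + calc_op I (cnj z) (cnj c) = (rscale J c o\<^sub>L cresolvent T J z) + (rscale J (cnj c) o\<^sub>L cresolvent T J (cnj z))"
proof (rule blinfun_eqI)
  fix v :: "('v, 'n) clifford_module"
  have l: "lmul (embed I a) v + lmul (embed I (cnj a)) v = (2 * Re a) *\<^sub>R v" for a
    by (simp add: lmul_embed scaleR_add_left[symmetric])
  have r: "rmul w (embed J a) + rmul w (embed J (cnj a)) = (2 * Re a) *\<^sub>R w"
    for a and w :: "('v, 'n) clifford_module"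
    by (simp add: rmul_embed scaleR_add_left[symmetric])
  have z': "outside (cnj z)" using z by simp
  have Tlin: "opT (opQ z x + opQ z y) = opT (opQ z x) + opT (opQ z y)" "opT (r *\<^sub>R opQ z x) = r *\<^sub>R opT (opQ z x)" for x y r
    using Q_facts(1)[OF z] by (simp_all add: blinfun.add_right blinfun.scaleR_right TD)
  have "blinfun_apply (calc_op I z c + calc_op I (cnj z) (cnj c)) v
      = opQ z (lmul (embed I (cnj z * c)) v + lmul (embed I (cnj (cnj z * c))) v)
        - opT (opQ z (lmul (embed I c) v + lmul (embed I (cnj c)) v))"
    using Qinv_independent(2)[OF J J, of z] TQinv_independent(2)[OF J J, of z]
    by (simp add: calc_op_def blinfun.add_left blinfun.diff_left lscale_apply TQinv_apply[OF z] blinfun.add_right Tlin(1))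
  also have "\<dots> = (2 * Re (cnj z * c)) *\<^sub>R opQ z v - (2 * Re c) *\<^sub>R opT (opQ z v)"
    unfolding l by (simp add: blinfun.scaleR_right Tlin(2))
  also have "\<dots> = (rmul (opQ z v) (embed J (cnj z * c)) + rmul (opQ z v) (embed J (cnj (cnj z * c))))
      - (rmul (opT (opQ z v)) (embed J c) + rmul (opT (opQ z v)) (embed J (cnj c)))"
    unfolding r ..
  also have "\<dots> = blinfun_apply ((rscale J c o\<^sub>L cresolvent T J z) + (rscale J (cnj c) o\<^sub>L cresolvent T J (cnj z))) v"
    using Qinv_independent(2)[OF J J, of z]
    by (simp add: blinfun.add_left rscale_apply cresolvent_apply[OF z] cresolvent_apply[OF z'] rmul.diff_left
        rmul_embed_mult[OF J] mult.commute)
  finally show "blinfun_apply (calc_op I z c + calc_op I (cnj z) (cnj c)) v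
      = blinfun_apply ((rscale J c o\<^sub>L cresolvent T J z) + (rscale J (cnj c) o\<^sub>L cresolvent T J (cnj z))) v" .
qed

text \<open>The values at \<open>z\<close> and \<open>cnj z\<close> determine both operators, as
  \<open>R(cnj z) - R(z)\<close> is \<open>Q\<^sub>z[T]\<inverse>\<close> times
  \<open>z - cnj z\<close>. In this way continuity passes from the resolvent to them.\<close>

lemma Qinv_TQinv_from_cresolvent:
  assumes z: "outside z"
  shows "Qinv T J z = (- 1 / (2 * Im z)) *\<^sub>R (rscale J \<i> o\<^sub>L (cresolvent T J (cnj z) - cresolvent T J z))"
    and "TQinv T J z = (rscale J (cnj z) o\<^sub>L Qinv T J z) - cresolvent T J z"
proof -
  have "0 \<le> \<bar>Re z\<bar> * sin \<omega>" using om sin_gt_zero[of \<omega>] by simp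
  then have y: "Im z \<noteq> 0" using z by auto
  have z': "outside (cnj z)" using z by simp
  show "Qinv T J z = (- 1 / (2 * Im z)) *\<^sub>R (rscale J \<i> o\<^sub>L (cresolvent T J (cnj z) - cresolvent T J z))"
  proof (rule blinfun_eqI)
    fix v :: "('v, 'n) clifford_module"
    have "blinfun_apply (cresolvent T J (cnj z) - cresolvent T J z) v = (2 * Im z) *\<^sub>R rmul (opQ z v) J"
      using Qinv_independent(2)[OF J J, of z]
      by (simp add: blinfun.diff_left cresolvent_apply[OF z] cresolvent_apply[OF z'] rmul_embed scaleR_add_left[symmetric])
    then have "blinfun_apply (rscale J \<i> o\<^sub>L (cresolvent T J (cnj z) - cresolvent T J z)) v = - ((2 * Im z) *\<^sub>R opQ z v)"
      by (simp add: rscale_apply embed_linear rmul.scaleR_left rmul_unit_sphere_square[OF J])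
    then show "opQ z v = blinfun_apply ((- 1 / (2 * Im z)) *\<^sub>R (rscale J \<i> o\<^sub>L (cresolvent T J (cnj z) - cresolvent T J z))) v"
      using y by (simp add: blinfun.scaleR_left blinfun.minus_left)
  qed
  show "TQinv T J z = (rscale J (cnj z) o\<^sub>L Qinv T J z) - cresolvent T J z" by (simp add: cresolvent_def)
qed

lemma norm_calc_op_le:
  assumes ph: "\<omega> < \<phi>" "\<phi> < pi / 2"
  obtains C where "C \<ge> 0" "\<And>z a. z \<noteq> 0 \<Longrightarrow> z \<notin> bisector \<phi> \<Longrightarrow> norm (calc_op I z (a * z)) \<le> C * norm a"
proof -
  obtain M where M: "M \<ge> 0" "\<And>z. z \<noteq> 0 \<Longrightarrow> z \<notin> bisector \<phi> \<Longrightarrow> norm (Qinv T J z) \<le> M / (norm z)\<^sup>2"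
    "\<And>z. z \<noteq> 0 \<Longrightarrow> z \<notin> bisector \<phi> \<Longrightarrow> norm (TQinv T J z) \<le> M / norm z"
    using Qinv_TQinv_bound[OF ph] by metis
  obtain K where K: "K > 0" "\<And>z. norm (lscale I z :: ('v, 'n) module_op) \<le> norm z * K"
    using bounded_linear.pos_bounded[OF bounded_linear_lscale] by metis
  show ?thesis
  proof (rule that[of "2 * (M * K)"])
    fix z a :: complex assume z: "z \<noteq> 0" "z \<notin> bisector \<phi>"
    have "norm (calc_op I z (a * z)) \<le> norm (Qinv T J z) * norm (lscale I (cnj z * (a * z)) :: ('v, 'n) module_op)
        + norm (TQinv T J z) * norm (lscale I (a * z) :: ('v, 'n) module_op)"
      unfolding calc_op_def by (intro order_trans[OF norm_triangle_ineq4] add_mono norm_blinfun_compose)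
    also have "\<dots> \<le> (M / (norm z)\<^sup>2) * (norm (cnj z * (a * z)) * K) + (M / norm z) * (norm (a * z) * K)"
      using M K z by (intro add_mono mult_mono) auto
    also have "\<dots> = 2 * (M * K) * norm a"
      using z by (simp add: norm_mult field_simps power2_eq_square)
    finally show "norm (calc_op I z (a * z)) \<le> 2 * (M * K) * norm a" .
  qed (use M K in auto)
qed

text \<open>The two rays of a half plane are conjugate and \<open>h\<close> commutes with
  conjugation, so \<open>calc_op_pair\<close> identifies the sums of the integrands \<open>X\<close>
  and \<open>Y\<close> pointwise; on a single ray they need not agree. \<open>I\<close> and
  \<open>J\<close> are unrelated, which gives independence of the imaginary unit.\<close>

lemma omega_calculus_eq_Op:
  assumes I: "I \<in> unit_sphere" and ph: "\<omega> < \<phi>" "\<phi> < \<theta>" and th: "\<theta> < pi / 2"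
    and h: "bisector_fun \<theta> h" and rep: "represents \<theta> h f"
  shows "omega_calculus \<phi> I T f = R.Op \<phi> h"
proof -
  have om_th: "\<omega> < \<theta>" and ph2: "\<phi> < pi / 2" and ph0: "0 < \<phi>" "0 < \<theta>" using ph th om by auto
  define k where "k \<sigma> t = Blinfun (\<lambda>v. SL_resolvent (sector_path \<sigma> \<phi> I t) T
    (lmul (lmul (lmul (vector_derivative (sector_path \<sigma> \<phi> I) (at t)) (- I)) (f (sector_path \<sigma> \<phi> I t))) v))" for \<sigma> t
  define X where "X p u = calc_op I (R.pt \<phi> p u) (R.coef \<phi> h p u)" for p u
  define Y where "Y p u = rscale J (R.coef \<phi> h p u) o\<^sub>L cresolvent T J (R.pt \<phi> p u)" for p u
  have mI: "- I = embed I (- \<i>)" by (simp add: embed_linear)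
  have out: "outside (R.pt \<phi> p u)" if "p \<in> R.signs" for p u
    using R.pt_Omega[OF om_th th that ph, of u] by (simp add: R.\<Omega>_def)
  have bis: "R.pt \<phi> p u \<in> bisector \<theta>" if "p \<in> R.signs" for p u
    unfolding R.pt_eq[OF om_th th]
    using exp_in_bisector_iff[of "fst p" "Complex u (snd p * \<phi>)" \<theta>] R.signs_D[OF om_th th that ph0(1)] ph th ph0
    by auto
  have fpt: "f (embed I (R.pt \<phi> p u)) = embed I (h (R.pt \<phi> p u))" if "p \<in> R.signs" for p u
    using rep I bis[OF that] by (simp add: represents_def)
  have sgn: "(\<sigma>, 1) \<in> R.signs" "(\<sigma>, -1) \<in> R.signs" if "\<sigma> \<in> {1, -1}" for \<sigma>
    using that by (auto simp: R.signs_def)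
  \<comment> \<open>The factor \<open>exp u\<close> of the substitution completes the tangent
    direction to \<open>z du\<close>; \<open>2 * pi\<close> compensates the normalisation in
    \<open>coef\<close>, whose \<open>1 / \<i>\<close> is the division by the unit.\<close>
  have kpos: "exp u *\<^sub>R k \<sigma> (exp u) = (2 * pi) *\<^sub>R X (\<sigma>, -1) u" if s: "\<sigma> \<in> {1, -1}" for \<sigma> u
  proof -
    let ?z = "ray_point \<phi> \<sigma> (-1) u"
    have "k \<sigma> (exp u) = calc_op I ?z (of_real \<sigma> * cis (- \<phi>) * (- \<i>) * h ?z)"
      unfolding k_def sector_path_pos[OF I] mI
      using SL_resolvent_calc_op[OF I, of ?z] out[OF sgn(2)[OF s], of u] fpt[OF sgn(2)[OF s], of u]
      by (simp add: embed_mult[OF I])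
    moreover have "exp u *\<^sub>R (of_real \<sigma> * cis (- \<phi>) * (- \<i>) * h ?z) = (2 * pi) *\<^sub>R R.coef \<phi> h (\<sigma>, -1) u"
      by (simp add: R.coef_def ray_point_def exp_Complex scaleR_conv_of_real field_simps)
    ultimately show ?thesis by (simp add: X_def flip: calc_op_scaleR)
  qed
  have kneg: "exp u *\<^sub>R k \<sigma> (- exp u) = (2 * pi) *\<^sub>R X (\<sigma>, 1) u" if s: "\<sigma> \<in> {1, -1}" for \<sigma> u
  proof -
    let ?z = "ray_point \<phi> \<sigma> 1 u"
    have "k \<sigma> (- exp u) = calc_op I ?z (- of_real \<sigma> * cis \<phi> * (- \<i>) * h ?z)"
      unfolding k_def sector_path_neg[OF I] mI
      using SL_resolvent_calc_op[OF I, of ?z] out[OF sgn(1)[OF s], of u] fpt[OF sgn(1)[OF s], of u]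
      by (simp add: embed_mult[OF I])
    moreover have "exp u *\<^sub>R (- of_real \<sigma> * cis \<phi> * (- \<i>) * h ?z) = (2 * pi) *\<^sub>R R.coef \<phi> h (\<sigma>, 1) u"
      by (simp add: R.coef_def ray_point_def exp_Complex scaleR_conv_of_real field_simps)
    ultimately show ?thesis by (simp add: X_def flip: calc_op_scaleR)
  qed
  have cnj_pt: "R.pt \<phi> (\<sigma>, -1) u = cnj (R.pt \<phi> (\<sigma>, 1) u)" for \<sigma> u
    by (simp add: ray_point_def exp_Complex cis_cnj)
  have cnj_coef: "R.coef \<phi> h (\<sigma>, -1) u = cnj (R.coef \<phi> h (\<sigma>, 1) u)" if s: "\<sigma> \<in> {1, -1}" for \<sigma> u
  proof -
    have "h (cnj (R.pt \<phi> (\<sigma>, 1) u)) = cnj (h (R.pt \<phi> (\<sigma>, 1) u))"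
      using rep bis[OF sgn(1)[OF s], of u] by (simp add: represents_def)
    then show ?thesis using cnj_pt[of \<sigma> u] by (simp add: R.coef_def)
  qed
  have pair: "X (\<sigma>, 1) u + X (\<sigma>, -1) u = Y (\<sigma>, 1) u + Y (\<sigma>, -1) u" if s: "\<sigma> \<in> {1, -1}" for \<sigma> u
    unfolding X_def Y_def cnj_pt cnj_coef[OF s] by (rule calc_op_pair[OF out[OF sgn(1)[OF s]]])
  \<comment> \<open>Recovering \<open>Qinv\<close> from the resolvent also involves the conjugate
    point, which is a point of the other ray \<open>q\<close> of the same half plane.\<close>
  have contX: "continuous_on UNIV (X p)" if p: "p \<in> R.signs" for p
  proof -
    define q where "q = (fst p, - snd p)"
    have q: "q \<in> R.signs" using p by (auto simp: q_def R.signs_def)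
    have cq: "cnj (R.pt \<phi> p u) = R.pt \<phi> q u" for u
      by (simp add: q_def ray_point_def exp_Complex cis_cnj)
    have cpt: "continuous_on UNIV (R.pt \<phi> p)" by (rule R.continuous_pt[OF om_th th])
    have im: "Im (R.pt \<phi> p u) \<noteq> 0" for u
    proof -
      have "0 \<le> \<bar>Re (R.pt \<phi> p u)\<bar> * sin \<omega>" using om sin_gt_zero[of \<omega>] by simp
      then show ?thesis using out[OF p, of u] by auto
    qed
    note o = bounded_bilinear.continuous_on[OF bounded_bilinear_blinfun_compose]
    have cR: "continuous_on UNIV (\<lambda>u. cresolvent T J (R.pt \<phi> p u))" "continuous_on UNIV (\<lambda>u. cresolvent T J (cnj (R.pt \<phi> p u)))"
      unfolding cq by (rule R.continuous_R_pt[OF om_th th _ ph], rule p q)+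
    have cQ: "continuous_on UNIV (\<lambda>u. Qinv T J (R.pt \<phi> p u))"
      unfolding Qinv_TQinv_from_cresolvent(1)[OF out[OF p]]
      by (intro continuous_on_scaleR continuous_on_divide continuous_on_mult continuous_on_const continuous_on_Im
          o continuous_on_diff cR cpt) (use im in auto)
    have cTQ: "continuous_on UNIV (\<lambda>u. TQinv T J (R.pt \<phi> p u))"
      unfolding Qinv_TQinv_from_cresolvent(2)[OF out[OF p]]
      by (intro continuous_on_diff o cQ cR bounded_linear.continuous_on[OF bounded_linear_rscale]
          continuous_on_cnj cpt)
    have cc: "continuous_on UNIV (R.coef \<phi> h p)" by (rule R.coef_integrable(2)[OF om_th th p ph h])
    show ?thesis
      unfolding X_def calc_op_def
      by (intro continuous_on_diff o cQ cTQ bounded_linear.continuous_on[OF bounded_linear_lscale]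
          continuous_on_mult continuous_on_cnj cpt cc)
  qed
  obtain C where C: "C \<ge> 0" "\<And>z a. z \<noteq> 0 \<Longrightarrow> z \<notin> bisector \<phi> \<Longrightarrow> norm (calc_op I z (a * z)) \<le> C * norm a"
    using norm_calc_op_le[OF ph(1) ph2] by metis
  have Xle: "norm (X p u) \<le> C * norm (h (R.pt \<phi> p u))" if p: "p \<in> R.signs" for p u
  proof -
    have "R.coef \<phi> h p u = (- of_real (snd p) / (2 * pi * \<i>) * h (R.pt \<phi> p u)) * R.pt \<phi> p u"
      by (simp add: R.coef_def)
    then have "norm (X p u) \<le> C * norm (- of_real (snd p) / (2 * pi * \<i>) * h (R.pt \<phi> p u))"
      unfolding X_def using C(2)[OF R.pt_not_bisector[OF om_th th p ph]] by metis
    also have "\<dots> \<le> C * (1 * norm (h (R.pt \<phi> p u)))"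
      unfolding norm_mult[of _ "h _"] using C(1) R.signs_D(3)[OF om_th th p, of 1] pi_gt3
      by (intro mult_left_mono mult_right_mono) (auto simp: norm_divide norm_mult)
    finally show ?thesis by simp
  qed
  have hI: "(\<lambda>u. c * norm (h (R.pt \<phi> p u))) integrable_on UNIV" if p: "p \<in> R.signs" for p c
    using integrable_cmul[OF R.integrable_f_pt[OF om_th th p ph h], of c] by simp
  have XI: "X p integrable_on UNIV" if p: "p \<in> R.signs" for p
    by (rule integrable_on_UNIV_dominated[OF contX[OF p] Xle[OF p] hI[OF p]])
  have YI: "Y p integrable_on UNIV" if p: "p \<in> R.signs" for p
    using R.coef_integrable(1)[OF om_th th p ph h] unfolding Y_def .
  have int: "integral UNIV (k \<sigma>) = (2 * pi) *\<^sub>R (integral UNIV (X (\<sigma>, -1)) + integral UNIV (X (\<sigma>, 1)))"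
    if s: "\<sigma> \<in> {1, -1}" for \<sigma>
  proof -
    have le: "norm ((2 * pi) *\<^sub>R X p u) \<le> (2 * pi * C) * norm (h (R.pt \<phi> p u))" if "p \<in> R.signs" for p u
      using mult_left_mono[OF Xle[OF that, of u], of "2 * pi"] by (simp add: mult.assoc)
    have "(k \<sigma> has_integral integral UNIV (\<lambda>u. exp u *\<^sub>R k \<sigma> (exp u))) {0<..}"
      by (rule has_integral_Ioi_exp_substitution[where k = "\<lambda>u. (2 * pi * C) * norm (h (R.pt \<phi> (\<sigma>, -1) u))"])
         (unfold kpos[OF s], (intro continuous_on_scaleR continuous_on_const contX le hI sgn s)+)
    moreover have "((\<lambda>t. k \<sigma> (- t)) has_integral integral UNIV (\<lambda>u. exp u *\<^sub>R k \<sigma> (- exp u))) {0<..}"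
      by (rule has_integral_Ioi_exp_substitution[where k = "\<lambda>u. (2 * pi * C) * norm (h (R.pt \<phi> (\<sigma>, 1) u))"])
         (unfold kneg[OF s], (intro continuous_on_scaleR continuous_on_const contX le hI sgn s)+)
    ultimately have "(k \<sigma> has_integral (integral UNIV (\<lambda>u. exp u *\<^sub>R k \<sigma> (exp u))
        + integral UNIV (\<lambda>u. exp u *\<^sub>R k \<sigma> (- exp u)))) UNIV"
      by (rule has_integral_two_sided)
    then show ?thesis
      unfolding kpos[OF s] kneg[OF s] by (simp add: integral_unique scaleR_add_right)
  qed
  have XY: "integral UNIV (X (\<sigma>, -1)) + integral UNIV (X (\<sigma>, 1)) = integral UNIV (Y (\<sigma>, 1)) + integral UNIV (Y (\<sigma>, -1))"
    if s: "\<sigma> \<in> {1, -1}" for \<sigma>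
  proof -
    have "integral UNIV (\<lambda>u. X (\<sigma>, 1) u + X (\<sigma>, -1) u) = integral UNIV (\<lambda>u. Y (\<sigma>, 1) u + Y (\<sigma>, -1) u)"
      unfolding pair[OF s] ..
    then show ?thesis using XI YI sgn[OF s] by (simp add: integral_add add.commute)
  qed
  have "omega_calculus \<phi> I T f = (1 / (2 * pi)) *\<^sub>R (\<Sum>\<sigma>\<in>{1, -1}. integral UNIV (k \<sigma>))"
    by (simp add: omega_calculus_def k_def[abs_def])
  also have "\<dots> = (\<Sum>\<sigma>\<in>{1, -1}. integral UNIV (Y (\<sigma>, 1)) + integral UNIV (Y (\<sigma>, -1)))"
    using int XY by (simp flip: scaleR_add_right)
  also have "\<dots> = R.Op \<phi> h"
    by (simp add: R.Op_def R.sum_signs Y_def[abs_def] add.assoc)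
  finally show ?thesis .
qed

lemma Op_power:
  assumes ph: "\<omega> < \<phi>" "\<phi> < \<theta>" and th: "\<theta> < pi / 2" and h: "bisector_fun \<theta> h"
  shows "blinfun_apply (R.Op \<phi> (\<lambda>z. h z ^ Suc k)) v = (blinfun_apply (R.Op \<phi> h) ^^ Suc k) v"
proof (induction k arbitrary: v)
  case (Suc k)
  have om_th: "\<omega> < \<theta>" "0 < \<theta>" using ph om by auto
  have "R.Op \<phi> (\<lambda>z. h z * h z ^ Suc k) = R.Op \<phi> h o\<^sub>L R.Op \<phi> (\<lambda>z. h z ^ Suc k)"
    by (rule R.Op_mult[OF om_th(1) th ph h bisector_fun_power[OF om_th(2) th h]])
  then show ?case using Suc by simp
qed simp

end

end

section \<open>Polynomials of the operator\<close>

lemma op_power_total_op: "op_power (total_op B) k v = Some ((blinfun_apply B ^^ k) v)"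
  by (induction k) (simp_all add: total_op_def map_comp_def)

lemma embed_sum: "embed J (sum f S) = (\<Sum>k\<in>S. embed J (f k))"
  by (induction S rule: infinite_finite_induct) (simp_all add: embed_linear)

theorem corollary3p14:
  fixes T :: "('v::banach, 'n::{finite,linorder}) clifford_module \<rightharpoonup> ('v, 'n) clifford_module"
    and g :: "'n clifford \<Rightarrow> 'n clifford"
    and p :: "real poly"
    and \<omega> \<theta> :: real
  assumes "0 < \<omega>" and "\<omega> < pi / 2" and "bisectorial \<omega> T"
    and "\<omega> < \<theta>" and "\<theta> < pi / 2" and "g \<in> intrinsic0 \<theta>"
    and "p \<noteq> 0" and "coeff p 0 = 0"
  shows "poly_comp p g \<in> SH_L0 \<theta> \<and>
    (\<forall>\<phi>\<in>{\<omega><..<\<theta>}. \<forall>\<phi>'\<in>{\<omega><..<\<theta>}. \<forall>J\<in>unit_sphere. \<forall>J'\<in>unit_sphere.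
       total_op (omega_calculus \<phi> J T (poly_comp p g))
         = poly_op p (total_op (omega_calculus \<phi>' J' T g)))"
proof -
  have th: "0 < \<theta>" "\<theta> < pi / 2" using assms by auto
  have g: "g \<in> intrinsic (double_sector \<theta>)" "g \<in> SH_L0 \<theta>" using assms by (auto simp: intrinsic0_def)
  obtain h where hol: "h holomorphic_on bisector \<theta>" and rep: "represents \<theta> h g"
    by (rule intrinsic_represents[OF th g(1)])
  have h: "bisector_fun \<theta> h" by (rule SH_L0_bisector_fun[OF th hol rep g(2)])
  \<comment> \<open>The sum starts at 1 since the constant coefficient vanishes; a term with
    exponent 0 would not be a \<open>bisector_fun\<close>.\<close>
  define hp where "hp z = (\<Sum>k\<in>{1..degree p}. of_real (coeff p k) * h z ^ k)" for z
  have pow: "bisector_fun \<theta> (\<lambda>z. h z ^ k)" if "k \<in> {1..degree p}" for k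
    using that bisector_fun_power[OF th h, of "k - 1"] by simp
  have bhp: "bisector_fun \<theta> hp"
    unfolding hp_def[abs_def] by (rule bisector_fun_lincomb[OF th]) (use pow in auto)
  have atMost_eq: "{..degree p} = insert 0 {1..degree p}" by auto
  have rep': "represents \<theta> hp (poly_comp p g)"
    unfolding represents_def
  proof (intro conjI ballI)
    fix z assume z: "z \<in> bisector \<theta>"
    show "hp (cnj z) = cnj (hp z)" using rep z by (simp add: hp_def represents_def)
    fix J :: "'n clifford" assume J: "J \<in> unit_sphere"
    have "poly_comp p g (embed J z) = (\<Sum>k\<in>{1..degree p}. coeff p k *\<^sub>R embed J (h z ^ k))"
      using rep z J assms(8)
      by (simp add: poly_comp_def represents_def cl_power_embed[OF J] atMost_eq del: cl_power.simps)
    also have "\<dots> = embed J (hp z)"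
      by (simp add: hp_def embed_sum embed_linear flip: scaleR_conv_of_real)
    finally show "poly_comp p g (embed J z) = embed J (hp z)" .
  qed
  have "poly_comp p g \<in> SH_L0 \<theta>"
    by (rule represents_SH_L0[OF th bhp rep']) (use g(1) in \<open>simp_all add: intrinsic_def\<close>)
  moreover have "total_op (omega_calculus \<phi> J T (poly_comp p g)) = poly_op p (total_op (omega_calculus \<phi>' J' T g))"
    if ph: "\<phi> \<in> {\<omega><..<\<theta>}" "\<phi>' \<in> {\<omega><..<\<theta>}" and J: "J \<in> unit_sphere" "J' \<in> unit_sphere" for \<phi> \<phi>' J J'
  proof -
    \<comment> \<open>Both sides are expressed by the one resolvent built from \<open>J\<close>. The
      unit \<open>J'\<close> disappears by \<open>omega_calculus_eq_Op\<close> and the angle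
      \<open>\<phi>'\<close> by angle independence.\<close>
    interpret R: bisectorial_resolvent "\<lambda>z X. rscale J z o\<^sub>L X" "(o\<^sub>L)" "cresolvent T J" \<omega>
      by (rule bisectorial_resolvent_cresolvent[OF assms(1-3) J(1)])
    have p1: "\<omega> < \<phi>" "\<phi> < \<theta>" and p2: "\<omega> < \<phi>'" "\<phi>' < \<theta>" using ph by auto
    define B where "B = R.Op \<phi> h"
    have "omega_calculus \<phi>' J' T g = R.Op \<phi>' h"
      by (rule omega_calculus_eq_Op[OF assms(1-3) J(1) J(2) p2 th(2) h rep])
    also have "\<dots> = B" unfolding B_def by (rule R.Op_angle_independent[OF assms(4) th(2) p2 p1 h])
    finally have 1: "omega_calculus \<phi>' J' T g = B" .
    have "omega_calculus \<phi> J T (poly_comp p g) = R.Op \<phi> hp"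
      by (rule omega_calculus_eq_Op[OF assms(1-3) J(1) J(1) p1 th(2) bhp rep'])
    also have "\<dots> = (\<Sum>k\<in>{1..degree p}. coeff p k *\<^sub>R R.Op \<phi> (\<lambda>z. h z ^ k))"
      unfolding hp_def[abs_def] by (rule R.Op_lincomb[OF assms(4) th(2) p1]) (use pow in auto)
    finally have 2: "omega_calculus \<phi> J T (poly_comp p g) = (\<Sum>k\<in>{1..degree p}. coeff p k *\<^sub>R R.Op \<phi> (\<lambda>z. h z ^ k))" .
    have pw: "blinfun_apply (R.Op \<phi> (\<lambda>z. h z ^ k)) v = (blinfun_apply B ^^ k) v" if k: "k \<in> {1..degree p}" for k v
      proof -
      obtain j where j: "k = Suc j" using k by (cases k) auto
      show ?thesis using Op_power[OF assms(1-3) J(1) p1 th(2) h, of j v] by (simp only: j B_def)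
    qed
    show ?thesis
    proof
      fix v
      have "blinfun_apply (\<Sum>k\<in>{1..degree p}. coeff p k *\<^sub>R R.Op \<phi> (\<lambda>z. h z ^ k)) v
          = (\<Sum>k\<in>{1..degree p}. coeff p k *\<^sub>R (blinfun_apply B ^^ k) v)"
        by (simp add: blinfun.sum_left blinfun.scaleR_left pw)
      also have "\<dots> = (\<Sum>k\<le>degree p. coeff p k *\<^sub>R (blinfun_apply B ^^ k) v)"
        using assms(8) by (simp add: atMost_eq)
      finally show "total_op (omega_calculus \<phi> J T (poly_comp p g)) v = poly_op p (total_op (omega_calculus \<phi>' J' T g)) v"
        unfolding 1 2 by (simp add: poly_op_def op_power_total_op dom_def) (simp add: total_op_def)
    qed
  qed
  ultimately show ?thesis by blast
qed

end
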